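(* Assume that $\mathbf{E}^\varepsilon$ and $b$ satisfy the global Lipschitz conditions recalled in the context, that $\mathbf{E}^\varepsilon\in\mathcal{C}^3([0,T]\times\mathbb{R}^2)$ with partial derivatives of order at most $3$ bounded on compact subsets of $[0,T]\times\mathbb{R}^2$ uniformly in $\varepsilon\in(0,1]$, and that $b\in\mathcal{C}^3(\mathbb{R}^2)$ with $b\ge c_0>0$. Let $(X_k,Y_k)$ be the solution on $[0,S_k]\times\mathbb{T}$ of the two-scale system $$\partial_s X_k+\frac1\varepsilon\partial_\tau X_k=\frac{e^{\tau J}}{b_k}Y_k,\qquad \partial_s Y_k+\frac1\varepsilon\partial_\tau Y_k=\frac1\varepsilon\Big(\frac{b(X_k)}{b_k}-1\Big)JY_k+e^{-\tau J}\frac{\mathbf{E}^\varepsilon(s/b_k,X_k)}{b_k},$$ with initial data $X_k(0,\tau)=X_k^{2nd}(\tau)$, $Y_k(0,\tau)=Y_k^{1st}(\tau)$ (defined in the context). For $\Delta t>0$ let $\Delta s=b_k\Delta t$, $t_n=n\Delta t$, $s_n=n\Delta s$, and let $X_k^n,Y_k^n:\mathbb{T}\to\mathbb{R}^2$ be given by the scheme $$\frac{X_k^{n+1}-X_k^n}{\Delta s}+\frac1\varepsilon\partial_\tau X_k^{n+1}=\frac{e^{\tau J}}{b_k}Y_k^{n+1},$$ $$\frac{Y_k^{n+1}-Y_k^n}{\Delta s}+\frac1\varepsilon\partial_\tau Y_k^{n+1}=\frac1\varepsilon\Big(\frac{b(X_k^n)}{b_k}-1\Big)JY_k^n+e^{-\tau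 J}\frac{\mathbf{E}^\varepsilon(t_n,X_k^n)}{b_k},$$ with $X_k^0=X_k^{2nd}$, $Y_k^0=Y_k^{1st}$. Then there exist constants $C_0,C_1,C_2>0$ independent of $\varepsilon$ (and of $\Delta s$ and $n$) such that, whenever $0<\Delta s\le C_0$, for all integers $0\le n\le S_k/\Delta s$, $$\frac1\varepsilon\|X_k^n-X_k(s_n,\cdot)\|_{L^\infty_\tau}+\|Y_k^n-Y_k(s_n,\cdot)\|_{L^\infty_\tau}\le C_1\Delta s,$$ $$\|X_k^n-\mathbf{x}_{k,0}\|_{L^\infty_\tau}\le C_2\,\varepsilon,\qquad \|Y_k^n\|_{L^\infty_\tau}\le \|Y_k\|_{L^\infty_s(L^\infty_\tau)}+1 .$$
   Context: Fix $T>0$ and a particle index $k$, with initial position $\mathbf{x}_{k,0}\in\mathbb{R}^2$ and velocity $\mathbf{v}_{k,0}\in\mathbb{R}^2$ independent of $\varepsilon$. $\varepsilon\in(0,1]$ is a parameter, $J=\begin{pmatrix}0&1\\-1&0\end{pmatrix}$, $\mathbb{T}=\mathbb{R}/(2\pi\mathbb{Z})$. $b:\mathbb{R}^2\to\mathbb{R}$ is a given function (independent of $\varepsilon$) with $b(\mathbf{x})\ge c_0>0$ for all $\mathbf{x}$; $b_k:=b(\mathbf{x}_{k,0})$, $S_k:=Tb_k$. $\mathbf{E}^\varepsilon:[0,T]\times\mathbb{R}^2\to\mathbb{R}^2$ is a given external field. Global Lipschitz conditions: there are constants $C_{\mathbf{E}},C_b>0$ independent of $\varepsilon$ with $|\mathbf{E}^\varepsilon(t,\mathbf{x}_1)-\mathbf{E}^\varepsilon(t,\mathbf{x}_2)|\le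 C_{\mathbf{E}}|\mathbf{x}_1-\mathbf{x}_2|$ and $|b(\mathbf{x}_1)-b(\mathbf{x}_2)|\le C_b|\mathbf{x}_1-\mathbf{x}_2|$ for all $\mathbf{x}_1,\mathbf{x}_2\in\mathbb{R}^2$, $t\in[0,T]$. Operators on functions of $\tau\in\mathbb{T}$ (acting componentwise on vectors and matrices): $\Pi u=\frac1{2\pi}\int_0^{2\pi}u(\theta)\,d\theta$; for zero-average $u$, $L^{-1}u(\tau)=(I-\Pi)\int_0^\tau u(\theta)\,d\theta$; $A:=L^{-1}(I-\Pi)$. Initial data: $$X_k^{1st}(\tau)=\mathbf{x}_{k,0}-\frac{\varepsilon}{b_k}J(e^{\tau J}-I)\mathbf{v}_{k,0},$$ $$Y_k^{1st}(\tau)=\mathbf{v}_{k,0}+\int_0^\tau(I-\Pi)\Big[\frac{b(X_k^{1st}(\sigma))}{b_k}-1\Big]d\sigma\,J\mathbf{v}_{k,0}+\varepsilon J(e^{-\tau J}-I)\frac{\mathbf{E}^\varepsilon(0,\mathbf{x}_{k,0})}{b_k},$$ $$\mathbf{h}_k^{2nd}(\tau)=\frac{\varepsilon}{b_k}A\big(e^{\tau J}Y_k^{1st}\big)-\frac{\varepsilon^2}{b_k}\big(L^{-1}Ae^{\tau J}\big)\,\Pi\Big[\frac1\varepsilon\Big(\frac{b(X_k^{1st})}{b_k}-1\Big)\Big]J\mathbf{v}_{k,0},$$ $$X_k^{2nd}(\tau)=\mathbf{x}_{k,0}+\mathbf{h}_k^{2nd}(\tau)-\mathbf{h}_k^{2nd}(0).$$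 Norms: $\|\cdot\|_{L^\infty_\tau}$ is the sup norm over $\tau\in\mathbb{T}$ (for vectors, the maximum of the norms of the two components); $L^\infty_s(L^\infty_\tau)$ is the supremum over $s\in[0,S_k]$ of the $L^\infty_\tau$ norm. *)

theory Defs
  imports "HOL-Analysis.Analysis"
begin

section \<open>Classes \<open>C\<^sup>k\<close> on a set\<close>

text \<open>
  The difference quotient only uses points of \<open>S\<close>, so partial derivatives at boundary points
  of a box such as \<open>{0..T} \<times> UNIV\<close> are one-sided.
\<close>

definition partial_deriv ::
    "'a::euclidean_space set \<Rightarrow> 'a \<Rightarrow> ('a \<Rightarrow> 'b::real_normed_vector) \<Rightarrow> 'a \<Rightarrow> 'b" where
  "partial_deriv S e f z = vector_derivative (\<lambda>h. f (z + h *\<^sub>R e)) (at 0 within {h. z + h *\<^sub>R e \<in> S})"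

text \<open>
  Iterated partial derivatives, indexed by the list of coordinate directions; the order is
  the length of the list and the empty list gives the function itself.
\<close>

definition iter_partial ::
    "'a::euclidean_space set \<Rightarrow> 'a list \<Rightarrow> ('a \<Rightarrow> 'b::real_normed_vector) \<Rightarrow> 'a \<Rightarrow> 'b" where
  "iter_partial S es f = foldr (partial_deriv S) es f"

definition Ck_on ::
    "nat \<Rightarrow> ('a::euclidean_space \<Rightarrow> 'b::real_normed_vector) \<Rightarrow> 'a set \<Rightarrow> bool" where
  "Ck_on k f S \<longleftrightarrow>
     (\<forall>es. set es \<subseteq> Basis \<and> length es < k \<longrightarrow>
        (\<forall>e\<in>Basis. \<forall>z\<in>S. (\<lambda>h. iter_partial S es f (z + h *\<^sub>R e))
           differentiable (at 0 within {h. z + h *\<^sub>R e \<in> S}))) \<and>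
     (\<forall>es. set es \<subseteq> Basis \<and> length es \<le> k \<longrightarrow> continuous_on S (iter_partial S es f))"


section \<open>The matrix \<open>J\<close> and the matrix exponential\<close>

definition J :: "real^2^2" where
  "J = vector [vector [0, 1], vector [-1, 0]]"

text \<open>
  The library function \<^const>\<open>exp\<close> is not available on \<open>real^'n^'n\<close>, which is not an instance of
  \<^class>\<open>real_normed_algebra_1\<close>; moreover the type-class multiplication there is componentwise,
  hence the explicit iteration of the matrix product.
\<close>

definition mexp :: "real^'n^'n \<Rightarrow> real^'n^'n" where
  "mexp M = (\<Sum>j. (1 / fact j) *\<^sub>R (((\<lambda>N. M ** N) ^^ j) (mat 1)))"


section \<open>Functions of the fast variable\<close>

text \<open>
  A function on the torus \<open>\<real>/2\<pi>\<int>\<close> is represented by a \<open>2\<pi>\<close>-periodic function on \<open>\<real>\<close>.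
\<close>

abbreviation torus_fun :: "(real \<Rightarrow> 'a) \<Rightarrow> bool" where
  "torus_fun u \<equiv> periodic_fun_simple u (2 * pi)"

definition avg :: "(real \<Rightarrow> 'a::{banach, second_countable_topology}) \<Rightarrow> 'a" where
  "avg u = (1 / (2 * pi)) *\<^sub>R (LBINT \<theta>=0..2 * pi. u \<theta>)"

text \<open>\<open>I - \<Pi>\<close>:\<close>

definition osc :: "(real \<Rightarrow> 'a::{banach, second_countable_topology}) \<Rightarrow> real \<Rightarrow> 'a" where
  "osc u \<tau> = u \<tau> - avg u"

definition L_inv :: "(real \<Rightarrow> 'a::{banach, second_countable_topology}) \<Rightarrow> real \<Rightarrow> 'a" where
  "L_inv u = osc (\<lambda>\<tau>. LBINT \<theta>=0..\<tau>. u \<theta>)"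

definition A_op :: "(real \<Rightarrow> 'a::{banach, second_countable_topology}) \<Rightarrow> real \<Rightarrow> 'a" where
  "A_op u = L_inv (osc u)"

definition Linf_norm :: "(real \<Rightarrow> real^2) \<Rightarrow> real" where
  "Linf_norm u = max (SUP \<tau>. \<bar>u \<tau> $ 1\<bar>) (SUP \<tau>. \<bar>u \<tau> $ 2\<bar>)"

definition Linf_Linf_norm :: "real \<Rightarrow> (real \<Rightarrow> real \<Rightarrow> real^2) \<Rightarrow> real" where
  "Linf_Linf_norm S U = (SUP s\<in>{0..S}. Linf_norm (U s))"


section \<open>Prepared initial data\<close>

text \<open>
  Below \<open>x0\<close>, \<open>v0\<close> are the initial position and velocity of the particle, so that
  \<open>b\<^sub>k = b x0\<close>; the field \<open>\<^bold>E\<^sup>\<epsilon>(t, x)\<close> is \<open>E \<epsilon> t x\<close>.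
\<close>

definition X_1st :: "(real^2 \<Rightarrow> real) \<Rightarrow> real^2 \<Rightarrow> real^2 \<Rightarrow> real \<Rightarrow> real \<Rightarrow> real^2" where
  "X_1st b x0 v0 \<epsilon> \<tau> = x0 - (\<epsilon> / b x0) *\<^sub>R ((J ** (mexp (\<tau> *\<^sub>R J) - mat 1)) *v v0)"

definition Y_1st ::
    "(real^2 \<Rightarrow> real) \<Rightarrow> (real \<Rightarrow> real \<Rightarrow> real^2 \<Rightarrow> real^2) \<Rightarrow> real^2 \<Rightarrow> real^2 \<Rightarrow> real \<Rightarrow> real \<Rightarrow> real^2" where
  "Y_1st b E x0 v0 \<epsilon> \<tau> =
     v0 + (LBINT \<sigma>=0..\<tau>. osc (\<lambda>\<sigma>'. b (X_1st b x0 v0 \<epsilon> \<sigma>') / b x0 - 1) \<sigma>) *\<^sub>R (J *v v0)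
        + \<epsilon> *\<^sub>R ((J ** (mexp (- \<tau> *\<^sub>R J) - mat 1)) *v ((1 / b x0) *\<^sub>R E \<epsilon> 0 x0))"

definition h_2nd ::
    "(real^2 \<Rightarrow> real) \<Rightarrow> (real \<Rightarrow> real \<Rightarrow> real^2 \<Rightarrow> real^2) \<Rightarrow> real^2 \<Rightarrow> real^2 \<Rightarrow> real \<Rightarrow> real \<Rightarrow> real^2" where
  "h_2nd b E x0 v0 \<epsilon> \<tau> =
     (\<epsilon> / b x0) *\<^sub>R A_op (\<lambda>\<sigma>. mexp (\<sigma> *\<^sub>R J) *v Y_1st b E x0 v0 \<epsilon> \<sigma>) \<tau>
     - (\<epsilon>\<^sup>2 / b x0) *\<^sub>R (L_inv (A_op (\<lambda>\<sigma>. mexp (\<sigma> *\<^sub>R J))) \<tau> *v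
         (avg (\<lambda>\<sigma>. (1 / \<epsilon>) * (b (X_1st b x0 v0 \<epsilon> \<sigma>) / b x0 - 1)) *\<^sub>R (J *v v0)))"

definition X_2nd ::
    "(real^2 \<Rightarrow> real) \<Rightarrow> (real \<Rightarrow> real \<Rightarrow> real^2 \<Rightarrow> real^2) \<Rightarrow> real^2 \<Rightarrow> real^2 \<Rightarrow> real \<Rightarrow> real \<Rightarrow> real^2" where
  "X_2nd b E x0 v0 \<epsilon> \<tau> = x0 + h_2nd b E x0 v0 \<epsilon> \<tau> - h_2nd b E x0 v0 \<epsilon> 0"


section \<open>The two-scale system and the numerical scheme\<close>

text \<open>Classical (\<open>C\<^sup>1\<close>) solutions on \<open>[0, T b\<^sub>k] \<times> \<real>/2\<pi>\<int>\<close>.\<close>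

definition two_scale_solution ::
    "(real^2 \<Rightarrow> real) \<Rightarrow> (real \<Rightarrow> real \<Rightarrow> real^2 \<Rightarrow> real^2) \<Rightarrow> real \<Rightarrow> real^2 \<Rightarrow> real^2 \<Rightarrow> real \<Rightarrow>
     (real \<Rightarrow> real \<Rightarrow> real^2) \<Rightarrow> (real \<Rightarrow> real \<Rightarrow> real^2) \<Rightarrow> bool" where
  "two_scale_solution b E T x0 v0 \<epsilon> X Y \<longleftrightarrow>
     Ck_on 1 (\<lambda>(s, \<tau>). X s \<tau>) ({0..T * b x0} \<times> UNIV) \<and>
     Ck_on 1 (\<lambda>(s, \<tau>). Y s \<tau>) ({0..T * b x0} \<times> UNIV) \<and>
     (\<forall>s\<in>{0..T * b x0}. torus_fun (X s) \<and> torus_fun (Y s)) \<and>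
     (\<forall>s\<in>{0..T * b x0}. \<forall>\<tau>.
        vector_derivative (\<lambda>s'. X s' \<tau>) (at s within {0..T * b x0})
          + (1 / \<epsilon>) *\<^sub>R vector_derivative (X s) (at \<tau>)
        = (1 / b x0) *\<^sub>R (mexp (\<tau> *\<^sub>R J) *v Y s \<tau>)) \<and>
     (\<forall>s\<in>{0..T * b x0}. \<forall>\<tau>.
        vector_derivative (\<lambda>s'. Y s' \<tau>) (at s within {0..T * b x0})
          + (1 / \<epsilon>) *\<^sub>R vector_derivative (Y s) (at \<tau>)
        = ((1 / \<epsilon>) * (b (X s \<tau>) / b x0 - 1)) *\<^sub>R (J *v Y s \<tau>)
          + mexp (- \<tau> *\<^sub>R J) *v ((1 / b x0) *\<^sub>R E \<epsilon> (s / b x0) (X s \<tau>))) \<and>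
     (\<forall>\<tau>. X 0 \<tau> = X_2nd b E x0 v0 \<epsilon> \<tau>) \<and>
     (\<forall>\<tau>. Y 0 \<tau> = Y_1st b E x0 v0 \<epsilon> \<tau>)"

text \<open>
  Only the iterates with \<open>s\<^sub>n \<le> T b\<^sub>k\<close> are constrained: the step from \<open>n\<close> to \<open>n + 1\<close> is required
  when \<open>s\<^sub>n\<^sub>+\<^sub>1 \<le> T b\<^sub>k\<close>, so that the field is only evaluated at times \<open>t\<^sub>n \<in> [0, T]\<close>.
\<close>

definition two_scale_scheme ::
    "(real^2 \<Rightarrow> real) \<Rightarrow> (real \<Rightarrow> real \<Rightarrow> real^2 \<Rightarrow> real^2) \<Rightarrow> real \<Rightarrow> real^2 \<Rightarrow> real^2 \<Rightarrow> real \<Rightarrow> real \<Rightarrow>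
     (nat \<Rightarrow> real \<Rightarrow> real^2) \<Rightarrow> (nat \<Rightarrow> real \<Rightarrow> real^2) \<Rightarrow> bool" where
  "two_scale_scheme b E T x0 v0 \<epsilon> \<Delta>t Xn Yn \<longleftrightarrow>
     (let \<Delta>s = b x0 * \<Delta>t in
       (\<forall>\<tau>. Xn 0 \<tau> = X_2nd b E x0 v0 \<epsilon> \<tau>) \<and>
       (\<forall>\<tau>. Yn 0 \<tau> = Y_1st b E x0 v0 \<epsilon> \<tau>) \<and>
       (\<forall>n. real (Suc n) * \<Delta>s \<le> T * b x0 \<longrightarrow>
          torus_fun (Xn (Suc n)) \<and> torus_fun (Yn (Suc n)) \<and>
          (\<forall>\<tau>. Xn (Suc n) differentiable (at \<tau>) \<and> Yn (Suc n) differentiable (at \<tau>) \<and>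
            (1 / \<Delta>s) *\<^sub>R (Xn (Suc n) \<tau> - Xn n \<tau>)
              + (1 / \<epsilon>) *\<^sub>R vector_derivative (Xn (Suc n)) (at \<tau>)
            = (1 / b x0) *\<^sub>R (mexp (\<tau> *\<^sub>R J) *v Yn (Suc n) \<tau>) \<and>
            (1 / \<Delta>s) *\<^sub>R (Yn (Suc n) \<tau> - Yn n \<tau>)
              + (1 / \<epsilon>) *\<^sub>R vector_derivative (Yn (Suc n)) (at \<tau>)
            = ((1 / \<epsilon>) * (b (Xn n \<tau>) / b x0 - 1)) *\<^sub>R (J *v Yn n \<tau>)
              + mexp (- \<tau> *\<^sub>R J) *v ((1 / b x0) *\<^sub>R E \<epsilon> (real n * \<Delta>t) (Xn n \<tau>)))))"

end

theory Submission
  imports Defs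
begin

text \<open>
  With \<open>Z = (X - x\<^sub>0) / \<epsilon> + J e\<^bsup>\<tau>J\<^esup> Y / b\<^sub>0\<close> and \<open>P = (Z, Y)\<close> the two-scale system becomes
  \<open>\<partial>\<^sub>s P + \<epsilon>\<^sup>-\<^sup>1 \<partial>\<^sub>\<tau> P = F(s, \<tau>, P)\<close>, where \<open>F\<close> is \<open>C\<^sup>1\<^sup>,\<^sup>1\<close> in \<open>(s, P)\<close> uniformly in \<open>\<epsilon>\<close>: the change of
  unknown integrates the oscillating source \<open>e\<^bsup>\<tau>J\<^esup> Y / b\<^sub>0\<close> exactly, and \<open>(b(x\<^sub>0 + \<epsilon> q) / b\<^sub>0 - 1) / \<epsilon>\<close> is regular
  in \<open>q\<close>. Since \<open>\<epsilon>\<^sup>-\<^sup>1 \<partial>\<^sub>\<tau>\<close> plus a backward difference obeys the Leibniz rule for factors depending on \<open>\<tau>\<close> only,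
  the same substitution turns the scheme into the implicit-explicit Euler scheme for \<open>P\<close>. The implicit step is a
  contraction for the supremum norm, so the error is of order \<open>\<Delta>s\<close> as soon as \<open>\<partial>\<^sub>s P\<close> is Lipschitz in \<open>s\<close>,
  uniformly in \<open>\<epsilon>\<close>. Along characteristics this propagates from \<open>s = 0\<close>, where it amounts to \<open>\<partial>\<^sub>s P(0, \<tau>)\<close>
  being bounded and Lipschitz in \<open>\<tau>\<close> with constant \<open>O(\<epsilon>)\<close>; the prepared initial data are chosen to ensure this.
\<close>

section \<open>A derivative-free \<open>C\<^sup>1\<^sup>,\<^sup>1\<close> bound\<close>

text \<open>The solution is only of class C^1, so \<partial>_s^2 P need not exist. Its role is
  played by second differences of P in s: along a characteristic they obey a Gronwall inequality,
  and dividing by one of the two steps and letting it tend to zero leaves a Lipschitz bound of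
  \<partial>_s P. Hence F is controlled through four of its values, and all four points share the
  same \<tau>: along a characteristic one derivative in \<tau> would cost a factor 1/\<epsilon>. Two
  further obstacles shape the proof. F may grow quadratically in P, so Gronwall does not bound P at
  once. Since J Y is orthogonal to Y, an energy estimate free of 1/\<epsilon> bounds Y and X - x0
  first; with Y bounded, the growth of F in P is linear and Gronwall applies. And nothing is known
  beforehand about the size of the numerical iterates: the constants of F are taken on a ball of
  radius R + 1, and the restriction on the step keeps the iterates within distance 1 of the exact
  solution, whose norm is at most R.\<close>

text \<open>
  The points \<open>p\<^sub>i\<^sub>j\<close> are attached to the times \<open>s + i h + j d\<close>; for \<open>F\<close> of class \<open>C\<^sup>2\<close> the bound on the second difference
  follows from bounds on the first two derivatives, and it only involves values of \<open>F\<close>. The variable \<open>\<tau>\<close> is a parameter.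
\<close>

definition c11 :: "real \<Rightarrow> real \<Rightarrow> real \<Rightarrow> (real \<Rightarrow> real \<Rightarrow> 'a::real_normed_vector \<Rightarrow> 'b::real_normed_vector) \<Rightarrow> bool" where
  "c11 L S r F \<longleftrightarrow> 0 \<le> L \<and>
    (\<forall>s\<in>{0..S}. \<forall>s'\<in>{0..S}. \<forall>\<tau> p p'. norm p \<le> r \<longrightarrow> norm p' \<le> r \<longrightarrow>
      norm (F s \<tau> p - F s' \<tau> p') \<le> L * (\<bar>s - s'\<bar> + norm (p - p'))) \<and>
    (\<forall>s h d \<tau> p00 p10 p01 p11. 0 \<le> s \<longrightarrow> 0 \<le> h \<longrightarrow> 0 \<le> d \<longrightarrow> s + h + d \<le> S \<longrightarrow>
      norm p00 \<le> r \<longrightarrow> norm p10 \<le> r \<longrightarrow> norm p01 \<le> r \<longrightarrow> norm p11 \<le> r \<longrightarrow>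
      norm (F (s + h + d) \<tau> p11 - F (s + h) \<tau> p10 - F (s + d) \<tau> p01 + F s \<tau> p00)
        \<le> L * (norm (p11 - p10 - p01 + p00) + (h + norm (p10 - p00)) * (d + norm (p01 - p00))))"

lemma c11I:
  assumes "0 \<le> L"
    "\<And>s s' \<tau> p p'. \<lbrakk>s \<in> {0..S}; s' \<in> {0..S}; norm p \<le> r; norm p' \<le> r\<rbrakk> \<Longrightarrow>
      norm (F s \<tau> p - F s' \<tau> p') \<le> L * (\<bar>s - s'\<bar> + norm (p - p'))"
    "\<And>s h d \<tau> p00 p10 p01 p11. \<lbrakk>0 \<le> s; 0 \<le> h; 0 \<le> d; s + h + d \<le> S;
        norm p00 \<le> r; norm p10 \<le> r; norm p01 \<le> r; norm p11 \<le> r\<rbrakk> \<Longrightarrow>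
      norm (F (s + h + d) \<tau> p11 - F (s + h) \<tau> p10 - F (s + d) \<tau> p01 + F s \<tau> p00)
        \<le> L * (norm (p11 - p10 - p01 + p00) + (h + norm (p10 - p00)) * (d + norm (p01 - p00)))"
  shows "c11 L S r F"
  using assms unfolding c11_def by blast

lemma
  assumes "c11 L S r F"
  shows c11_nonneg: "0 \<le> L"
    and c11_lipschitz: "\<lbrakk>s \<in> {0..S}; s' \<in> {0..S}; norm p \<le> r; norm p' \<le> r\<rbrakk> \<Longrightarrow>
      norm (F s \<tau> p - F s' \<tau> p') \<le> L * (\<bar>s - s'\<bar> + norm (p - p'))"
    and c11_second: "\<lbrakk>0 \<le> s; 0 \<le> h; 0 \<le> d; s + h + d \<le> S;
        norm p00 \<le> r; norm p10 \<le> r; norm p01 \<le> r; norm p11 \<le> r\<rbrakk> \<Longrightarrow>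
      norm (F (s + h + d) \<tau> p11 - F (s + h) \<tau> p10 - F (s + d) \<tau> p01 + F s \<tau> p00)
        \<le> L * (norm (p11 - p10 - p01 + p00) + (h + norm (p10 - p00)) * (d + norm (p01 - p00)))"
  using assms unfolding c11_def by blast+

lemma c11_linear:
  fixes A :: "real \<Rightarrow> 'a::real_normed_vector \<Rightarrow> 'b::real_normed_vector"
  assumes A: "\<And>\<tau>. linear (A \<tau>)" and K: "0 \<le> K" "\<And>\<tau> p. norm (A \<tau> p) \<le> K * norm p"
  shows "c11 K S r (\<lambda>s \<tau>. A \<tau>)"
proof (rule c11I[OF K(1)])
  fix s s' \<tau> :: real and p p' :: 'a
  show "norm (A \<tau> p - A \<tau> p') \<le> K * (\<bar>s - s'\<bar> + norm (p - p'))"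
    using order_trans[OF K(2)[of \<tau> "p - p'"] mult_left_mono[OF _ K(1)]] by (simp add: linear_diff[OF A])
next
  fix s h d \<tau> :: real and p00 p10 p01 p11 :: 'a assume "0 \<le> h" "0 \<le> d"
  then show "norm (A \<tau> p11 - A \<tau> p10 - A \<tau> p01 + A \<tau> p00)
      \<le> K * (norm (p11 - p10 - p01 + p00) + (h + norm (p10 - p00)) * (d + norm (p01 - p00)))"
    using order_trans[OF K(2)[of \<tau> "p11 - p10 - p01 + p00"] mult_left_mono[OF _ K(1)]]
    by (simp add: linear_diff[OF A] linear_add[OF A])
qed

lemma c11_linear_image:
  assumes F: "c11 L S r F"
    and A: "\<And>\<tau>. linear (A \<tau>)" and K: "0 \<le> K" "\<And>\<tau> y. norm (A \<tau> y) \<le> K * norm y"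
  shows "c11 (K * L) S r (\<lambda>s \<tau> p. A \<tau> (F s \<tau> p))"
proof (rule c11I)
  show "0 \<le> K * L" using K c11_nonneg[OF F] by simp
  have A_le: "norm (A \<tau> y) \<le> (K * L) * w" if "norm y \<le> L * w" for \<tau> y w
    using order_trans[OF K(2) mult_left_mono[OF that K(1)]] by (simp add: mult.assoc)
  show "norm (A \<tau> (F s \<tau> p) - A \<tau> (F s' \<tau> p')) \<le> K * L * (\<bar>s - s'\<bar> + norm (p - p'))"
    if "s \<in> {0..S}" "s' \<in> {0..S}" "norm p \<le> r" "norm p' \<le> r" for s s' \<tau> p p'
    unfolding linear_diff[OF A, symmetric] by (rule A_le[OF c11_lipschitz[OF F that]])
  show "norm (A \<tau> (F (s + h + d) \<tau> p11) - A \<tau> (F (s + h) \<tau> p10) - A \<tau> (F (s + d) \<tau> p01) + A \<tau> (F s \<tau> p00))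
      \<le> K * L * (norm (p11 - p10 - p01 + p00) + (h + norm (p10 - p00)) * (d + norm (p01 - p00)))"
    if "0 \<le> s" "0 \<le> h" "0 \<le> d" "s + h + d \<le> S" "norm p00 \<le> r" "norm p10 \<le> r" "norm p01 \<le> r" "norm p11 \<le> r"
    for s h d \<tau> p00 p10 p01 p11
    unfolding linear_diff[OF A, symmetric] linear_add[OF A, symmetric] by (rule A_le[OF c11_second[OF F that]])
qed

text \<open>A linear inner map sends a four-point combination to the four-point combination of the
  images, so it creates no product term. The constant is quadratic in \<open>K\<close> because both
  factors of the product of first differences are scaled; \<open>1 \<le> K\<close> lets the other
  terms be absorbed. The time factor \<open>c\<close> serves the field, evaluated at s / b0.\<close>

lemma c11_compose_linear:
  fixes A :: "real \<Rightarrow> 'a::real_normed_vector \<Rightarrow> 'b::real_normed_vector"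
  assumes F: "c11 L S (K * r) F" and r: "0 \<le> r"
    and A: "\<And>\<tau>. linear (A \<tau>)" and K: "1 \<le> K" "\<And>\<tau> p. norm (A \<tau> p) \<le> K * norm p"
    and c: "0 \<le> c" "c \<le> K" "c * S' \<le> S"
  shows "c11 (K * K * L) S' r (\<lambda>s \<tau> p. F (c * s) \<tau> (A \<tau> p))"
proof -
  have L: "0 \<le> L" by (rule c11_nonneg[OF F])
  have near: "norm (A \<tau> p) \<le> K * r" if "norm p \<le> r" for \<tau> p
    using K(1) that by (intro order_trans[OF K(2)] mult_left_mono) auto
  have time: "c * s \<le> S" if "s \<le> S'" for s using mult_left_mono[OF that c(1)] c(3) by linarith
  have A_diff: "norm (A \<tau> p - A \<tau> p') \<le> K * norm (p - p')" for \<tau> p p'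
    unfolding linear_diff[OF A, symmetric] by (rule K(2))
  have c_le: "c * h \<le> K * h" if "0 \<le> h" for h using c(2) that by (rule mult_right_mono)
  have KK: "K * w \<le> K * K * w" if "0 \<le> w" for w using K(1) that by (simp add: mult_right_mono)
  show ?thesis
  proof (rule c11I)
    show "0 \<le> K * K * L" using K L by simp
  next
    fix s s' \<tau> and p p' :: 'a assume a: "s \<in> {0..S'}" "s' \<in> {0..S'}" "norm p \<le> r" "norm p' \<le> r"
    have "norm (F (c * s) \<tau> (A \<tau> p) - F (c * s') \<tau> (A \<tau> p')) \<le> L * (\<bar>c * s - c * s'\<bar> + norm (A \<tau> p - A \<tau> p'))"
      by (rule c11_lipschitz[OF F]) (use a c time near in auto)
    also have "\<dots> \<le> L * (K * \<bar>s - s'\<bar> + K * norm (p - p'))"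
      using A_diff c_le[of "\<bar>s - s'\<bar>"] c(1) L
      by (intro mult_left_mono add_mono) (simp_all add: abs_mult flip: right_diff_distrib)
    also have "\<dots> \<le> L * (K * K * (\<bar>s - s'\<bar> + norm (p - p')))"
      unfolding distrib_left[symmetric] by (intro mult_left_mono KK L) simp
    finally show "norm (F (c * s) \<tau> (A \<tau> p) - F (c * s') \<tau> (A \<tau> p')) \<le> K * K * L * (\<bar>s - s'\<bar> + norm (p - p'))"
      by (simp add: mult_ac)
  next
    fix s h d \<tau> and p00 p10 p01 p11 :: 'a
    assume a: "0 \<le> s" "0 \<le> h" "0 \<le> d" "s + h + d \<le> S'" and p: "norm p00 \<le> r" "norm p10 \<le> r" "norm p01 \<le> r" "norm p11 \<le> r"
    have "c * s + c * h + c * d \<le> S"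
      using mult_left_mono[OF a(4) c(1)] c(3) by (simp add: distrib_left)
    then have "norm (F (c * s + c * h + c * d) \<tau> (A \<tau> p11) - F (c * s + c * h) \<tau> (A \<tau> p10) - F (c * s + c * d) \<tau> (A \<tau> p01) + F (c * s) \<tau> (A \<tau> p00))
        \<le> L * (norm (A \<tau> p11 - A \<tau> p10 - A \<tau> p01 + A \<tau> p00) + (c * h + norm (A \<tau> p10 - A \<tau> p00)) * (c * d + norm (A \<tau> p01 - A \<tau> p00)))"
      using a c p near by (intro c11_second[OF F]) auto
    also have "\<dots> \<le> L * ((K * K) * norm (p11 - p10 - p01 + p00) + (K * (h + norm (p10 - p00))) * (K * (d + norm (p01 - p00))))"
    proof (intro mult_left_mono add_mono mult_mono L)
      have "norm (A \<tau> (p11 - p10 - p01 + p00)) \<le> (K * 1) * norm (p11 - p10 - p01 + p00)" using K(2) by simp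
      also have "\<dots> \<le> (K * K) * norm (p11 - p10 - p01 + p00)" using K(1) by (intro mult_right_mono mult_left_mono) auto
      finally show "norm (A \<tau> p11 - A \<tau> p10 - A \<tau> p01 + A \<tau> p00) \<le> (K * K) * norm (p11 - p10 - p01 + p00)"
        by (simp add: linear_diff[OF A] linear_add[OF A])
      show "c * h + norm (A \<tau> p10 - A \<tau> p00) \<le> K * (h + norm (p10 - p00))"
        "c * d + norm (A \<tau> p01 - A \<tau> p00) \<le> K * (d + norm (p01 - p00))"
        using A_diff[of \<tau> p10 p00] A_diff[of \<tau> p01 p00] c_le[OF a(2)] c_le[OF a(3)] by (simp_all add: distrib_left)
    qed (use K a c in auto)
    finally show "norm (F (c * (s + h + d)) \<tau> (A \<tau> p11) - F (c * (s + h)) \<tau> (A \<tau> p10) - F (c * (s + d)) \<tau> (A \<tau> p01) + F (c * s) \<tau> (A \<tau> p00))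
        \<le> K * K * L * (norm (p11 - p10 - p01 + p00) + (h + norm (p10 - p00)) * (d + norm (p01 - p00)))"
      by (simp add: algebra_simps)
  qed
qed

lemma c11_add:
  assumes F: "c11 L S r F" and G: "c11 M S r G"
  shows "c11 (L + M) S r (\<lambda>s \<tau> p. F s \<tau> p + G s \<tau> p)"
proof (rule c11I)
  show "0 \<le> L + M" using c11_nonneg[OF F] c11_nonneg[OF G] by simp
  show "norm (F s \<tau> p + G s \<tau> p - (F s' \<tau> p' + G s' \<tau> p')) \<le> (L + M) * (\<bar>s - s'\<bar> + norm (p - p'))"
    if "s \<in> {0..S}" "s' \<in> {0..S}" "norm p \<le> r" "norm p' \<le> r" for s s' \<tau> p p'
    using norm_triangle_mono[OF c11_lipschitz[OF F that, of \<tau>] c11_lipschitz[OF G that, of \<tau>]]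
    by (simp add: add_diff_add distrib_right)
  show "norm (F (s + h + d) \<tau> p11 + G (s + h + d) \<tau> p11 - (F (s + h) \<tau> p10 + G (s + h) \<tau> p10)
        - (F (s + d) \<tau> p01 + G (s + d) \<tau> p01) + (F s \<tau> p00 + G s \<tau> p00))
      \<le> (L + M) * (norm (p11 - p10 - p01 + p00) + (h + norm (p10 - p00)) * (d + norm (p01 - p00)))"
    if "0 \<le> s" "0 \<le> h" "0 \<le> d" "s + h + d \<le> S" "norm p00 \<le> r" "norm p10 \<le> r" "norm p01 \<le> r" "norm p11 \<le> r"
    for s h d \<tau> p00 p10 p01 p11
  proof -
    have "F (s + h + d) \<tau> p11 + G (s + h + d) \<tau> p11 - (F (s + h) \<tau> p10 + G (s + h) \<tau> p10)
        - (F (s + d) \<tau> p01 + G (s + d) \<tau> p01) + (F s \<tau> p00 + G s \<tau> p00)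
      = (F (s + h + d) \<tau> p11 - F (s + h) \<tau> p10 - F (s + d) \<tau> p01 + F s \<tau> p00)
        + (G (s + h + d) \<tau> p11 - G (s + h) \<tau> p10 - G (s + d) \<tau> p01 + G s \<tau> p00)" by simp
    then show ?thesis
      using norm_triangle_mono[OF c11_second[OF F that, of \<tau>] c11_second[OF G that, of \<tau>]] by (simp only: distrib_right)
  qed
qed

text \<open>A discrete product rule: the mixed difference of a product splits into mixed differences
  of the factors and two products of first differences in opposite directions.\<close>

lemma four_point_scaleR:
  fixes f00 f10 f01 f11 :: real and g00 g10 g01 g11 :: "'a::real_normed_vector"
  assumes f: "\<bar>f11\<bar> \<le> A" and g: "norm g00 \<le> B" "norm g10 \<le> B" "norm g01 \<le> B"
  shows "norm (f11 *\<^sub>R g11 - f10 *\<^sub>R g10 - f01 *\<^sub>R g01 + f00 *\<^sub>R g00)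
    \<le> A * norm (g11 - g10 - g01 + g00) + 5 * B * \<bar>f11 - f10 - f01 + f00\<bar>
      + \<bar>f01 - f00\<bar> * norm (g10 - g00) + \<bar>f10 - f00\<bar> * norm (g01 - g00)"
proof -
  define F where "F = f11 - f10 - f01 + f00"
  define G where "G = g11 - g10 - g01 + g00"
  have eq: "f11 *\<^sub>R g11 - f10 *\<^sub>R g10 - f01 *\<^sub>R g01 + f00 *\<^sub>R g00
      = f11 *\<^sub>R G + F *\<^sub>R (g10 - g00 + (g01 - g00) + g00) + (f01 - f00) *\<^sub>R (g10 - g00) + (f10 - f00) *\<^sub>R (g01 - g00)"
    unfolding F_def G_def by (simp add: algebra_simps)
  \<comment> \<open>Two differences, each at most 2 B, plus one value.\<close>
  have "norm (g10 - g00 + (g01 - g00) + g00) \<le> 5 * B"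
    using norm_triangle_ineq4[of g10 g00] norm_triangle_ineq4[of g01 g00]
      norm_triangle_ineq[of "g10 - g00" "g01 - g00"] norm_triangle_ineq[of "g10 - g00 + (g01 - g00)" g00] g
    by linarith
  then have "norm (F *\<^sub>R (g10 - g00 + (g01 - g00) + g00)) \<le> 5 * B * \<bar>F\<bar>"
    by (simp add: mult_left_mono mult.commute[of "5 * B"])
  moreover have "norm (f11 *\<^sub>R G) \<le> A * norm G"
    using f by (simp add: mult_right_mono)
  ultimately show ?thesis
    unfolding eq F_def[symmetric] G_def[symmetric]
    by (intro order_trans[OF norm_triangle_ineq] add_mono) auto
qed

lemma c11_scaleR:
  fixes f :: "real \<Rightarrow> real \<Rightarrow> 'a::real_normed_vector \<Rightarrow> real"
  assumes f: "c11 L S r f" and G: "c11 M S r G"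
    and A: "\<And>s \<tau> p. \<lbrakk>s \<in> {0..S}; norm p \<le> r\<rbrakk> \<Longrightarrow> \<bar>f s \<tau> p\<bar> \<le> A"
    and B: "\<And>s \<tau> p. \<lbrakk>s \<in> {0..S}; norm p \<le> r\<rbrakk> \<Longrightarrow> norm (G s \<tau> p) \<le> B"
    and AB: "0 \<le> A" "0 \<le> B"
  shows "c11 (A * M + 5 * B * L + 2 * L * M) S r (\<lambda>s \<tau> p. f s \<tau> p *\<^sub>R G s \<tau> p)"
proof (rule c11I)
  have LM: "0 \<le> L" "0 \<le> M" using c11_nonneg f G by auto
  then show C: "0 \<le> A * M + 5 * B * L + 2 * L * M" using AB by simp
  fix s s' \<tau> and p p' :: 'a assume a: "s \<in> {0..S}" "s' \<in> {0..S}" "norm p \<le> r" "norm p' \<le> r"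
  define w where "w = \<bar>s - s'\<bar> + norm (p - p')"
  have eq: "f s \<tau> p *\<^sub>R G s \<tau> p - f s' \<tau> p' *\<^sub>R G s' \<tau> p'
      = f s \<tau> p *\<^sub>R (G s \<tau> p - G s' \<tau> p') + (f s \<tau> p - f s' \<tau> p') *\<^sub>R G s' \<tau> p'"
    by (simp add: algebra_simps)
  have "norm (f s \<tau> p *\<^sub>R (G s \<tau> p - G s' \<tau> p')) \<le> A * (M * w)"
    unfolding norm_scaleR w_def using A[OF a(1,3)] c11_lipschitz[OF G a] AB by (intro mult_mono) auto
  moreover have "norm ((f s \<tau> p - f s' \<tau> p') *\<^sub>R G s' \<tau> p') \<le> (L * w) * B"
    unfolding norm_scaleR w_def using B[OF a(2,4)] c11_lipschitz[OF f a, of \<tau>] LM by (intro mult_mono) auto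
  ultimately have "norm (f s \<tau> p *\<^sub>R G s \<tau> p - f s' \<tau> p' *\<^sub>R G s' \<tau> p') \<le> A * (M * w) + (L * w) * B"
    unfolding eq by (rule norm_triangle_mono)
  also have "\<dots> = (A * M + B * L) * w" by (simp add: algebra_simps)
  also have "\<dots> \<le> (A * M + 5 * B * L + 2 * L * M) * w"
  proof (rule mult_right_mono)
    show "A * M + B * L \<le> A * M + 5 * B * L + 2 * L * M"
      using mult_nonneg_nonneg[OF AB(2) LM(1)] mult_nonneg_nonneg[OF LM] by linarith
  qed (simp add: w_def)
  finally show "norm (f s \<tau> p *\<^sub>R G s \<tau> p - f s' \<tau> p' *\<^sub>R G s' \<tau> p') \<le> (A * M + 5 * B * L + 2 * L * M) * (\<bar>s - s'\<bar> + norm (p - p'))"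
    by (simp add: w_def)
next
  have LM: "0 \<le> L" "0 \<le> M" using c11_nonneg f G by auto
  fix s h d \<tau> and p00 p10 p01 p11 :: 'a
  assume a: "0 \<le> s" "0 \<le> h" "0 \<le> d" "s + h + d \<le> S" and p: "norm p00 \<le> r" "norm p10 \<le> r" "norm p01 \<le> r" "norm p11 \<le> r"
  define N H D where "N = norm (p11 - p10 - p01 + p00)" and "H = h + norm (p10 - p00)" and "D = d + norm (p01 - p00)"
  have HD: "0 \<le> H" "0 \<le> D" "0 \<le> N" using a by (auto simp: N_def H_def D_def)
  have times: "s \<in> {0..S}" "s + h \<in> {0..S}" "s + d \<in> {0..S}" "s + h + d \<in> {0..S}" using a by auto
  have "norm (f (s + h + d) \<tau> p11 *\<^sub>R G (s + h + d) \<tau> p11 - f (s + h) \<tau> p10 *\<^sub>R G (s + h) \<tau> p10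
        - f (s + d) \<tau> p01 *\<^sub>R G (s + d) \<tau> p01 + f s \<tau> p00 *\<^sub>R G s \<tau> p00)
      \<le> A * norm (G (s + h + d) \<tau> p11 - G (s + h) \<tau> p10 - G (s + d) \<tau> p01 + G s \<tau> p00)
        + 5 * B * \<bar>f (s + h + d) \<tau> p11 - f (s + h) \<tau> p10 - f (s + d) \<tau> p01 + f s \<tau> p00\<bar>
        + \<bar>f (s + d) \<tau> p01 - f s \<tau> p00\<bar> * norm (G (s + h) \<tau> p10 - G s \<tau> p00)
        + \<bar>f (s + h) \<tau> p10 - f s \<tau> p00\<bar> * norm (G (s + d) \<tau> p01 - G s \<tau> p00)"
    by (rule four_point_scaleR) (use A B times p in auto)
  also have "\<dots> \<le> A * (M * (N + H * D)) + 5 * B * (L * (N + H * D)) + (L * D) * (M * H) + (L * H) * (M * D)"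
    using c11_second[OF f a p, of \<tau>] c11_second[OF G a p, of \<tau>] AB LM HD
      c11_lipschitz[OF f times(3,1) p(3,1), of \<tau>] c11_lipschitz[OF f times(2,1) p(2,1), of \<tau>]
      c11_lipschitz[OF G times(3,1) p(3,1), of \<tau>] c11_lipschitz[OF G times(2,1) p(2,1), of \<tau>] a
    by (intro add_mono mult_mono mult_left_mono) (auto simp: N_def H_def D_def)
  also have "\<dots> \<le> (A * M + 5 * B * L + 2 * L * M) * (N + H * D)"
    using mult_nonneg_nonneg[OF mult_nonneg_nonneg[OF LM] HD(3)] by (simp add: algebra_simps)
  finally show "norm (f (s + h + d) \<tau> p11 *\<^sub>R G (s + h + d) \<tau> p11 - f (s + h) \<tau> p10 *\<^sub>R G (s + h) \<tau> p10
        - f (s + d) \<tau> p01 *\<^sub>R G (s + d) \<tau> p01 + f s \<tau> p00 *\<^sub>R G s \<tau> p00)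
      \<le> (A * M + 5 * B * L + 2 * L * M) * (norm (p11 - p10 - p01 + p00) + (h + norm (p10 - p00)) * (d + norm (p01 - p00)))"
    by (simp add: N_def H_def D_def)
qed

section \<open>Transport equations with a stiff fast variable\<close>

lemma gronwall_scalar:
  fixes N :: "real \<Rightarrow> real"
  assumes der: "\<And>t. t \<in> {0..S} \<Longrightarrow> (N has_real_derivative N' t) (at t within {0..S})"
    and le: "\<And>t. t \<in> {0..S} \<Longrightarrow> N' t \<le> k * N t"
    and s: "s \<in> {0..S}"
  shows "N s \<le> exp (k * s) * N 0"
proof -
  define g where "g t = exp (- k * t) * N t" for t
  have gd: "(g has_real_derivative exp (- k * t) * (N' t - k * N t)) (at t within {0..S})"
    if "t \<in> {0..S}" for t
    unfolding g_def
    using der[OF that] by (auto intro!: derivative_eq_intros simp: algebra_simps)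
  have "g s \<le> g 0"
  proof (rule DERIV_nonpos_imp_decreasing_open[of 0 s g])
    show "0 \<le> s" using s by simp
    show "continuous_on {0..s} g"
      using s by (intro continuous_on_subset[OF DERIV_continuous_on[OF gd]]) auto
    fix x assume x: "0 < x" "x < s"
    have "(g has_real_derivative exp (- k * x) * (N' x - k * N x)) (at x)"
      using gd[of x] x s by (simp add: at_within_Icc_at)
    moreover have "exp (- k * x) * (N' x - k * N x) \<le> 0"
      using le[of x] x s by (simp add: mult_nonneg_nonpos)
    ultimately show "\<exists>y. DERIV g x :> y \<and> y \<le> 0" by blast
  qed
  then have "exp (k * s) * g s \<le> exp (k * s) * N 0"
    by (simp add: g_def)
  then show ?thesis by (simp add: g_def mult.assoc[symmetric] exp_add[symmetric])
qed

lemma has_real_derivative_inner_self: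
  fixes u :: "real \<Rightarrow> 'a::real_inner"
  assumes "(u has_vector_derivative u') (at t within A)"
  shows "((\<lambda>t. u t \<bullet> u t) has_real_derivative 2 * (u t \<bullet> u')) (at t within A)"
proof -
  have *: "(u has_derivative (\<lambda>h. h *\<^sub>R u')) (at t within A)"
    using assms by (simp add: has_vector_derivative_def)
  have "((\<lambda>t. u t \<bullet> u t) has_derivative (\<lambda>h. u t \<bullet> (h *\<^sub>R u') + (h *\<^sub>R u') \<bullet> u t)) (at t within A)"
    by (rule has_derivative_inner[OF * *])
  moreover have "(\<lambda>h. u t \<bullet> (h *\<^sub>R u') + (h *\<^sub>R u') \<bullet> u t) = (*) (2 * (u t \<bullet> u'))"
    by (auto simp: inner_commute algebra_simps)
  ultimately show ?thesis by (simp add: has_field_derivative_def)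
qed

lemma right_derivative_tendsto:
  fixes f :: "real \<Rightarrow> 'a::real_normed_vector"
  assumes f: "(f has_vector_derivative v) (at s within {a..b})" and "a \<le> s" "s < b"
  shows "((\<lambda>h. (1 / h) *\<^sub>R (f (s + h) - f s)) \<longlongrightarrow> v) (at_right 0)"
proof -
  have "(f has_vector_derivative v) (at s within {s<..<b})"
    by (rule has_vector_derivative_within_subset[OF f]) (use assms in auto)
  then have "((\<lambda>y. (1 / norm (y - s)) *\<^sub>R (f y - (f s + (y - s) *\<^sub>R v))) \<longlongrightarrow> 0) (at_right s)"
    using at_within_nhd[of s "{..<b}" "{s<..<b}" "{s<..}"] \<open>s < b\<close>
      Int_absorb2[of "{s<..<b}" "{..<b}"] greaterThanLessThan_eq[of s b]
    by (auto simp: has_vector_derivative_def has_derivative_within)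
  then have "((\<lambda>h. (1 / norm h) *\<^sub>R (f (s + h) - (f s + h *\<^sub>R v)) + v) \<longlongrightarrow> 0 + v) (at_right 0)"
    by (intro tendsto_add tendsto_const) (simp add: filterlim_at_right_to_0[of _ _ s] add.commute)
  moreover have "\<forall>\<^sub>F h in at_right 0. (1 / norm h) *\<^sub>R (f (s + h) - (f s + h *\<^sub>R v)) + v
      = (1 / h) *\<^sub>R (f (s + h) - f s)"
    unfolding eventually_at_right_field by (intro exI[of _ 1]) (auto simp: algebra_simps)
  ultimately show ?thesis by (simp add: tendsto_cong)
qed

text \<open>Divide by \<open>h\<close> and let it decrease to 0. This turns bounds between
  increments into bounds between slow derivatives without differentiating F.\<close>

lemma right_quotient_norm_le:
  fixes f g :: "real \<Rightarrow> 'a::real_normed_vector"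
  assumes f: "((\<lambda>h. (1 / h) *\<^sub>R f h) \<longlongrightarrow> a) (at_right 0)" and g: "((\<lambda>h. (1 / h) *\<^sub>R g h) \<longlongrightarrow> c) (at_right 0)"
    and le: "\<And>h. \<lbrakk>0 < h; h < \<eta>\<rbrakk> \<Longrightarrow> norm (f h) \<le> K * (norm (g h) + C * h)" and "0 < \<eta>"
  shows "norm a \<le> K * (norm c + C)"
proof (rule tendsto_le[OF trivial_limit_at_right_real])
  show "((\<lambda>h. norm ((1 / h) *\<^sub>R f h)) \<longlongrightarrow> norm a) (at_right 0)"
    "((\<lambda>h. K * (norm ((1 / h) *\<^sub>R g h) + C)) \<longlongrightarrow> K * (norm c + C)) (at_right 0)"
    by (intro tendsto_intros f g)+
  have "norm ((1 / h) *\<^sub>R f h) \<le> K * (norm ((1 / h) *\<^sub>R g h) + C)" if h: "0 < h" "h < \<eta>" for h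
  proof -
    have "(1 / h) * norm (f h) \<le> (1 / h) * (K * (norm (g h) + C * h))"
      using le[OF h] h by (intro mult_left_mono) auto
    also have "\<dots> = K * ((1 / h) * norm (g h) + C)" using h by (simp add: field_simps)
    finally show ?thesis using h by simp
  qed
  then show "\<forall>\<^sub>F h in at_right 0. norm ((1 / h) *\<^sub>R f h) \<le> K * (norm ((1 / h) *\<^sub>R g h) + C)"
    using \<open>0 < \<eta>\<close> unfolding eventually_at_right_field by (intro exI[of _ \<eta>]) auto
qed

text \<open>The norm is not differentiable at 0, so the scalar inequality is applied to |u|^2 + C^2.
  The extra 1 in the rate pays for |u| C \<le> |u|^2 + C^2, and the square root is taken at the end
  through |u 0|^2 + C^2 \<le> (|u 0| + C)^2.\<close>

lemma gronwall_norm: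
  fixes u :: "real \<Rightarrow> 'a::real_inner"
  assumes der: "\<And>t. t \<in> {0..S} \<Longrightarrow> (u has_vector_derivative u' t) (at t within {0..S})"
    and le: "\<And>t. t \<in> {0..S} \<Longrightarrow> norm (u' t) \<le> L * norm (u t) + C"
    and s: "s \<in> {0..S}" and L: "0 \<le> L" and C: "0 \<le> C"
  shows "norm (u s) \<le> exp ((L + 1) * s) * (norm (u 0) + C)"
proof -
  define N where "N t = (norm (u t))\<^sup>2 + C\<^sup>2" for t
  have Nd: "(N has_real_derivative 2 * (u t \<bullet> u' t)) (at t within {0..S})"
    if "t \<in> {0..S}" for t
    using has_real_derivative_inner_self[OF der[OF that]] unfolding N_def power2_norm_eq_inner
    by (auto intro!: derivative_eq_intros)
  have "N s \<le> exp ((2 * (L + 1)) * s) * N 0"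
  proof (rule gronwall_scalar[OF Nd _ s])
    fix t assume t: "t \<in> {0..S}"
    have "u t \<bullet> u' t \<le> norm (u t) * norm (u' t)" by (rule norm_cauchy_schwarz)
    also have "\<dots> \<le> norm (u t) * (L * norm (u t) + C)"
      by (rule mult_left_mono[OF le[OF t]]) simp
    also have "\<dots> = L * (norm (u t))\<^sup>2 + norm (u t) * C"
      by (simp add: power2_eq_square algebra_simps)
    also have "\<dots> \<le> L * (norm (u t))\<^sup>2 + (norm (u t))\<^sup>2 + C\<^sup>2"
      using sum_squares_bound[of "norm (u t)" C] mult_nonneg_nonneg[OF norm_ge_zero[of "u t"] C]
      by linarith
    also have "\<dots> \<le> (L + 1) * N t" using L by (simp add: N_def algebra_simps)
    finally have "2 * (u t \<bullet> u' t) \<le> 2 * ((L + 1) * N t)" by simp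
    then show "2 * (u t \<bullet> u' t) \<le> 2 * (L + 1) * N t" by (simp only: mult.assoc)
  qed
  also have "\<dots> \<le> exp (2 * (L + 1) * s) * (norm (u 0) + C)\<^sup>2"
    using C by (simp add: N_def power2_sum)
  also have "\<dots> = (exp ((L + 1) * s) * (norm (u 0) + C))\<^sup>2"
    by (simp add: power_mult_distrib exp_double[symmetric] mult.assoc)
  finally have "(norm (u s))\<^sup>2 \<le> (exp ((L + 1) * s) * (norm (u 0) + C))\<^sup>2"
    by (simp add: N_def) (smt (verit) zero_le_power2)
  then show ?thesis by (rule power2_le_imp_le) (use C in simp)
qed

text \<open>The derivative and its bound are required on the half-open interval only: bounds of
  \<partial>_s P come from right difference quotients and miss the final time.\<close>

lemma norm_diff_le_of_vector_derivative:
  fixes f :: "real \<Rightarrow> 'a::real_inner"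
  assumes ab: "a \<le> b"
    and der: "\<And>t. t \<in> {a..<b} \<Longrightarrow> (f has_vector_derivative f' t) (at t within {a..b})"
    and cont: "continuous_on {a..b} f"
    and le: "\<And>t. t \<in> {a..<b} \<Longrightarrow> norm (f' t) \<le> B"
  shows "norm (f b - f a) \<le> B * (b - a)"
proof (cases "a = b")
  case False
  with ab have "a < b" by simp
  have "(f has_derivative (\<lambda>h. h *\<^sub>R f' t)) (at t)" if "a < t" "t < b" for t
    using der[of t] that by (simp add: has_vector_derivative_def at_within_Icc_at)
  from mvt_general[OF \<open>a < b\<close> cont this]
  obtain t where t: "a < t" "t < b" "norm (f b - f a) \<le> norm ((b - a) *\<^sub>R f' t)" by auto
  note t(3)
  also have "norm ((b - a) *\<^sub>R f' t) \<le> B * (b - a)"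
    using le[of t] t ab by (simp add: mult.commute mult_right_mono)
  finally show ?thesis .
qed simp

section \<open>Maximum principle for the implicit step\<close>

lemma periodic_attains_sup:
  fixes f :: "real \<Rightarrow> real"
  assumes cont: "continuous_on UNIV f" and per: "periodic_fun_simple f p" and p: "0 < p"
  obtains t where "\<And>x. f x \<le> f t"
proof -
  interpret periodic_fun_simple f p by (rule per)
  obtain t where t: "t \<in> {0..p}" "\<And>y. y \<in> {0..p} \<Longrightarrow> f y \<le> f t"
    using continuous_attains_sup[of "{0..p}" f] continuous_on_subset[OF cont] p by auto
  have "f x \<le> f t" for x
  proof -
    define k where "k = \<lfloor>x / p\<rfloor>"
    have "of_int k \<le> x / p" "x / p \<le> of_int k + 1" by (auto simp: k_def)
    then have "x - of_int k * p \<in> {0..p}" using p by (auto simp: field_simps)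
    from t(2)[OF this] show ?thesis by (simp add: minus_of_int)
  qed
  then show thesis by (rule that)
qed

text \<open>At a maximum of |u|^2 over a period, u is orthogonal to u', so |u|^2 = u \<bullet> g
  there whatever the value of \<open>c\<close>. The stiff ratio D / \<epsilon> therefore never
  enters the stability estimate.\<close>

lemma implicit_step_bound:
  fixes u g :: "real \<Rightarrow> 'a::real_inner"
  assumes der: "\<And>t. (u has_vector_derivative u' t) (at t)"
    and per: "periodic_fun_simple u p" and p: "0 < p"
    and eq: "\<And>t. u t + c *\<^sub>R u' t = g t"
    and g: "\<And>t. norm (g t) \<le> B"
  shows "norm (u t) \<le> B"
proof -
  define N where "N t = u t \<bullet> u t" for t
  have Nd: "(N has_real_derivative 2 * (u t \<bullet> u' t)) (at t)" for t
    unfolding N_def by (rule has_real_derivative_inner_self[OF der])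
  have "periodic_fun_simple N p"
    using per by (simp add: N_def periodic_fun_simple_def)
  moreover have "continuous_on UNIV N"
    by (rule DERIV_continuous_on[OF DERIV_subset[OF Nd subset_UNIV]])
  ultimately obtain m where m: "\<And>x. N x \<le> N m" using periodic_attains_sup p by metis
  have "2 * (u m \<bullet> u' m) = 0"
    by (rule DERIV_local_max[OF Nd, of 1]) (use m in auto)
  then have "u m \<bullet> u m = u m \<bullet> g m"
    by (simp add: eq[symmetric] inner_add_right)
  also have "\<dots> \<le> norm (u m) * norm (g m)" by (rule norm_cauchy_schwarz)
  finally have "norm (u m) * norm (u m) \<le> norm (u m) * norm (g m)"
    by (simp add: dot_square_norm power2_eq_square)
  then have "norm (u m) \<le> norm (g m)"
    by (cases "u m = 0") auto
  moreover have "norm (u t) \<le> norm (u m)"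
    using m[of t] by (simp add: N_def norm_le)
  ultimately show ?thesis using g[of m] by linarith
qed

text \<open>
  \<open>V = \<partial>\<^sub>s P\<close> and \<open>Q = \<partial>\<^sub>\<tau> P\<close>. The last two assumptions say that the initial datum is well prepared;
  \<open>V0_lipschitz\<close> is a bound of \<open>\<partial>\<^sub>s\<^sup>2 P\<close> at \<open>s = 0\<close> in disguise.
\<close>

locale transport_problem =
  fixes \<epsilon> S R L \<kappa> :: real
    and F :: "real \<Rightarrow> real \<Rightarrow> 'a::real_inner \<Rightarrow> 'a"
    and P V Q :: "real \<Rightarrow> real \<Rightarrow> 'a"
  assumes \<epsilon>_pos: "0 < \<epsilon>" and S_pos: "0 < S" and \<kappa>_nonneg: "0 \<le> \<kappa>"
    and P_char: "\<And>s \<tau>. s \<in> {0..S} \<Longrightarrow>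
      ((\<lambda>s. P s (\<tau> + s / \<epsilon>)) has_vector_derivative F s (\<tau> + s / \<epsilon>) (P s (\<tau> + s / \<epsilon>))) (at s within {0..S})"
    and P_s: "\<And>s \<tau>. s \<in> {0..S} \<Longrightarrow> ((\<lambda>s. P s \<tau>) has_vector_derivative V s \<tau>) (at s within {0..S})"
    and P_\<tau>: "\<And>s \<tau>. s \<in> {0..S} \<Longrightarrow> (P s has_vector_derivative Q s \<tau>) (at \<tau>)"
    and P_eq: "\<And>s \<tau>. s \<in> {0..S} \<Longrightarrow> V s \<tau> + (1 / \<epsilon>) *\<^sub>R Q s \<tau> = F s \<tau> (P s \<tau>)"
    and V_cont: "\<And>\<tau>. continuous_on {0..S} (\<lambda>s. V s \<tau>)"
    and P_periodic: "\<And>s. s \<in> {0..S} \<Longrightarrow> torus_fun (P s)"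
    and P_bound: "\<And>s \<tau>. s \<in> {0..S} \<Longrightarrow> norm (P s \<tau>) \<le> R"
    and F_c11: "c11 L S (R + 1) F"
    and V0_bound: "\<And>\<tau>. norm (V 0 \<tau>) \<le> \<kappa>"
    and V0_lipschitz: "\<And>\<tau> \<tau>'. norm (V 0 \<tau> - V 0 \<tau>') \<le> \<kappa> * \<epsilon> * \<bar>\<tau> - \<tau>'\<bar>"
begin

section \<open>Slow derivatives of the exact solution along characteristics\<close>

lemmas L_nonneg = c11_nonneg[OF F_c11]

lemmas F_lipschitz = c11_lipschitz[OF F_c11]

definition "K = exp ((L + 1) * S)"

lemma K_ge_1: "1 \<le> K"
  using L_nonneg S_pos by (simp add: K_def)

lemma exp_le_K: "s \<le> S \<Longrightarrow> exp ((L + 1) * s) \<le> K"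
  using L_nonneg by (simp add: K_def mult_left_mono)

lemma P_bound': "s \<in> {0..S} \<Longrightarrow> norm (P s \<tau>) \<le> R + 1"
  using P_bound[of s \<tau>] by linarith

text \<open>The shifted slow time \<open>s + h\<close> is paired with the unshifted fast variable
  \<open>\<tau> + s / \<epsilon>\<close>; this curve is again a characteristic, starting from
  \<open>\<tau> - h / \<epsilon>\<close>. Differences of such curves compare values of F at equal
  \<tau>, where the bounds of F are uniform in \<epsilon>.\<close>

lemma P_char_shift:
  assumes h: "0 \<le> h" and s: "s \<in> {0..A - h}" and A: "A \<le> S"
  shows "((\<lambda>s. P (s + h) (\<tau> + s / \<epsilon>)) has_vector_derivative
     F (s + h) (\<tau> + s / \<epsilon>) (P (s + h) (\<tau> + s / \<epsilon>))) (at s within {0..A - h})"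
proof -
  have shift: "(\<tau> - h / \<epsilon>) + (s + h) / \<epsilon> = \<tau> + s / \<epsilon>" for s
    by (simp add: add_divide_distrib)
  have "((\<lambda>s. P s ((\<tau> - h / \<epsilon>) + s / \<epsilon>)) has_vector_derivative
      F (s + h) ((\<tau> - h / \<epsilon>) + (s + h) / \<epsilon>) (P (s + h) ((\<tau> - h / \<epsilon>) + (s + h) / \<epsilon>))) (at (s + h) within {0..S})"
    by (rule P_char) (use assms in auto)
  then have "((\<lambda>s. P s ((\<tau> - h / \<epsilon>) + s / \<epsilon>)) has_vector_derivative
      F (s + h) (\<tau> + s / \<epsilon>) (P (s + h) (\<tau> + s / \<epsilon>))) (at (s + h) within (\<lambda>s. s + h) ` {0..A - h})"
    unfolding shift by (rule has_vector_derivative_within_subset) (use assms in auto)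
  moreover have "((\<lambda>s. s + h) has_vector_derivative 1) (at s within {0..A - h})"
    by (auto intro!: derivative_eq_intros)
  ultimately have "((\<lambda>s. P s ((\<tau> - h / \<epsilon>) + s / \<epsilon>)) \<circ> (\<lambda>s. s + h) has_vector_derivative
      1 *\<^sub>R F (s + h) (\<tau> + s / \<epsilon>) (P (s + h) (\<tau> + s / \<epsilon>))) (at s within {0..A - h})"
    by (intro vector_diff_chain_within)
  then show ?thesis unfolding o_def shift by simp
qed

lemma right_quotient_tendsto:
  assumes "0 \<le> s" "s < S"
  shows "((\<lambda>h. (1 / h) *\<^sub>R (P (s + h) \<tau> - P s \<tau>)) \<longlongrightarrow> V s \<tau>) (at_right 0)"
  by (rule right_derivative_tendsto[OF P_s[of s \<tau>]]) (use assms in auto)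

lemma second_quotient_tendsto:
  assumes "0 \<le> s" "s < S" "0 \<le> s'" "s' < S"
  shows "((\<lambda>h. (1 / h) *\<^sub>R ((P (s + h) \<tau> - P s \<tau>) - (P (s' + h) \<tau>' - P s' \<tau>'))) \<longlongrightarrow> V s \<tau> - V s' \<tau>') (at_right 0)"
  unfolding scaleR_diff_right[of _ "_ - _"] by (intro tendsto_diff right_quotient_tendsto assms)

lemma difference_has_derivative:
  fixes \<tau> :: real
  assumes h: "0 \<le> h" and a: "a + h \<le> S" and t: "t \<in> {0..a}"
  defines "u \<equiv> \<lambda>s. P (s + h) (\<tau> + s / \<epsilon>) - P s (\<tau> + s / \<epsilon>)"
    and "u' \<equiv> \<lambda>s. F (s + h) (\<tau> + s / \<epsilon>) (P (s + h) (\<tau> + s / \<epsilon>)) - F s (\<tau> + s / \<epsilon>) (P s (\<tau> + s / \<epsilon>))"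
  shows "(u has_vector_derivative u' t) (at t within {0..a})" and "norm (u' t) \<le> L * norm (u t) + L * h"
proof -
  show "(u has_vector_derivative u' t) (at t within {0..a})"
    unfolding u_def u'_def
    using P_char_shift[of h t "a + h" \<tau>] P_char_shift[of 0 t a \<tau>] h a t by (intro has_vector_derivative_diff) auto
  have "norm (u' t) \<le> L * (\<bar>t + h - t\<bar> + norm (u t))"
    unfolding u'_def u_def by (rule F_lipschitz) (use t h a in \<open>auto intro!: P_bound'\<close>)
  then show "norm (u' t) \<le> L * norm (u t) + L * h"
    using h by (simp add: algebra_simps)
qed

lemma difference_bound:
  assumes h: "0 \<le> h" and s: "s \<in> {0..S - h}"
  shows "norm (P (s + h) (\<tau> + s / \<epsilon>) - P s (\<tau> + s / \<epsilon>)) \<le> K * (norm (P h \<tau> - P 0 \<tau>) + L * h)"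
proof -
  define u where "u s = P (s + h) (\<tau> + s / \<epsilon>) - P s (\<tau> + s / \<epsilon>)" for s
  have "norm (u s) \<le> exp ((L + 1) * s) * (norm (u 0) + L * h)"
    unfolding u_def
    by (rule gronwall_norm[OF difference_has_derivative[OF h] s L_nonneg]) (use h L_nonneg in auto)
  also have "\<dots> \<le> K * (norm (u 0) + L * h)"
    using s h L_nonneg by (intro mult_right_mono exp_le_K) auto
  finally show ?thesis by (simp add: u_def)
qed

text \<open>\<open>K1\<close> will bound V: it is the Gronwall factor times the initial bound
  \<kappa> plus the Lipschitz constant of F in time. \<open>K2\<close> will be the Lipschitz
  constant of V in s: the same factor times the initial one plus the forcing L (1 + K1)^2 of the
  second differences.\<close>

definition "K1 = K * (\<kappa> + L)"
definition "K2 = K * ((L * (1 + K1) + \<kappa>) + L * (1 + K1)\<^sup>2)"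

lemma K1_nonneg: "0 \<le> K1"
  using K_ge_1 L_nonneg \<kappa>_nonneg by (simp add: K1_def)

lemma K2_nonneg: "0 \<le> K2"
  using K_ge_1 L_nonneg \<kappa>_nonneg K1_nonneg by (simp add: K2_def)

lemma V_bound:
  assumes s: "0 \<le> s" "s < S"
  shows "norm (V s \<tau>) \<le> K1"
proof -
  define \<tau>0 where "\<tau>0 = \<tau> - s / \<epsilon>"
  have "norm (V s \<tau>) \<le> K * (norm (V 0 \<tau>0) + L)"
  proof (rule right_quotient_norm_le[OF right_quotient_tendsto[OF s] right_quotient_tendsto[OF order_refl S_pos]])
    show "norm (P (s + h) \<tau> - P s \<tau>) \<le> K * (norm (P (0 + h) \<tau>0 - P 0 \<tau>0) + L * h)" if "0 < h" "h < S - s" for h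
      using difference_bound[of h s \<tau>0] that s by (simp add: \<tau>0_def)
  qed (use s in simp)
  also have "\<dots> \<le> K1"
    using V0_bound[of \<tau>0] K_ge_1 by (simp add: K1_def mult_left_mono)
  finally show ?thesis .
qed

lemma P_lipschitz:
  assumes "0 \<le> s" "s \<le> t" "t \<le> S"
  shows "norm (P t \<tau> - P s \<tau>) \<le> K1 * (t - s)"
proof (rule norm_diff_le_of_vector_derivative)
  have der: "((\<lambda>r. P r \<tau>) has_vector_derivative V r \<tau>) (at r within {s..t})" if "r \<in> {s..t}" for r
    by (rule has_vector_derivative_within_subset[OF P_s]) (use that assms in auto)
  show "((\<lambda>r. P r \<tau>) has_vector_derivative V r \<tau>) (at r within {s..t})" if "r \<in> {s..<t}" for r
    using der that by auto
  show "continuous_on {s..t} (\<lambda>r. P r \<tau>)"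
    by (rule continuous_on_vector_derivative[OF der])
  show "norm (V r \<tau>) \<le> K1" if "r \<in> {s..<t}" for r
    using V_bound assms that by auto
qed (use assms in auto)

text \<open>Along the characteristic, the first difference with step \<open>h\<close> has a
  derivative of size L (1 + K1) h; integrating up to \<open>d\<close> and dividing by
  \<open>h\<close> gives the bound.\<close>

lemma V_char_initial:
  assumes d: "0 \<le> d" "d < S"
  shows "norm (V d (\<tau> + d / \<epsilon>) - V 0 \<tau>) \<le> L * (1 + K1) * d"
proof -
  \<comment> \<open>The comparison quotient is zero and its factor is 1, so only the forcing
    survives in the limit.\<close>
  have "norm (V d (\<tau> + d / \<epsilon>) - V 0 \<tau>) \<le> 1 * (norm (0 :: 'a) + L * (1 + K1) * d)"
  proof (rule right_quotient_norm_le[OF second_quotient_tendsto])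
    show "((\<lambda>h. (1 / h) *\<^sub>R (0 :: 'a)) \<longlongrightarrow> 0) (at_right 0)" by simp
    fix h assume h: "0 < h" "h < S - d"
    define u where "u s = P (s + h) (\<tau> + s / \<epsilon>) - P s (\<tau> + s / \<epsilon>)" for s
    note diff = difference_has_derivative[of h d _ \<tau>, folded u_def]
    have "norm (u d - u 0) \<le> (L * (1 + K1) * h) * (d - 0)"
    proof (rule norm_diff_le_of_vector_derivative)
      show "continuous_on {0..d} u"
        by (rule continuous_on_vector_derivative[OF diff(1)]) (use h in auto)
      fix t assume t: "t \<in> {0..<d}"
      show "(u has_vector_derivative F (t + h) (\<tau> + t / \<epsilon>) (P (t + h) (\<tau> + t / \<epsilon>)) - F t (\<tau> + t / \<epsilon>) (P t (\<tau> + t / \<epsilon>)))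
          (at t within {0..d})"
        by (rule diff(1)) (use t h in auto)
      have "norm (F (t + h) (\<tau> + t / \<epsilon>) (P (t + h) (\<tau> + t / \<epsilon>)) - F t (\<tau> + t / \<epsilon>) (P t (\<tau> + t / \<epsilon>))) \<le> L * norm (u t) + L * h"
        by (rule diff(2)) (use t h in auto)
      also have "\<dots> \<le> L * (K1 * h) + L * h"
        using P_lipschitz[of t "t + h" "\<tau> + t / \<epsilon>"] t h L_nonneg
        by (intro add_right_mono mult_left_mono) (auto simp: u_def)
      finally show "norm (F (t + h) (\<tau> + t / \<epsilon>) (P (t + h) (\<tau> + t / \<epsilon>)) - F t (\<tau> + t / \<epsilon>) (P t (\<tau> + t / \<epsilon>))) \<le> L * (1 + K1) * h"
        by (simp add: algebra_simps)
    qed (use d in auto)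
    then show "norm ((P (d + h) (\<tau> + d / \<epsilon>) - P d (\<tau> + d / \<epsilon>)) - (P (0 + h) \<tau> - P 0 \<tau>))
        \<le> 1 * (norm (0 :: 'a) + L * (1 + K1) * d * h)"
      by (simp add: u_def mult_ac)
  qed (use d S_pos in auto)
  then show ?thesis by simp
qed

text \<open>Go back along the characteristic to time 0, landing at distance d / \<epsilon> in the
  fast variable, then return along s = 0. The Lipschitz constant \<kappa> \<epsilon> of V 0 exactly
  compensates this distance: this is where well-prepared data are indispensable to the
  argument.\<close>

lemma V_initial:
  assumes d: "0 \<le> d" "d < S"
  shows "norm (V d \<tau> - V 0 \<tau>) \<le> (L * (1 + K1) + \<kappa>) * d"
proof -
  have "norm (V d \<tau> - V 0 \<tau>) \<le> norm (V d \<tau> - V 0 (\<tau> - d / \<epsilon>)) + norm (V 0 (\<tau> - d / \<epsilon>) - V 0 \<tau>)"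
    by (rule norm_diff_triangle_ineq[THEN order_trans[rotated]]) simp
  also have "norm (V d \<tau> - V 0 (\<tau> - d / \<epsilon>)) \<le> L * (1 + K1) * d"
    using V_char_initial[OF d, of "\<tau> - d / \<epsilon>"] by simp
  also have "norm (V 0 (\<tau> - d / \<epsilon>) - V 0 \<tau>) \<le> \<kappa> * d"
    using V0_lipschitz[of "\<tau> - d / \<epsilon>" \<tau>] d \<epsilon>_pos by simp
  finally show ?thesis by (simp add: algebra_simps)
qed

text \<open>Gronwall for the mixed difference over the times s, s + h, s + d, s + h + d with common
  fast variable. The forcing comes from \<open>c11_second\<close>: each first difference of (s, P)
  is at most (1 + K1) times its step.\<close>

lemma second_difference_bound:
  assumes h: "0 \<le> h" and d: "0 \<le> d" and s: "s \<in> {0..S - (h + d)}"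
  shows "norm (P (s + (h + d)) (\<tau> + s / \<epsilon>) - P (s + h) (\<tau> + s / \<epsilon>) - P (s + d) (\<tau> + s / \<epsilon>) + P s (\<tau> + s / \<epsilon>))
     \<le> K * (norm (P (h + d) \<tau> - P h \<tau> - P d \<tau> + P 0 \<tau>) + L * (1 + K1)\<^sup>2 * h * d)"
proof -
  define p where "p h s = P (s + h) (\<tau> + s / \<epsilon>)" for h s
  define f where "f h s = F (s + h) (\<tau> + s / \<epsilon>) (p h s)" for h s
  define u where "u s = p (h + d) s - p h s - p d s + p 0 s" for s
  define u' where "u' s = f (h + d) s - f h s - f d s + f 0 s" for s
  define C where "C = L * (1 + K1)\<^sup>2 * h * d"
  have C: "0 \<le> C" using h d L_nonneg by (simp add: C_def)
  have "norm (u s) \<le> exp ((L + 1) * s) * (norm (u 0) + C)"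
  proof (rule gronwall_norm)
    fix t assume t: "t \<in> {0..S - (h + d)}"
    have pder: "(p k has_vector_derivative f k t) (at t within {0..S - (h + d)})" if "0 \<le> k" "k \<le> h + d" for k
    proof -
      have "(p k has_vector_derivative f k t) (at t within {0..(S - (h + d) + k) - k})"
        unfolding p_def f_def by (rule P_char_shift) (use t that in auto)
      then show ?thesis by simp
    qed
    show "(u has_vector_derivative u' t) (at t within {0..S - (h + d)})"
      unfolding u_def u'_def
      by (intro has_vector_derivative_diff has_vector_derivative_add pder) (use h d in auto)
    have lip: "norm (p k t - p 0 t) \<le> K1 * k" if "0 \<le> k" "k \<le> h + d" for k
      using P_lipschitz[of t "t + k" "\<tau> + t / \<epsilon>"] t that by (simp add: p_def)
    have "norm (F (t + h + d) (\<tau> + t / \<epsilon>) (p (h + d) t) - F (t + h) (\<tau> + t / \<epsilon>) (p h t)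
        - F (t + d) (\<tau> + t / \<epsilon>) (p d t) + F t (\<tau> + t / \<epsilon>) (p 0 t))
      \<le> L * (norm (p (h + d) t - p h t - p d t + p 0 t) + (h + norm (p h t - p 0 t)) * (d + norm (p d t - p 0 t)))"
      by (rule c11_second[OF F_c11]) (use t h d in \<open>auto simp: p_def intro!: P_bound'\<close>)
    also have "\<dots> \<le> L * (norm (u t) + ((1 + K1) * h) * ((1 + K1) * d))"
      unfolding u_def using lip[of h] lip[of d] h d L_nonneg K1_nonneg
      by (intro mult_left_mono add_left_mono mult_mono) (auto simp: algebra_simps)
    finally show "norm (u' t) \<le> L * norm (u t) + C"
      by (simp add: u'_def f_def C_def add.assoc power2_eq_square distrib_left mult_ac)
  qed (use s L_nonneg C in auto)
  also have "\<dots> \<le> K * (norm (u 0) + C)"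
    using s h d C by (intro mult_right_mono exp_le_K) auto
  finally show ?thesis by (simp add: u_def p_def C_def)
qed

text \<open>Divide the mixed difference by \<open>h\<close> with \<open>d\<close> fixed; in the
  limit it becomes a difference of V, at times s and s + d on the left and at times 0 and d on the
  right.\<close>

lemma V_lipschitz_open:
  assumes "0 \<le> s" "0 \<le> d" "s + d < S"
  shows "norm (V (s + d) \<tau> - V s \<tau>) \<le> K2 * d"
proof -
  define \<tau>0 where "\<tau>0 = \<tau> - s / \<epsilon>"
  have "norm (V (s + d) \<tau> - V s \<tau>) \<le> K * (norm (V d \<tau>0 - V 0 \<tau>0) + L * (1 + K1)\<^sup>2 * d)"
  proof (rule right_quotient_norm_le[OF second_quotient_tendsto second_quotient_tendsto])
    show "norm ((P (s + d + h) \<tau> - P (s + d) \<tau>) - (P (s + h) \<tau> - P s \<tau>))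
        \<le> K * (norm ((P (d + h) \<tau>0 - P d \<tau>0) - (P (0 + h) \<tau>0 - P 0 \<tau>0)) + L * (1 + K1)\<^sup>2 * d * h)"
      if "0 < h" "h < S - (s + d)" for h
      using second_difference_bound[of h d s \<tau>0] that assms by (simp add: \<tau>0_def algebra_simps)
  qed (use assms in auto)
  also have "\<dots> \<le> K * ((L * (1 + K1) + \<kappa>) * d + L * (1 + K1)\<^sup>2 * d)"
    using V_initial[of d \<tau>0] K_ge_1 assms by (intro mult_left_mono) auto
  finally show ?thesis by (simp add: K2_def algebra_simps)
qed

text \<open>No right quotient exists at the final time \<open>S\<close>; the bound extends there by
  continuity of V in s.\<close>

lemma V_lipschitz:
  assumes "0 \<le> s" "s \<le> t" "t \<le> S"
  shows "norm (V t \<tau> - V s \<tau>) \<le> K2 * (t - s)"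
proof -
  have *: "norm (V r \<tau> - V s \<tau>) \<le> K2 * (r - s)" if "s \<le> r" "r < S" for r
    using V_lipschitz_open[of s "r - s" \<tau>] assms that by simp
  consider "t < S" | "s = t" | "s < t" "t = S" using assms by linarith
  then show ?thesis
  proof cases
    case 3
    have cl: "closure {s..<S} = {s..S}" using 3 by simp
    have "norm (V t \<tau> - V s \<tau>) \<le> K2 * (S - s)"
    proof (rule continuous_on_closure_norm_le[where f = "\<lambda>r. V r \<tau> - V s \<tau>" and s = "{s..<S}"])
      show "continuous_on (closure {s..<S}) (\<lambda>r. V r \<tau> - V s \<tau>)"
        unfolding cl using assms by (intro continuous_intros continuous_on_subset[OF V_cont]) auto
      show "\<forall>r\<in>{s..<S}. norm (V r \<tau> - V s \<tau>) \<le> K2 * (S - s)"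
        using * K2_nonneg by (auto intro!: order_trans[OF * mult_left_mono])
      show "t \<in> closure {s..<S}" unfolding cl using 3 by simp
    qed
    then show ?thesis using 3 by simp
  qed (use * assms in auto)
qed

section \<open>Consistency and stability of the scheme\<close>

lemma truncation_bound:
  assumes "0 \<le> s" "s \<le> t" "t \<le> S"
  shows "norm (P t \<tau> - P s \<tau> - (t - s) *\<^sub>R V t \<tau>) \<le> K2 * (t - s)\<^sup>2"
proof -
  have der: "((\<lambda>r. P r \<tau> - r *\<^sub>R V t \<tau>) has_vector_derivative V r \<tau> - V t \<tau>) (at r within {s..t})"
    if "r \<in> {s..t}" for r
  proof -
    have "((\<lambda>r. P r \<tau>) has_vector_derivative V r \<tau>) (at r within {s..t})"
      by (rule has_vector_derivative_within_subset[OF P_s]) (use that assms in auto)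
    then show ?thesis by (auto intro!: derivative_eq_intros)
  qed
  \<comment> \<open>The slope is taken at the right end because the transport term of the scheme is
    implicit.\<close>
  have "norm ((P t \<tau> - t *\<^sub>R V t \<tau>) - (P s \<tau> - s *\<^sub>R V t \<tau>)) \<le> (K2 * (t - s)) * (t - s)"
  proof (rule norm_diff_le_of_vector_derivative[OF \<open>s \<le> t\<close>])
    show "((\<lambda>r. P r \<tau> - r *\<^sub>R V t \<tau>) has_vector_derivative V r \<tau> - V t \<tau>) (at r within {s..t})"
      if "r \<in> {s..<t}" for r using der that by auto
    show "continuous_on {s..t} (\<lambda>r. P r \<tau> - r *\<^sub>R V t \<tau>)"
      by (rule continuous_on_vector_derivative[OF der])
    fix r assume r: "r \<in> {s..<t}"
    have "norm (V t \<tau> - V r \<tau>) \<le> K2 * (t - r)"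
      by (rule V_lipschitz) (use r assms in auto)
    also have "\<dots> \<le> K2 * (t - s)" using r K2_nonneg by (intro mult_left_mono) auto
    finally show "norm (V r \<tau> - V t \<tau>) \<le> K2 * (t - s)" by (simp add: norm_minus_commute)
  qed
  then show ?thesis by (simp add: algebra_simps power2_eq_square)
qed

text \<open>Local error divided by D^2: \<open>K2\<close> from the backward difference, and L (1 +
  K1) from evaluating F at the old time and the old value of P.\<close>

definition "M = K2 + L * (1 + K1)"

lemma M_nonneg: "0 \<le> M"
  using K2_nonneg K1_nonneg L_nonneg by (simp add: M_def)

text \<open>The error equation is one implicit transport step with right-hand side \<open>g\<close>,
  so the maximum principle reduces it to a scalar recursion with factor 1 + L D and source M D^2.
  The induction carries M D s (1 + L D)^n; the restriction on \<open>D\<close> keeps this at most 1,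
  hence the iterate inside the ball where F is controlled.\<close>

theorem scheme_error:
  fixes Pn Qn :: "nat \<Rightarrow> real \<Rightarrow> 'a"
  assumes D: "0 < D" "M * S * exp (L * S) * D \<le> 1"
    and init: "\<And>\<tau>. Pn 0 \<tau> = P 0 \<tau>"
    and der: "\<And>n \<tau>. real (Suc n) * D \<le> S \<Longrightarrow> (Pn (Suc n) has_vector_derivative Qn (Suc n) \<tau>) (at \<tau>)"
    and per: "\<And>n. real (Suc n) * D \<le> S \<Longrightarrow> torus_fun (Pn (Suc n))"
    and step: "\<And>n \<tau>. real (Suc n) * D \<le> S \<Longrightarrow>
      (1 / D) *\<^sub>R (Pn (Suc n) \<tau> - Pn n \<tau>) + (1 / \<epsilon>) *\<^sub>R Qn (Suc n) \<tau> = F (real n * D) \<tau> (Pn n \<tau>)"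
    and n: "real n * D \<le> S"
  shows "norm (Pn n \<tau> - P (real n * D) \<tau>) \<le> M * S * exp (L * S) * D"
proof -
  have growth: "M * D * (real n * D) * (1 + L * D) ^ n \<le> M * S * exp (L * S) * D" if "real n * D \<le> S" for n
  proof -
    have "(1 + L * D) ^ n \<le> exp (L * D) ^ n"
      using L_nonneg D by (intro power_mono) auto
    also have "\<dots> = exp (L * (real n * D))" by (simp add: exp_of_nat_mult[symmetric] mult_ac)
    also have "\<dots> \<le> exp (L * S)" using that L_nonneg by (simp add: mult_left_mono)
    finally have "(M * D) * ((real n * D) * (1 + L * D) ^ n) \<le> (M * D) * (S * exp (L * S))"
      using that L_nonneg M_nonneg D S_pos by (intro mult_left_mono mult_mono) auto
    then show ?thesis by (simp add: mult_ac)
  qed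
  have "norm (Pn n \<tau> - P (real n * D) \<tau>) \<le> M * D * (real n * D) * (1 + L * D) ^ n"
    using n
  proof (induction n arbitrary: \<tau>)
    case 0
    then show ?case by (simp add: init)
  next
    case (Suc n)
    define s t where "s = real n * D" and "t = real (Suc n) * D"
    have st: "0 \<le> s" "s \<le> t" "t \<le> S" "t - s = D" using D Suc.prems by (auto simp: s_def t_def algebra_simps)
    define B where "B = M * D * s * (1 + L * D) ^ n"
    have e: "norm (Pn n \<tau> - P s \<tau>) \<le> B" for \<tau>
      using Suc.IH[of \<tau>] st by (simp add: B_def s_def)
    have B: "0 \<le> B" "B \<le> 1"
    proof -
      show "0 \<le> B" using order_trans[OF norm_ge_zero e] .
      have "B \<le> M * S * exp (L * S) * D" unfolding B_def s_def by (rule growth) (use st in \<open>simp add: s_def\<close>)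
      then show "B \<le> 1" using D(2) by linarith
    qed
    \<comment> \<open>Old error, plus the explicit evaluation of F at the old iterate against the
      exact F at the new time, minus the truncation error.\<close>
    define g where "g \<tau> = (Pn n \<tau> - P s \<tau>) + D *\<^sub>R (F s \<tau> (Pn n \<tau>) - F t \<tau> (P t \<tau>))
      - (P t \<tau> - P s \<tau> - (t - s) *\<^sub>R V t \<tau>)" for \<tau>
    have "norm (Pn (Suc n) \<tau> - P t \<tau>) \<le> B + D * (L * B) + M * D\<^sup>2"
    proof (rule implicit_step_bound)
      show "((\<lambda>\<tau>. Pn (Suc n) \<tau> - P t \<tau>) has_vector_derivative Qn (Suc n) \<tau> - Q t \<tau>) (at \<tau>)" for \<tau>
        by (intro has_vector_derivative_diff der P_\<tau>) (use Suc.prems st in auto)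
      show "torus_fun (\<lambda>\<tau>. Pn (Suc n) \<tau> - P t \<tau>)"
        using per[OF Suc.prems] P_periodic[of t] st by (simp add: periodic_fun_simple_def)
      show "0 < 2 * pi" by simp
      show "(Pn (Suc n) \<tau> - P t \<tau>) + (D / \<epsilon>) *\<^sub>R (Qn (Suc n) \<tau> - Q t \<tau>) = g \<tau>" for \<tau>
      proof -
        have "D *\<^sub>R F s \<tau> (Pn n \<tau>) = (Pn (Suc n) \<tau> - Pn n \<tau>) + (D / \<epsilon>) *\<^sub>R Qn (Suc n) \<tau>"
          using step[OF Suc.prems, of \<tau>, symmetric] D(1) by (simp add: s_def scaleR_add_right)
        moreover have "D *\<^sub>R F t \<tau> (P t \<tau>) = D *\<^sub>R V t \<tau> + (D / \<epsilon>) *\<^sub>R Q t \<tau>"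
          using P_eq[of t \<tau>, symmetric] st by (simp add: scaleR_add_right)
        ultimately show ?thesis by (simp add: g_def st scaleR_diff_right)
      qed
      show "norm (g \<tau>) \<le> B + D * (L * B) + M * D\<^sup>2" for \<tau>
      proof -
        \<comment> \<open>Here the margin 1 in the radius R + 1 is spent.\<close>
        have Pn_b: "norm (Pn n \<tau>) \<le> R + 1"
          using norm_triangle_sub[of "Pn n \<tau>" "P s \<tau>"] e[of \<tau>] B P_bound[of s \<tau>] st by auto
        have "norm (F s \<tau> (Pn n \<tau>) - F t \<tau> (P t \<tau>)) \<le> L * (\<bar>s - t\<bar> + norm (Pn n \<tau> - P t \<tau>))"
          by (rule F_lipschitz) (use st Pn_b in \<open>auto intro!: P_bound'\<close>)
        also have "\<dots> \<le> L * (D + (B + K1 * D))"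
        proof (intro mult_left_mono add_mono)
          show "\<bar>s - t\<bar> \<le> D" using st by simp
          have "norm (Pn n \<tau> - P t \<tau>) \<le> norm (Pn n \<tau> - P s \<tau>) + norm (P s \<tau> - P t \<tau>)"
            using norm_triangle_ineq[of "Pn n \<tau> - P s \<tau>" "P s \<tau> - P t \<tau>"] by simp
          then show "norm (Pn n \<tau> - P t \<tau>) \<le> B + K1 * D"
            using e[of \<tau>] P_lipschitz[of s t \<tau>] st by (simp add: norm_minus_commute)
        qed (rule L_nonneg)
        finally have "norm (D *\<^sub>R (F s \<tau> (Pn n \<tau>) - F t \<tau> (P t \<tau>))) \<le> D * (L * (D + (B + K1 * D)))"
          using D by simp
        moreover have "norm (P t \<tau> - P s \<tau> - (t - s) *\<^sub>R V t \<tau>) \<le> K2 * (t - s)\<^sup>2"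
          by (rule truncation_bound) (use st in auto)
        ultimately have "norm (g \<tau>) \<le> B + D * (L * (D + (B + K1 * D))) + K2 * (t - s)\<^sup>2"
          unfolding g_def using e[of \<tau>]
          by (meson add_mono norm_triangle_le norm_triangle_le_diff)
        then show ?thesis using st by (simp add: M_def algebra_simps power2_eq_square)
      qed
    qed
    also have "\<dots> \<le> M * D * t * (1 + L * D) ^ Suc n"
    proof -
      have "1 \<le> (1 + L * D) ^ Suc n" using L_nonneg D by (intro one_le_power) auto
      then have "M * D\<^sup>2 * 1 \<le> M * D\<^sup>2 * (1 + L * D) ^ Suc n" using M_nonneg by (intro mult_left_mono) auto
      moreover have "B + D * (L * B) = M * D * s * (1 + L * D) ^ Suc n"
        by (simp add: B_def algebra_simps)
      moreover have "M * D * t * (1 + L * D) ^ Suc n = M * D * s * (1 + L * D) ^ Suc n + M * D\<^sup>2 * (1 + L * D) ^ Suc n"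
        using st by (metis (no_types) add.commute diff_add_cancel distrib_left distrib_right mult.assoc power2_eq_square)
      ultimately show ?thesis by linarith
    qed
    finally show ?case by (simp add: t_def)
  qed
  also have "\<dots> \<le> M * S * exp (L * S) * D" by (rule growth[OF n])
  finally show ?thesis .
qed

end

section \<open>Second differences of \<open>C\<^sup>2\<close> functions\<close>

text \<open>Replacing the coordinates of z by those of y one at a time never leaves the box, so
  increments along coordinate directions suffice. Each increment is at most |y - z|, whence the
  factor equal to the dimension.\<close>

lemma coordinate_walk:
  fixes g :: "'a::euclidean_space \<Rightarrow> 'b::real_normed_vector"
  assumes step: "\<And>z e \<alpha>. \<lbrakk>e \<in> Basis; z \<in> cbox a c; z + \<alpha> *\<^sub>R e \<in> cbox a c\<rbrakk> \<Longrightarrow>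
      norm (g (z + \<alpha> *\<^sub>R e) - g z) \<le> M * \<bar>\<alpha>\<bar>"
    and y: "y \<in> cbox a c" and z: "z \<in> cbox a c" and M: "0 \<le> M"
  shows "norm (g y - g z) \<le> M * DIM('a) * norm (y - z)"
proof -
  define w where "w B = z + (\<Sum>i\<in>B. ((y - z) \<bullet> i) *\<^sub>R i)" for B
  have wi: "w B \<bullet> j = (if j \<in> B then y \<bullet> j else z \<bullet> j)" if "B \<subseteq> Basis" "j \<in> Basis" for B j
  proof -
    have fin: "finite B" using that finite_subset finite_Basis by blast
    have "(\<Sum>i\<in>B. ((y - z) \<bullet> i) *\<^sub>R i) \<bullet> j = (\<Sum>i\<in>B. if i = j then (y - z) \<bullet> i else 0)"
      unfolding inner_sum_left using that by (intro sum.cong) (auto simp: inner_Basis subset_iff)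
    then show ?thesis using fin by (simp add: w_def inner_add_left inner_diff_left)
  qed
  have wD: "w B \<in> cbox a c" if "B \<subseteq> Basis" for B
    using y z by (auto simp: mem_box wi[OF that])
  have "norm (g (w B) - g z) \<le> M * (\<Sum>i\<in>B. \<bar>(y - z) \<bullet> i\<bar>)" if "B \<subseteq> Basis" for B
    using finite_subset[OF that finite_Basis] that
  proof (induction B rule: finite_induct)
    case empty
    then show ?case by (simp add: w_def)
  next
    case (insert i B)
    have ins: "w (insert i B) = w B + ((y - z) \<bullet> i) *\<^sub>R i"
      using insert by (simp add: w_def add_ac)
    have "norm (g (w (insert i B)) - g z) \<le> norm (g (w (insert i B)) - g (w B)) + norm (g (w B) - g z)"
      using norm_triangle_ineq[of "g (w (insert i B)) - g (w B)" "g (w B) - g z"] by simp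
    also have "norm (g (w (insert i B)) - g (w B)) \<le> M * \<bar>(y - z) \<bullet> i\<bar>"
      using step[of i "w B" "(y - z) \<bullet> i"] wD[of B] wD[of "insert i B"] insert.prems by (simp add: ins)
    also have "norm (g (w B) - g z) \<le> M * (\<Sum>i\<in>B. \<bar>(y - z) \<bullet> i\<bar>)"
      using insert by auto
    finally show ?case using insert by (simp add: algebra_simps)
  qed
  from this[of Basis] have "norm (g y - g z) \<le> M * (\<Sum>i\<in>Basis. \<bar>(y - z) \<bullet> i\<bar>)"
    by (simp add: w_def euclidean_representation)
  also have "\<dots> \<le> M * (\<Sum>i\<in>(Basis::'a set). norm (y - z))"
    using M by (intro mult_left_mono sum_mono Basis_le_norm) auto
  finally show ?thesis by (simp add: mult_ac)
qed

section \<open>Iterated partial derivatives along segments of a box\<close>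

lemma has_vector_derivative_partial_deriv:
  assumes "(\<lambda>h. f ((z + t *\<^sub>R e) + h *\<^sub>R e)) differentiable (at 0 within {h. (z + t *\<^sub>R e) + h *\<^sub>R e \<in> S})"
  shows "((\<lambda>t. f (z + t *\<^sub>R e)) has_vector_derivative partial_deriv S e f (z + t *\<^sub>R e)) (at t within {t. z + t *\<^sub>R e \<in> S})"
proof -
  let ?f = "\<lambda>h. f ((z + t *\<^sub>R e) + h *\<^sub>R e)"
  have "(?f has_vector_derivative partial_deriv S e f (z + t *\<^sub>R e)) (at 0 within {h. (z + t *\<^sub>R e) + h *\<^sub>R e \<in> S})"
    using assms unfolding partial_deriv_def vector_derivative_works .
  moreover have "{h. (z + t *\<^sub>R e) + h *\<^sub>R e \<in> S} = (\<lambda>s. s - t) ` {s. z + s *\<^sub>R e \<in> S}"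
  proof (intro set_eqI iffI)
    fix h assume "h \<in> {h. (z + t *\<^sub>R e) + h *\<^sub>R e \<in> S}"
    then show "h \<in> (\<lambda>s. s - t) ` {s. z + s *\<^sub>R e \<in> S}"
      by (intro image_eqI[of _ _ "t + h"]) (auto simp: scaleR_add_left add.assoc)
  qed (auto simp: scaleR_diff_left algebra_simps)
  ultimately have "(?f has_vector_derivative partial_deriv S e f (z + t *\<^sub>R e)) (at (t - t) within (\<lambda>s. s - t) ` {s. z + s *\<^sub>R e \<in> S})"
    by simp
  moreover have "((\<lambda>s. s - t) has_vector_derivative 1) (at t within {s. z + s *\<^sub>R e \<in> S})"
    by (auto intro!: derivative_eq_intros)
  ultimately have "(?f \<circ> (\<lambda>s. s - t) has_vector_derivative 1 *\<^sub>R partial_deriv S e f (z + t *\<^sub>R e)) (at t within {s. z + s *\<^sub>R e \<in> S})"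
    by (intro vector_diff_chain_within)
  then show ?thesis by (simp add: o_def scaleR_diff_left)
qed

lemma iter_partial_Nil [simp]: "iter_partial S [] f = f"
  and iter_partial_Cons [simp]: "iter_partial S (e # es) f = partial_deriv S e (iter_partial S es f)"
  by (simp_all add: iter_partial_def)

lemma Ck_on_partial:
  assumes "Ck_on k f S" "set es \<subseteq> Basis" "length es < k" "e \<in> Basis" "z + t *\<^sub>R e \<in> S"
  shows "((\<lambda>t. iter_partial S es f (z + t *\<^sub>R e)) has_vector_derivative iter_partial S (e # es) f (z + t *\<^sub>R e))
    (at t within {t. z + t *\<^sub>R e \<in> S})"
  using assms has_vector_derivative_partial_deriv[of "iter_partial S es f" z t e S]
  by (simp add: Ck_on_def)

lemma cbox_segment:
  fixes z e :: "'a::euclidean_space"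
  assumes "z \<in> cbox a c" "z + \<alpha> *\<^sub>R e \<in> cbox a c" "t \<in> closed_segment 0 \<alpha>"
  shows "z + t *\<^sub>R e \<in> cbox a c"
proof -
  obtain u where u: "0 \<le> u" "u \<le> 1" "t = u * \<alpha>"
    using assms(3) by (auto simp: closed_segment_def)
  have "(1 - u) *\<^sub>R z + u *\<^sub>R (z + \<alpha> *\<^sub>R e) \<in> cbox a c"
    by (rule convexD[OF convex_box(1)]) (use assms u in auto)
  also have "(1 - u) *\<^sub>R z + u *\<^sub>R (z + \<alpha> *\<^sub>R e) = z + t *\<^sub>R e"
    using u by (simp add: algebra_simps)
  finally show ?thesis .
qed

lemma norm_increment_le:
  fixes g :: "real \<Rightarrow> 'b::real_normed_vector"
  assumes "\<And>t. t \<in> closed_segment 0 \<alpha> \<Longrightarrow> (g has_vector_derivative g' t) (at t within closed_segment 0 \<alpha>)"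
    and "\<And>t. t \<in> closed_segment 0 \<alpha> \<Longrightarrow> norm (g' t) \<le> M"
  shows "norm (g \<alpha> - g 0) \<le> M * \<bar>\<alpha>\<bar>"
proof -
  have "norm (g \<alpha> - g 0) \<le> M * norm (\<alpha> - 0)"
  proof (rule differentiable_bound)
    show "(g has_derivative (\<lambda>h. h *\<^sub>R g' t)) (at t within closed_segment 0 \<alpha>)" if "t \<in> closed_segment 0 \<alpha>" for t
      using assms(1)[OF that] by (simp add: has_vector_derivative_def)
    show "onorm (\<lambda>h. h *\<^sub>R g' t) \<le> M" if "t \<in> closed_segment 0 \<alpha>" for t
      by (rule onorm_le) (simp add: mult.commute[of M] mult_left_mono assms(2)[OF that])
  qed auto
  then show ?thesis by simp
qed

lemma Ck_on_lipschitz: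
  fixes f :: "'a::euclidean_space \<Rightarrow> 'b::real_normed_vector"
  assumes Ck: "Ck_on k f S" and D: "cbox a c \<subseteq> S"
    and bound: "\<And>es z. \<lbrakk>set es \<subseteq> Basis; length es \<le> k; z \<in> cbox a c\<rbrakk> \<Longrightarrow> norm (iter_partial S es f z) \<le> M"
    and es: "set es \<subseteq> Basis" "length es < k"
    and y: "y \<in> cbox a c" and z: "z \<in> cbox a c"
  shows "norm (iter_partial S es f y - iter_partial S es f z) \<le> M * DIM('a) * norm (y - z)"
proof (rule coordinate_walk[OF _ y z])
  show "0 \<le> M" using order_trans[OF norm_ge_zero bound[OF es(1) _ z]] es(2) by simp
  fix z e \<alpha> assume e: "e \<in> Basis" and zD: "z \<in> cbox a c" "z + \<alpha> *\<^sub>R e \<in> cbox a c"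
  let ?g = "\<lambda>t. iter_partial S es f (z + t *\<^sub>R e)"
  have "norm (?g \<alpha> - ?g 0) \<le> M * \<bar>\<alpha>\<bar>"
  proof (rule norm_increment_le)
    fix t assume t: "t \<in> closed_segment 0 \<alpha>"
    show "(?g has_vector_derivative iter_partial S (e # es) f (z + t *\<^sub>R e)) (at t within closed_segment 0 \<alpha>)"
      by (rule has_vector_derivative_within_subset[OF Ck_on_partial[OF Ck es e]])
         (use cbox_segment[OF zD] t D in auto)
    show "norm (iter_partial S (e # es) f (z + t *\<^sub>R e)) \<le> M"
      by (rule bound) (use es e cbox_segment[OF zD t] in auto)
  qed
  then show "norm (iter_partial S es f (z + \<alpha> *\<^sub>R e) - iter_partial S es f z) \<le> M * \<bar>\<alpha>\<bar>" by simp
qed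

text \<open>The mixed difference is an increment in direction u of g(z) = f(z + v) - f(z). The
  partial derivatives of g are increments of first partials of f, hence bounded by |v| through the
  second partials.\<close>

lemma Ck_on_second_difference:
  fixes f :: "'a::euclidean_space \<Rightarrow> 'b::real_normed_vector"
  assumes Ck: "Ck_on k f S" and k: "2 \<le> k" and D: "cbox a c \<subseteq> S"
    and bound: "\<And>es z. \<lbrakk>set es \<subseteq> Basis; length es \<le> k; z \<in> cbox a c\<rbrakk> \<Longrightarrow> norm (iter_partial S es f z) \<le> M"
    and z: "z \<in> cbox a c" "z + u \<in> cbox a c" "z + v \<in> cbox a c" "z + u + v \<in> cbox a c"
  shows "norm (f (z + u + v) - f (z + u) - f (z + v) + f z) \<le> M * (DIM('a))\<^sup>2 * norm u * norm v"
proof -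
  have M: "0 \<le> M" using order_trans[OF norm_ge_zero bound[of "[]" z]] z by simp
  define g where "g z = f (z + v) - f z" for z
  \<comment> \<open>The walk takes place in the intersection of the box with its translate by -v,
    again a box, so that both x and x + v remain in the original one.\<close>
  have Int: "\<exists>p q. cbox a c \<inter> cbox (a - v) (c - v) = cbox p q"
    unfolding Int_interval by blast
  then obtain p q where pq: "cbox a c \<inter> cbox (a - v) (c - v) = cbox p q" by blast
  have mem: "x \<in> cbox p q \<longleftrightarrow> x \<in> cbox a c \<and> x + v \<in> cbox a c" for x
    unfolding pq[symmetric] by (simp add: mem_box inner_diff_left inner_add_left algebra_simps)
  have "norm (g (z + u) - g z) \<le> (M * DIM('a) * norm v) * DIM('a) * norm ((z + u) - z)"
  proof (rule coordinate_walk)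
    show "z + u \<in> cbox p q" "z \<in> cbox p q" using z by (simp_all add: mem)
    fix x e \<alpha> assume e: "e \<in> Basis" and x: "x \<in> cbox p q" "x + \<alpha> *\<^sub>R e \<in> cbox p q"
    let ?g = "\<lambda>t. f ((x + v) + t *\<^sub>R e) - f (x + t *\<^sub>R e)"
    have "norm (?g \<alpha> - ?g 0) \<le> (M * DIM('a) * norm v) * \<bar>\<alpha>\<bar>"
    proof (rule norm_increment_le)
      fix t assume t: "t \<in> closed_segment 0 \<alpha>"
      have in_D: "x + s *\<^sub>R e \<in> cbox a c" "(x + v) + s *\<^sub>R e \<in> cbox a c" if "s \<in> closed_segment 0 \<alpha>" for s
        using cbox_segment[OF x that] by (simp_all add: mem add_ac)
      show "(?g has_vector_derivative partial_deriv S e f ((x + v) + t *\<^sub>R e) - partial_deriv S e f (x + t *\<^sub>R e))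
          (at t within closed_segment 0 \<alpha>)"
      proof (rule has_vector_derivative_diff)
        show "((\<lambda>t. f ((x + v) + t *\<^sub>R e)) has_vector_derivative partial_deriv S e f ((x + v) + t *\<^sub>R e)) (at t within closed_segment 0 \<alpha>)"
          by (rule has_vector_derivative_within_subset[OF Ck_on_partial[OF Ck _ _ e, of "[]", simplified]])
             (use k in_D t D in auto)
        show "((\<lambda>t. f (x + t *\<^sub>R e)) has_vector_derivative partial_deriv S e f (x + t *\<^sub>R e)) (at t within closed_segment 0 \<alpha>)"
          by (rule has_vector_derivative_within_subset[OF Ck_on_partial[OF Ck _ _ e, of "[]", simplified]])
             (use k in_D t D in auto)
      qed
      have "norm (iter_partial S [e] f ((x + v) + t *\<^sub>R e) - iter_partial S [e] f (x + t *\<^sub>R e))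
          \<le> M * DIM('a) * norm (((x + v) + t *\<^sub>R e) - (x + t *\<^sub>R e))"
        by (rule Ck_on_lipschitz[OF Ck D bound]) (use e k in_D[OF t] in auto)
      then show "norm (partial_deriv S e f ((x + v) + t *\<^sub>R e) - partial_deriv S e f (x + t *\<^sub>R e)) \<le> M * DIM('a) * norm v"
        by simp
    qed
    then show "norm (g (x + \<alpha> *\<^sub>R e) - g x) \<le> (M * DIM('a) * norm v) * \<bar>\<alpha>\<bar>"
      by (simp add: g_def add_ac)
  qed (use M in auto)
  then show ?thesis by (simp add: g_def power2_eq_square algebra_simps)
qed

text \<open>Compare \<open>p11\<close> with the point completing the parallelogram of the other
  three: the distance to it is a first-order term, the parallelogram a genuine second difference.
  The completing point has to lie in the box, which is why the boxes used later have half-width 3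
  r.\<close>

lemma Ck_on_four_points:
  fixes f :: "'a::euclidean_space \<Rightarrow> 'b::real_normed_vector"
  assumes Ck: "Ck_on k f S" and k: "2 \<le> k" and D: "cbox a c \<subseteq> S"
    and bound: "\<And>es z. \<lbrakk>set es \<subseteq> Basis; length es \<le> k; z \<in> cbox a c\<rbrakk> \<Longrightarrow> norm (iter_partial S es f z) \<le> M"
    and p: "p00 \<in> cbox a c" "p10 \<in> cbox a c" "p01 \<in> cbox a c" "p11 \<in> cbox a c" "p10 + p01 - p00 \<in> cbox a c"
  shows "norm (f p11 - f p10 - f p01 + f p00)
    \<le> M * (DIM('a))\<^sup>2 * (norm (p11 - p10 - p01 + p00) + norm (p10 - p00) * norm (p01 - p00))"
proof -
  have M: "0 \<le> M" using order_trans[OF norm_ge_zero bound[of "[]" p00]] p by simp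
  define q where "q = p10 + p01 - p00"
  have "norm (f p11 - f p10 - f p01 + f p00) \<le> norm (f p11 - f q) + norm (f q - f p10 - f p01 + f p00)"
    by (rule order_trans[OF _ norm_triangle_ineq]) (simp add: algebra_simps)
  also have "norm (f p11 - f q) \<le> M * DIM('a) * norm (p11 - q)"
    using Ck_on_lipschitz[OF Ck D bound, of "[]" p11 q] k p by (simp add: q_def)
  also have "\<dots> \<le> M * (DIM('a))\<^sup>2 * norm (p11 - q)"
  proof -
    have "real DIM('a) \<le> (real DIM('a))\<^sup>2"
      using DIM_positive[where 'a='a] by (simp add: power2_eq_square)
    then show ?thesis using M by (intro mult_right_mono mult_left_mono) auto
  qed
  also have "norm (f q - f p10 - f p01 + f p00) \<le> M * (DIM('a))\<^sup>2 * norm (p10 - p00) * norm (p01 - p00)"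
    using Ck_on_second_difference[OF Ck k D bound, of p00 "p10 - p00" "p01 - p00"] p
    by (simp add: q_def algebra_simps)
  finally show ?thesis by (simp add: q_def algebra_simps)
qed

lemma Ck_on_bounded_cbox:
  fixes f :: "'a::euclidean_space \<Rightarrow> 'b::real_normed_vector"
  assumes Ck: "Ck_on k f S" and D: "cbox a c \<subseteq> S"
  obtains M where "\<And>es z. \<lbrakk>set es \<subseteq> Basis; length es \<le> k; z \<in> cbox a c\<rbrakk> \<Longrightarrow> norm (iter_partial S es f z) \<le> M"
proof -
  let ?L = "{es. set es \<subseteq> (Basis::'a set) \<and> length es \<le> k}"
  have fin: "finite ?L" by (rule finite_lists_length_le[OF finite_Basis])
  have "\<exists>M. \<forall>z\<in>cbox a c. norm (iter_partial S es f z) \<le> M" if "es \<in> ?L" for es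
  proof -
    have "continuous_on (cbox a c) (iter_partial S es f)"
      by (rule continuous_on_subset[OF _ D]) (use Ck that in \<open>auto simp: Ck_on_def\<close>)
    then have "bounded (iter_partial S es f ` cbox a c)"
      by (intro compact_imp_bounded compact_continuous_image compact_cbox)
    then show ?thesis by (auto simp: bounded_iff)
  qed
  then obtain m where m: "\<And>es z. \<lbrakk>es \<in> ?L; z \<in> cbox a c\<rbrakk> \<Longrightarrow> norm (iter_partial S es f z) \<le> m es"
    by metis
  have "norm (iter_partial S es f z) \<le> (\<Sum>es\<in>?L. \<bar>m es\<bar>)"
    if "set es \<subseteq> Basis" "length es \<le> k" "z \<in> cbox a c" for es z
  proof -
    have "norm (iter_partial S es f z) \<le> \<bar>m es\<bar>" using m[of es z] that by auto
    also have "\<dots> \<le> (\<Sum>es\<in>?L. \<bar>m es\<bar>)" using fin that by (intro member_le_sum) auto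
    finally show ?thesis .
  qed
  then show thesis by (rule that)
qed

section \<open>Rotations and averages\<close>

lemma J_nth [simp]: "(J *v x) $ 1 = x $ 2" "(J *v x) $ 2 = - (x $ 1)"
  by (simp_all add: J_def matrix_vector_mult_def sum_2)

lemma J_J [simp]: "J *v (J *v x) = - x"
  by (simp add: vec_eq_iff forall_2)

lemma norm_J [simp]: "norm (J *v x) = norm x"
  by (simp add: norm_vec_def L2_set_def sum_2 add.commute)

lemma inner_J_self [simp]: "x \<bullet> (J *v x) = 0"
  by (simp add: inner_vec_def sum_2 mult.commute)

lemmas bounded_linear_J = matrix_vector_mul_bounded_linear[of J]

lemma bounded_linear_matrix_vector_left: "bounded_linear (\<lambda>A::real^'n^'m. A *v w)"
  by (intro linear_conv_bounded_linear[THEN iffD1] linearI)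
     (simp_all add: matrix_vector_mult_add_rdistrib scaleR_matrix_vector_assoc)

text \<open>The powers of t J are expressed through the Taylor coefficients of cosine and sine,
  whose recursions reproduce multiplication by J with J^2 = -I; no case distinction on parity is
  needed.\<close>

lemma mexp_J: "mexp (t *\<^sub>R J) = cos t *\<^sub>R mat 1 + sin t *\<^sub>R J"
proof -
  have pow: "((\<lambda>N. (t *\<^sub>R J) ** N) ^^ j) (mat 1) =
      (fact j * t ^ j) *\<^sub>R (cos_coeff j *\<^sub>R mat 1 + sin_coeff j *\<^sub>R J)" for j
  proof (induction j)
    case (Suc j)
    have "(t *\<^sub>R J) ** ((fact j * t ^ j) *\<^sub>R (cos_coeff j *\<^sub>R mat 1 + sin_coeff j *\<^sub>R J))
        = (t * (fact j * t ^ j)) *\<^sub>R (cos_coeff j *\<^sub>R J - sin_coeff j *\<^sub>R mat 1)"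
      by (simp add: vec_eq_iff forall_2 matrix_matrix_mult_def sum_2 J_def mat_def algebra_simps)
    also have "\<dots> = (fact (Suc j) * t ^ Suc j) *\<^sub>R (cos_coeff (Suc j) *\<^sub>R mat 1 + sin_coeff (Suc j) *\<^sub>R J)"
    proof -
      have "fact (Suc j) * t ^ Suc j * (a / real (Suc j)) = t * (fact j * t ^ j) * a" for a
        by (simp add: field_simps del: of_nat_Suc)
      then show ?thesis
        by (simp only: cos_coeff_Suc sin_coeff_Suc scaleR_add_right scaleR_scaleR minus_divide_left)
           (simp add: algebra_simps)
    qed
    finally show ?case using Suc by simp
  qed (simp add: cos_coeff_def sin_coeff_def)
  have "(\<lambda>j. (1 / fact j) *\<^sub>R (((\<lambda>N. (t *\<^sub>R J) ** N) ^^ j) (mat 1))) sums (cos t *\<^sub>R mat 1 + sin t *\<^sub>R J)"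
  proof -
    have "(\<lambda>j. (cos_coeff j *\<^sub>R t ^ j) *\<^sub>R mat 1 + (sin_coeff j *\<^sub>R t ^ j) *\<^sub>R J) sums (cos t *\<^sub>R mat 1 + sin t *\<^sub>R J)"
      by (intro sums_add sums_scaleR_left cos_converges sin_converges)
    then show ?thesis by (simp add: pow scaleR_add_right mult_ac)
  qed
  then show ?thesis by (simp add: mexp_def sums_iff)
qed

text \<open>The action of e^{tJ} on a vector in closed form.\<close>

definition rot :: "real \<Rightarrow> real^2 \<Rightarrow> real^2" where
  "rot t y = cos t *\<^sub>R y + sin t *\<^sub>R (J *v y)"

lemma mexp_mult_vec: "mexp (t *\<^sub>R J) *v y = rot t y"
  by (simp add: mexp_J rot_def matrix_vector_mult_add_rdistrib flip: scaleR_matrix_vector_assoc)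

lemma norm_rot [simp]: "norm (rot t y) = norm y"
proof -
  have "(norm (rot t y))\<^sup>2 = (norm y)\<^sup>2"
    unfolding power2_norm_eq_inner rot_def
    by (simp add: inner_vec_def sum_2) (use sin_cos_squared_add3[of t] in algebra)
  then show ?thesis by (simp add: power2_eq_iff_nonneg)
qed

lemma rot_0 [simp]: "rot 0 y = y"
  by (simp add: rot_def)

lemma rot_add: "rot t (x + y) = rot t x + rot t y"
  by (simp add: rot_def matrix_vector_right_distrib scaleR_add_right)

lemma rot_scaleR: "rot t (c *\<^sub>R x) = c *\<^sub>R rot t x"
  by (simp add: rot_def matrix_vector_mult_scaleR scaleR_add_right mult_ac)

lemma rot_minus: "rot t (- x) = - rot t x"
  using rot_scaleR[of t "-1" x] by simp

lemma rot_diff: "rot t (x - y) = rot t x - rot t y"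
  using rot_add[of t x "- y"] by (simp add: rot_minus)

lemma J_rot: "J *v rot t y = rot t (J *v y)"
  by (simp add: rot_def matrix_vector_right_distrib matrix_vector_mult_scaleR)

lemma rot_periodic [simp]: "rot (t + 2 * pi) y = rot t y"
  by (simp add: rot_def)

lemma has_vector_derivative_rot:
  assumes g: "(g has_real_derivative g') (at t within A)"
    and y: "(y has_vector_derivative y') (at t within A)"
  shows "((\<lambda>t. rot (g t) (y t)) has_vector_derivative g' *\<^sub>R rot (g t) (J *v y t) + rot (g t) y') (at t within A)"
proof -
  have "((\<lambda>t. J *v y t) has_vector_derivative J *v y') (at t within A)"
    by (rule bounded_linear.has_vector_derivative[OF bounded_linear_J y])
  then show ?thesis
    unfolding rot_def using g y
    by (auto intro!: derivative_eq_intros simp: matrix_vector_right_distrib matrix_vector_mult_scaleR algebra_simps)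
qed

lemma continuous_on_rot [continuous_intros]:
  fixes A :: "real set"
  assumes "continuous_on A g" "continuous_on A y"
  shows "continuous_on A (\<lambda>t. rot (g t) (y t))"
  unfolding rot_def
  by (intro continuous_intros bounded_linear.continuous_on[OF bounded_linear_J] assms)

lemma rot_lipschitz: "norm (rot t y - rot t' y) \<le> \<bar>t - t'\<bar> * norm y"
proof -
  have "norm (rot t y - rot t' y) \<le> norm y * norm (t - t')"
  proof (rule differentiable_bound[where S = UNIV])
    show "((\<lambda>t. rot t y) has_derivative (\<lambda>h. h *\<^sub>R rot t (J *v y))) (at t within UNIV)" for t
      using has_vector_derivative_rot[of "\<lambda>t. t" 1 t UNIV "\<lambda>t. y" 0]
      by (auto simp: has_vector_derivative_def rot_def)
    show "onorm (\<lambda>h. h *\<^sub>R rot t (J *v y)) \<le> norm y" for t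
      by (rule onorm_le) (simp add: mult.commute)
  qed auto
  then show ?thesis by (simp add: mult.commute)
qed

section \<open>Primitives and mean values\<close>

lemma interval_integral_has_derivative:
  fixes f :: "real \<Rightarrow> 'a::euclidean_space"
  assumes "continuous_on UNIV f"
  shows "((\<lambda>u. LBINT y=0..u. f y) has_vector_derivative f x) (at x)"
proof -
  \<comment> \<open>A compact window containing both 0 and x, with x in its interior, turns the
    one-sided statement into a two-sided derivative.\<close>
  define a b where "a = min 0 x - 1" and "b = max 0 x + 1"
  have "((\<lambda>u. LBINT y=ereal 0..ereal u. f y) has_vector_derivative f x) (at x within {a..b})"
    by (rule interval_integral_FTC2) (auto simp: a_def b_def intro: continuous_on_subset[OF assms])
  then show ?thesis by (simp add: a_def b_def at_within_Icc_at zero_ereal_def)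
qed

lemma interval_integral_unique:
  fixes f :: "real \<Rightarrow> 'a::euclidean_space"
  assumes cont: "continuous_on UNIV f" and G: "\<And>x. (G has_vector_derivative f x) (at x)"
  shows "(LBINT y=0..u. f y) = G u - G 0"
proof -
  obtain c where "\<And>x. x \<in> UNIV \<Longrightarrow> (LBINT y=0..ereal x. f y) - G x = c"
  proof (rule has_vector_derivative_zero_constant[of UNIV "\<lambda>x. (LBINT y=0..ereal x. f y) - G x"])
    show "((\<lambda>x. (LBINT y=0..x. f y) - G x) has_vector_derivative 0) (at x within UNIV)" for x
      using has_vector_derivative_diff[OF interval_integral_has_derivative[OF cont, of x] G[of x]] by simp
  qed auto
  then have c: "(LBINT y=0..ereal x. f y) - G x = c" for x by simp
  have "(LBINT y=0..0. f y) = 0" by simp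
  with c[of 0] have "c = - G 0" by (simp add: zero_ereal_def)
  with c[of u] show ?thesis by (simp add: diff_eq_eq)
qed

lemma avg_eq_interval_integral: "avg u = (1 / (2 * pi)) *\<^sub>R (LBINT y=0..ereal (2 * pi). u y)"
  by (simp add: avg_def)

lemma avg_eq_primitive:
  fixes f :: "real \<Rightarrow> 'a::euclidean_space"
  assumes "continuous_on UNIV f" "\<And>x. (G has_vector_derivative f x) (at x)"
  shows "avg f = (1 / (2 * pi)) *\<^sub>R (G (2 * pi) - G 0)"
  unfolding avg_eq_interval_integral by (simp only: interval_integral_unique[OF assms])

lemma norm_avg_le:
  fixes f :: "real \<Rightarrow> 'a::euclidean_space"
  assumes cont: "continuous_on UNIV f" and le: "\<And>x. norm (f x) \<le> B"
  shows "norm (avg f) \<le> B"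
proof -
  let ?G = "\<lambda>u. LBINT y=0..ereal u. f y"
  note G = interval_integral_has_derivative[OF cont]
  have "norm (?G (2 * pi) - ?G 0) \<le> B * norm (2 * pi - 0)"
  proof (rule differentiable_bound[where S = UNIV])
    show "(?G has_derivative (\<lambda>h. h *\<^sub>R f t)) (at t within UNIV)" for t
      using G by (simp add: has_vector_derivative_def)
    show "onorm (\<lambda>h. h *\<^sub>R f t) \<le> B" for t
      by (rule onorm_le) (simp add: mult.commute[of B] mult_left_mono le)
  qed auto
  then have "(1 / (2 * pi)) * norm (?G (2 * pi) - ?G 0) \<le> B"
    by (simp add: field_simps)
  then show ?thesis by (simp add: avg_eq_primitive[OF cont G])
qed

lemma avg_add:
  fixes f g :: "real \<Rightarrow> 'a::euclidean_space"
  assumes "continuous_on UNIV f" "continuous_on UNIV g"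
  shows "avg (\<lambda>x. f x + g x) = avg f + avg g"
proof -
  note F = interval_integral_has_derivative[OF assms(1)] and G = interval_integral_has_derivative[OF assms(2)]
  show ?thesis
    unfolding avg_eq_primitive[OF continuous_on_add[OF assms] has_vector_derivative_add[OF F G]]
      avg_eq_primitive[OF assms(1) F] avg_eq_primitive[OF assms(2) G]
    by (simp add: algebra_simps)
qed

lemma avg_scaleR:
  fixes f :: "real \<Rightarrow> 'a::euclidean_space"
  assumes "continuous_on UNIV f"
  shows "avg (\<lambda>x. c *\<^sub>R f x) = c *\<^sub>R avg f"
proof -
  note F = interval_integral_has_derivative[OF assms]
  have cF: "((\<lambda>u. c *\<^sub>R (LBINT y=0..ereal u. f y)) has_vector_derivative c *\<^sub>R f x) (at x)" for x
    using F[of x] by (auto intro!: derivative_eq_intros)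
  have cf: "continuous_on UNIV (\<lambda>x. c *\<^sub>R f x)" by (intro continuous_intros assms)
  show ?thesis
    unfolding avg_eq_primitive[OF cf cF] avg_eq_primitive[OF assms F]
    by (simp add: scaleR_diff_right mult.commute)
qed

lemma continuous_on_osc:
  "continuous_on UNIV u \<Longrightarrow> continuous_on UNIV (osc u)"
  unfolding osc_def by (intro continuous_intros)

lemma L_inv_has_derivative:
  fixes u :: "real \<Rightarrow> 'a::euclidean_space"
  assumes "continuous_on UNIV u"
  shows "(L_inv u has_vector_derivative u x) (at x)"
  unfolding L_inv_def osc_def
  using has_vector_derivative_diff[OF interval_integral_has_derivative[OF assms, of x]
      has_vector_derivative_const[of "avg (\<lambda>\<tau>. LBINT \<theta>=0..ereal \<tau>. u \<theta>)"]]
  by simp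

lemma A_op_has_derivative:
  fixes u :: "real \<Rightarrow> 'a::euclidean_space"
  assumes "continuous_on UNIV u"
  shows "(A_op u has_vector_derivative osc u x) (at x)"
  unfolding A_op_def by (rule L_inv_has_derivative[OF continuous_on_osc[OF assms]])

lemma trig_has_vector_derivative:
  fixes a b c :: "'a::real_normed_vector"
  shows "((\<lambda>t. sin t *\<^sub>R a - cos t *\<^sub>R b + c) has_vector_derivative cos x *\<^sub>R a + sin x *\<^sub>R b) (at x)"
  by (auto intro!: derivative_eq_intros)

lemma avg_trig:
  fixes a b c :: "'a::euclidean_space"
  shows "avg (\<lambda>t. cos t *\<^sub>R a + sin t *\<^sub>R b) = 0"
  by (subst avg_eq_primitive[OF _ trig_has_vector_derivative[of a b 0]]) (auto intro!: continuous_intros)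

text \<open>The rotation has mean zero, and the value is -J e^{\<tau>J}, its primitive of mean
  zero.\<close>

lemma A_op_mexp: "A_op (\<lambda>\<sigma>. mexp (\<sigma> *\<^sub>R J)) \<tau> = sin \<tau> *\<^sub>R mat 1 - cos \<tau> *\<^sub>R J"
proof -
  have *: "osc (\<lambda>\<sigma>. mexp (\<sigma> *\<^sub>R J)) = (\<lambda>\<sigma>. cos \<sigma> *\<^sub>R mat 1 + sin \<sigma> *\<^sub>R J)"
    by (auto simp: osc_def mexp_J avg_trig)
  have I: "(LBINT \<theta>=0..ereal t. cos \<theta> *\<^sub>R mat 1 + sin \<theta> *\<^sub>R J) = sin t *\<^sub>R mat 1 - cos t *\<^sub>R J + J" for t
    by (subst interval_integral_unique[OF _ trig_has_vector_derivative[of "mat 1" J J]])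
       (auto intro!: continuous_intros)
  have "avg (\<lambda>t. sin t *\<^sub>R mat 1 - cos t *\<^sub>R J + J) = avg (\<lambda>t. cos t *\<^sub>R (- J) + sin t *\<^sub>R mat 1) + avg (\<lambda>t. J)"
    by (subst avg_add[symmetric]) (auto intro!: continuous_intros simp: algebra_simps)
  also have "avg (\<lambda>t. J) = J"
    by (subst avg_eq_primitive[where G = "\<lambda>t. t *\<^sub>R J"]) (auto intro!: derivative_eq_intros)
  finally have a: "avg (\<lambda>t. sin t *\<^sub>R mat 1 - cos t *\<^sub>R J + J) = J" by (simp add: avg_trig del: scaleR_minus_right)
  show ?thesis unfolding A_op_def * L_inv_def osc_def I a by simp
qed

text \<open>Only the derivative is recorded: the additive constant fixed by the mean cancels in
  \<open>X_2nd\<close>, where the value at 0 is subtracted.\<close>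

lemma L_inv_A_op_mexp_has_derivative:
  "((\<lambda>\<tau>. L_inv (A_op (\<lambda>\<sigma>. mexp (\<sigma> *\<^sub>R J))) \<tau> *v w) has_vector_derivative - rot \<tau> (J *v w)) (at \<tau>)"
proof -
  have "(L_inv (A_op (\<lambda>\<sigma>. mexp (\<sigma> *\<^sub>R J))) has_vector_derivative sin \<tau> *\<^sub>R mat 1 - cos \<tau> *\<^sub>R J) (at \<tau>)"
    using L_inv_has_derivative[of "A_op (\<lambda>\<sigma>. mexp (\<sigma> *\<^sub>R J))" \<tau>]
    by (simp add: A_op_mexp[abs_def] continuous_intros)
  from bounded_linear.has_vector_derivative[OF bounded_linear_matrix_vector_left this, of w]
  show ?thesis
    by (simp add: rot_def matrix_vector_mult_diff_rdistrib flip: scaleR_matrix_vector_assoc)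
qed

section \<open>Periodic functions and functions on a strip\<close>

text \<open>Reduce t to one period. Small slopes of the periodic initial data thus give small
  deviations for all t.\<close>

lemma periodic_lipschitz_bound:
  fixes u :: "real \<Rightarrow> 'a::real_normed_vector"
  assumes per: "periodic_fun_simple u p" and p: "0 < p"
    and lip: "\<And>t t'. norm (u t - u t') \<le> K * \<bar>t - t'\<bar>"
  shows "norm (u t - u 0) \<le> K * p"
proof -
  interpret periodic_fun_simple u p by (rule per)
  define k where "k = \<lfloor>t / p\<rfloor>"
  have "of_int k \<le> t / p" "t / p \<le> of_int k + 1" by (auto simp: k_def)
  then have t: "0 \<le> t - of_int k * p" "t - of_int k * p \<le> p" using p by (auto simp: field_simps)
  have "0 \<le> K" using order_trans[OF norm_ge_zero lip[of 1 0]] by simp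
  have "norm (u t - u 0) = norm (u (t - of_int k * p) - u 0)" by (simp add: minus_of_int)
  also have "\<dots> \<le> K * \<bar>t - of_int k * p - 0\<bar>" by (rule lip)
  also have "\<dots> \<le> K * p" using t \<open>0 \<le> K\<close> by (intro mult_left_mono) auto
  finally show ?thesis .
qed

lemma lipschitz_of_vector_derivative:
  fixes u :: "real \<Rightarrow> 'a::real_normed_vector"
  assumes "\<And>t. (u has_vector_derivative u' t) (at t)" "\<And>t. norm (u' t) \<le> K"
  shows "norm (u t - u t') \<le> K * \<bar>t - t'\<bar>"
proof -
  have "norm (u t - u t') \<le> K * norm (t - t')"
  proof (rule differentiable_bound[where S = UNIV])
    show "(u has_derivative (\<lambda>h. h *\<^sub>R u' t)) (at t within UNIV)" for t
      using assms(1) by (simp add: has_vector_derivative_def)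
    show "onorm (\<lambda>h. h *\<^sub>R u' t) \<le> K" for t
      by (rule onorm_le) (simp add: mult.commute[of K] mult_left_mono assms(2))
  qed auto
  then show ?thesis by simp
qed

lemmas scaleR_has_vd = bounded_linear.has_vector_derivative[OF bounded_linear_scaleR_right]

text \<open>The assumed regularity consists of one-sided partial derivatives. Differentiating along
  a characteristic needs a total derivative on the strip, which follows from both partials and
  continuity of the fast one.\<close>

lemma C1_on_strip:
  fixes U :: "real \<Rightarrow> real \<Rightarrow> 'a::euclidean_space"
  assumes C1: "Ck_on 1 (\<lambda>(s, \<tau>). U s \<tau>) ({0..S} \<times> UNIV)" and S: "0 < S"
  defines "Us \<equiv> \<lambda>s \<tau>. vector_derivative (\<lambda>s'. U s' \<tau>) (at s within {0..S})"
    and "Ut \<equiv> \<lambda>s \<tau>. vector_derivative (U s) (at \<tau>)"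
  shows strip_slow: "s \<in> {0..S} \<Longrightarrow> ((\<lambda>s. U s \<tau>) has_vector_derivative Us s \<tau>) (at s within {0..S})"
    and strip_fast: "s \<in> {0..S} \<Longrightarrow> (U s has_vector_derivative Ut s \<tau>) (at \<tau>)"
    and strip_slow_continuous: "continuous_on {0..S} (\<lambda>s. Us s \<tau>)"
    and strip_characteristic: "s \<in> {0..S} \<Longrightarrow> \<epsilon> \<noteq> 0 \<Longrightarrow>
      ((\<lambda>s. U s (\<tau> + s / \<epsilon>)) has_vector_derivative Us s (\<tau> + s / \<epsilon>) + (1 / \<epsilon>) *\<^sub>R Ut s (\<tau> + s / \<epsilon>)) (at s within {0..S})"
proof -
  let ?D = "{0..S} \<times> (UNIV :: real set)"
  let ?f = "\<lambda>(s, \<tau>). U s \<tau>"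
  have e: "(1, 0) \<in> (Basis :: (real \<times> real) set)" "(0, 1) \<in> (Basis :: (real \<times> real) set)"
    by (auto simp: Basis_prod_def)
  have slow: "((\<lambda>s. U s \<tau>) has_vector_derivative iter_partial ?D [(1, 0)] ?f (s, \<tau>)) (at s within {0..S})"
    if "s \<in> {0..S}" for s \<tau>
    using Ck_on_partial[OF C1 _ _ e(1), of "[]" "(0, \<tau>)" s] that by (simp del: atLeastAtMost_iff)
  have fast: "(U s has_vector_derivative iter_partial ?D [(0, 1)] ?f (s, \<tau>)) (at \<tau>)"
    if "s \<in> {0..S}" for s \<tau>
    using Ck_on_partial[OF C1 _ _ e(2), of "[]" "(s, 0)" \<tau>] that by simp
  have Us: "Us s \<tau> = iter_partial ?D [(1, 0)] ?f (s, \<tau>)" if "s \<in> {0..S}" for s \<tau>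
    unfolding Us_def using slow[OF that] S that by (intro vector_derivative_within_closed_interval) auto
  have Ut: "Ut s \<tau> = iter_partial ?D [(0, 1)] ?f (s, \<tau>)" if "s \<in> {0..S}" for s \<tau>
    unfolding Ut_def using fast[OF that] by (rule vector_derivative_at)
  have contD: "continuous_on ?D (iter_partial ?D [e] ?f)" if "e \<in> Basis" for e
    by (rule conjunct2[OF C1[unfolded Ck_on_def], rule_format]) (use that in simp)
  show 1: "((\<lambda>s. U s \<tau>) has_vector_derivative Us s \<tau>) (at s within {0..S})" if "s \<in> {0..S}" for s \<tau>
    using slow[OF that] Us[OF that] by simp
  show 2: "(U s has_vector_derivative Ut s \<tau>) (at \<tau>)" if "s \<in> {0..S}" for s \<tau>
    using fast[OF that] Ut[OF that] by simp
  show "continuous_on {0..S} (\<lambda>s. Us s \<tau>)" for \<tau>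
  proof -
    have "continuous_on {0..S} (\<lambda>s. iter_partial ?D [(1, 0)] ?f (s, \<tau>))"
      by (rule continuous_on_compose2[OF contD[OF e(1)]]) (auto intro!: continuous_intros)
    then show ?thesis by (rule continuous_on_eq) (simp add: Us)
  qed
  show "((\<lambda>s. U s (\<tau> + s / \<epsilon>)) has_vector_derivative Us s (\<tau> + s / \<epsilon>) + (1 / \<epsilon>) *\<^sub>R Ut s (\<tau> + s / \<epsilon>)) (at s within {0..S})"
    if s: "s \<in> {0..S}" and \<epsilon>: "\<epsilon> \<noteq> 0" for s \<tau> \<epsilon>
  proof -
    let ?t = "\<tau> + s / \<epsilon>"
    have "((\<lambda>(x, y). U x y) has_derivative (\<lambda>(tx, ty). tx *\<^sub>R Us s ?t + blinfun_apply (blinfun_scaleR_left (Ut s ?t)) ty)) (at (s, ?t) within ?D)"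
    proof (rule has_derivative_partialsI)
      show "((\<lambda>x. U x ?t) has_derivative (\<lambda>tx. tx *\<^sub>R Us s ?t)) (at s within {0..S})"
        using 1[OF s] by (simp add: has_vector_derivative_def)
      show "((\<lambda>y. U x y) has_derivative blinfun_apply (blinfun_scaleR_left (Ut x y))) (at y within UNIV)"
        if "x \<in> {0..S}" for x y
        using 2[OF that] by (simp add: has_vector_derivative_def)
      have "continuous_on ?D (\<lambda>(x, y). Ut x y)"
        by (rule continuous_on_eq[OF contD[OF e(2)]]) (auto simp: Ut)
      then have "continuous_on ?D (\<lambda>z. blinfun_scaleR_left (case z of (x, y) \<Rightarrow> Ut x y))"
        by (intro continuous_intros)
      then show "continuous (at (s, ?t) within ?D) (\<lambda>(x, y). blinfun_scaleR_left (Ut x y))"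
        using s by (auto simp: continuous_on_eq_continuous_within case_prod_unfold)
    qed auto
    then have "((\<lambda>(x, y). U x y) has_derivative (\<lambda>(tx, ty). tx *\<^sub>R Us s ?t + blinfun_apply (blinfun_scaleR_left (Ut s ?t)) ty))
        (at (s, ?t) within (\<lambda>s. (s, \<tau> + s / \<epsilon>)) ` {0..S})"
      by (rule has_derivative_subset) auto
    moreover have "((\<lambda>s. (s, \<tau> + s / \<epsilon>)) has_derivative (\<lambda>h. (h, h / \<epsilon>))) (at s within {0..S})"
      using \<epsilon> by (auto intro!: derivative_eq_intros)
    ultimately have "((\<lambda>s. (\<lambda>(x, y). U x y) (s, \<tau> + s / \<epsilon>)) has_derivative
        (\<lambda>h. (\<lambda>(tx, ty). tx *\<^sub>R Us s ?t + blinfun_apply (blinfun_scaleR_left (Ut s ?t)) ty) (h, h / \<epsilon>))) (at s within {0..S})"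
      by (rule has_derivative_in_compose[rotated])
    then show ?thesis
      by (simp add: has_vector_derivative_def scaleR_add_right divide_inverse_commute mult.commute)
  qed
qed

section \<open>Supremum norms by components\<close>

lemma Linf_norm_le:
  assumes "\<And>\<tau>. norm (u \<tau>) \<le> B"
  shows "Linf_norm u \<le> B"
proof -
  have "\<bar>u \<tau> $ i\<bar> \<le> B" for \<tau> i
    using component_le_norm_cart[of "u \<tau>" i] assms[of \<tau>] by linarith
  then show ?thesis unfolding Linf_norm_def by (intro max.boundedI cSUP_least) auto
qed

lemma component_le_Linf_norm:
  assumes "\<And>\<tau>. norm (u \<tau>) \<le> B"
  shows "\<bar>u \<tau> $ i\<bar> \<le> Linf_norm u"
proof -
  have b: "bdd_above (range (\<lambda>\<tau>. \<bar>u \<tau> $ i\<bar>))" for i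
    by (rule bdd_aboveI2[where M = B]) (use component_le_norm_cart assms order_trans in blast)
  have "\<bar>u \<tau> $ i\<bar> \<le> (SUP \<tau>. \<bar>u \<tau> $ i\<bar>)" by (rule cSUP_upper[OF UNIV_I b])
  moreover have "i = 1 \<or> i = 2" by (rule exhaust_2)
  ultimately show ?thesis unfolding Linf_norm_def by auto
qed

text \<open>The bound \<open>R\<close> ensures that the supremum over s is taken over a set bounded
  above. The triangle inequality is used component by component, so no norm-equivalence factor
  multiplies the supremum of Y.\<close>

lemma Linf_norm_le_Linf_Linf:
  assumes s: "s \<in> {0..S}" and Y: "\<And>s \<tau>. s \<in> {0..S} \<Longrightarrow> norm (Y s \<tau>) \<le> R"
    and u: "\<And>\<tau>. norm (u \<tau> - Y s \<tau>) \<le> d"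
  shows "Linf_norm u \<le> Linf_Linf_norm S Y + d"
proof -
  have "bdd_above ((\<lambda>s. Linf_norm (Y s)) ` {0..S})"
    by (rule bdd_aboveI2[where M = R]) (rule Linf_norm_le[OF Y])
  then have sup: "Linf_norm (Y s) \<le> Linf_Linf_norm S Y"
    unfolding Linf_Linf_norm_def by (rule cSUP_upper[OF s])
  have "\<bar>u \<tau> $ i\<bar> \<le> Linf_Linf_norm S Y + d" for \<tau> i
  proof -
    have "\<bar>u \<tau> $ i\<bar> \<le> \<bar>Y s \<tau> $ i\<bar> + \<bar>(u \<tau> - Y s \<tau>) $ i\<bar>" by simp
    then show ?thesis
      using component_le_Linf_norm[where u = "Y s" and \<tau> = \<tau> and i = i, OF Y[OF s]] component_le_norm_cart[of "u \<tau> - Y s \<tau>" i] u[of \<tau>] sup by linarith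
  qed
  then show ?thesis unfolding Linf_norm_def by (intro max.boundedI cSUP_least) auto
qed

section \<open>The desingularised system\<close>

lemma near_in_cbox:
  fixes x x0 :: "'a::euclidean_space"
  assumes "norm (x - x0) \<le> r"
  shows "x \<in> cbox (x0 - r *\<^sub>R One) (x0 + r *\<^sub>R One)"
  unfolding mem_box
proof (intro ballI conjI)
  fix i :: 'a assume i: "i \<in> Basis"
  have "\<bar>(x - x0) \<bullet> i\<bar> \<le> r" using Basis_le_norm[OF i, of "x - x0"] assms by linarith
  then show "(x0 - r *\<^sub>R One) \<bullet> i \<le> x \<bullet> i" "x \<bullet> i \<le> (x0 + r *\<^sub>R One) \<bullet> i"
    using i by (auto simp: inner_diff_left inner_add_left)
qed

locale gyrating_particle =
  fixes T c0 C_E C_b :: real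
    and x0 v0 :: "real^2"
    and b :: "real^2 \<Rightarrow> real"
    and E :: "real \<Rightarrow> real \<Rightarrow> real^2 \<Rightarrow> real^2"
  assumes T_pos: "T > 0"
    and c0_pos: "c0 > 0" and b_ge: "\<forall>x. b x \<ge> c0"
    and C_E_pos: "C_E > 0" and C_b_pos: "C_b > 0"
    and E_lipschitz: "\<forall>\<epsilon>\<in>{0<..1}. \<forall>t\<in>{0..T}. \<forall>x1 x2. norm (E \<epsilon> t x1 - E \<epsilon> t x2) \<le> C_E * norm (x1 - x2)"
    and b_lipschitz: "\<forall>x1 x2. \<bar>b x1 - b x2\<bar> \<le> C_b * norm (x1 - x2)"
    and E_C3: "\<forall>\<epsilon>\<in>{0<..1}. Ck_on 3 (\<lambda>(t, x). E \<epsilon> t x) ({0..T} \<times> UNIV)"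
    and E_bounded: "\<forall>K. compact K \<and> K \<subseteq> {0..T} \<times> UNIV \<longrightarrow>
          (\<exists>M. \<forall>\<epsilon>\<in>{0<..1}. \<forall>es. set es \<subseteq> Basis \<and> length es \<le> 3 \<longrightarrow>
             (\<forall>z\<in>K. norm (iter_partial ({0..T} \<times> UNIV) es (\<lambda>(t, x). E \<epsilon> t x) z) \<le> M))"
    and b_C3: "Ck_on 3 b UNIV"
begin

section \<open>The right-hand side and its regularity, uniform in \<epsilon>\<close>

abbreviation "b0 \<equiv> b x0"

lemma b0_pos: "0 < b0"
  using c0_pos b_ge by (meson less_le_trans)

lemma b_four_points:
  obtains M where "0 \<le> M" "\<And>p00 p10 p01 p11. \<lbrakk>norm (p00 - x0) \<le> r; norm (p10 - x0) \<le> r; norm (p01 - x0) \<le> r; norm (p11 - x0) \<le> r\<rbrakk>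
    \<Longrightarrow> \<bar>b p11 - b p10 - b p01 + b p00\<bar> \<le> M * (norm (p11 - p10 - p01 + p00) + norm (p10 - p00) * norm (p01 - p00))"
proof -
  \<comment> \<open>Three radii leave room for p10 + p01 - p00.\<close>
  define D where "D = cbox (x0 - (3 * r) *\<^sub>R One) (x0 + (3 * r) *\<^sub>R One)"
  obtain M where M: "\<And>es z. \<lbrakk>set es \<subseteq> Basis; length es \<le> 3; z \<in> D\<rbrakk> \<Longrightarrow> norm (iter_partial UNIV es b z) \<le> M"
    unfolding D_def using Ck_on_bounded_cbox[OF b_C3 subset_UNIV] by blast
  then have M': "\<And>es z. \<lbrakk>set es \<subseteq> Basis; length es \<le> 3; z \<in> D\<rbrakk> \<Longrightarrow> norm (iter_partial UNIV es b z) \<le> \<bar>M\<bar>"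
    by (meson abs_ge_self order_trans)
  have "\<bar>b p11 - b p10 - b p01 + b p00\<bar> \<le> (\<bar>M\<bar> * 4) * (norm (p11 - p10 - p01 + p00) + norm (p10 - p00) * norm (p01 - p00))"
    if p: "norm (p00 - x0) \<le> r" "norm (p10 - x0) \<le> r" "norm (p01 - x0) \<le> r" "norm (p11 - x0) \<le> r" for p00 p10 p01 p11
  proof -
    have r: "0 \<le> r" using order_trans[OF norm_ge_zero p(1)] .
    have "norm (p10 + p01 - p00 - x0) \<le> norm (p10 - x0) + norm (p01 - x0) + norm (p00 - x0)"
      using norm_triangle_ineq4[of "p10 - x0 + (p01 - x0)" "p00 - x0"] norm_triangle_ineq[of "p10 - x0" "p01 - x0"]
      by (simp add: algebra_simps)
    then have "p10 + p01 - p00 \<in> D" unfolding D_def using p by (intro near_in_cbox) auto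
    moreover have "x \<in> D" if "norm (x - x0) \<le> r" for x
      unfolding D_def using that r by (intro near_in_cbox) auto
    ultimately have "norm (b p11 - b p10 - b p01 + b p00)
        \<le> \<bar>M\<bar> * (DIM(real^2))\<^sup>2 * (norm (p11 - p10 - p01 + p00) + norm (p10 - p00) * norm (p01 - p00))"
      unfolding D_def using p
      by (intro Ck_on_four_points[OF b_C3 _ subset_UNIV] M'[unfolded D_def]) auto
    then show ?thesis by (simp add: power2_eq_square)
  qed
  then show thesis by (intro that[of "\<bar>M\<bar> * 4"]) auto
qed

lemma E_x0_bounded:
  obtains m where "0 \<le> m" "\<And>\<epsilon> t. \<lbrakk>\<epsilon> \<in> {0<..1}; t \<in> {0..T}\<rbrakk> \<Longrightarrow> norm (E \<epsilon> t x0) \<le> m"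
proof -
  have "compact ({0..T} \<times> {x0}) \<and> {0..T} \<times> {x0} \<subseteq> {0..T} \<times> UNIV" by (auto intro: compact_Times)
  from mp[OF spec[OF E_bounded] this] obtain M
    where M: "\<forall>\<epsilon>\<in>{0<..1}. \<forall>es. set es \<subseteq> Basis \<and> length es \<le> 3 \<longrightarrow>
      (\<forall>z\<in>{0..T} \<times> {x0}. norm (iter_partial ({0..T} \<times> UNIV) es (\<lambda>(t, x). E \<epsilon> t x) z) \<le> M)" by (elim exE)
  show thesis
  proof (rule that[of "\<bar>M\<bar>"])
    show "norm (E \<epsilon> t x0) \<le> \<bar>M\<bar>" if "\<epsilon> \<in> {0<..1}" "t \<in> {0..T}" for \<epsilon> t
      using M[rule_format, OF that(1), of "[]" "(t, x0)"] that(2) by simp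
  qed simp
qed

text \<open>One compact box in time and space gives derivative bounds common to all \<epsilon>. The
  factor 9 is the square of the dimension 3 of that box and also covers the Lipschitz factor
  3.\<close>

lemma E_c11:
  obtains M where "\<And>\<epsilon>. \<epsilon> \<in> {0<..1} \<Longrightarrow> c11 M T r (\<lambda>t \<tau> x. E \<epsilon> t (x0 + x))"
proof -
  define lo hi :: "real^2" where "lo = x0 - (3 * r) *\<^sub>R One" and "hi = x0 + (3 * r) *\<^sub>R One"
  define D where "D = cbox (0, lo) (T, hi)"
  have D: "z \<in> D \<longleftrightarrow> fst z \<in> {0..T} \<and> snd z \<in> cbox lo hi" for z
    by (cases z) (auto simp: D_def cbox_Pair_eq)
  have D_sub: "D \<subseteq> {0..T} \<times> UNIV" using D by auto
  then obtain M where M: "\<And>\<epsilon> es z. \<lbrakk>\<epsilon> \<in> {0<..1}; set es \<subseteq> Basis; length es \<le> 3; z \<in> D\<rbrakk> \<Longrightarrow>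
      norm (iter_partial ({0..T} \<times> UNIV) es (\<lambda>(t, x). E \<epsilon> t x) z) \<le> M"
    using E_bounded unfolding D_def by (metis compact_cbox)
  have M': "norm (iter_partial ({0..T} \<times> UNIV) es (\<lambda>(t, x). E \<epsilon> t x) z) \<le> \<bar>M\<bar>"
    if "\<epsilon> \<in> {0<..1}" "set es \<subseteq> Basis" "length es \<le> 3" "z \<in> D" for \<epsilon> es z
    using M[OF that] by linarith
  have near: "x0 + x \<in> cbox lo hi" if "norm x \<le> 3 * r" for x
    unfolding lo_def hi_def by (rule near_in_cbox) (use that in simp)
  have near1: "x0 + x \<in> cbox lo hi" if "norm x \<le> r" for x
    using that order_trans[OF norm_ge_zero that] by (intro near) auto
  have pair: "norm (s, x) \<le> \<bar>s\<bar> + norm x" for s :: real and x :: "real^2"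
    using norm_Pair_le[of s x] by simp
  have "c11 (9 * \<bar>M\<bar>) T r (\<lambda>t \<tau> x. E \<epsilon> t (x0 + x))" if \<epsilon>: "\<epsilon> \<in> {0<..1}" for \<epsilon>
  proof (rule c11I)
    fix t t' and x x' :: "real^2" assume t: "t \<in> {0..T}" "t' \<in> {0..T}" and x: "norm x \<le> r" "norm x' \<le> r"
    have "norm (E \<epsilon> t (x0 + x) - E \<epsilon> t' (x0 + x')) \<le> \<bar>M\<bar> * DIM(real \<times> (real^2)) * norm ((t, x0 + x) - (t', x0 + x'))"
      using Ck_on_lipschitz[OF bspec[OF E_C3 \<epsilon>] D_sub[unfolded D_def] M'[OF \<epsilon>, unfolded D_def], of "[]" "(t, x0 + x)" "(t', x0 + x')"]
        t x near1 D unfolding D_def by auto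
    also have "\<dots> \<le> 9 * \<bar>M\<bar> * (\<bar>t - t'\<bar> + norm (x - x'))"
      using pair[of "t - t'" "x - x'"] by (simp add: mult_mono)
    finally show "norm (E \<epsilon> t (x0 + x) - E \<epsilon> t' (x0 + x')) \<le> 9 * \<bar>M\<bar> * (\<bar>t - t'\<bar> + norm (x - x'))" .
  next
    fix t h d and p00 p10 p01 p11 :: "real^2"
    assume t: "0 \<le> t" "0 \<le> h" "0 \<le> d" "t + h + d \<le> T"
      and p: "norm p00 \<le> r" "norm p10 \<le> r" "norm p01 \<le> r" "norm p11 \<le> r"
    define z00 z10 z01 z11 where "z00 = (t, x0 + p00)" and "z10 = (t + h, x0 + p10)" and "z01 = (t + d, x0 + p01)" and "z11 = (t + h + d, x0 + p11)"
    note z = z00_def z10_def z01_def z11_def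
    have "norm (p10 + p01 - p00) \<le> norm p10 + norm p01 + norm p00"
      using norm_triangle_ineq4[of "p10 + p01" p00] norm_triangle_ineq[of p10 p01] by linarith
    then have n: "x0 + (p10 + p01 - p00) \<in> cbox lo hi" using p by (intro near) auto
    have "norm ((\<lambda>(t, x). E \<epsilon> t x) z11 - (\<lambda>(t, x). E \<epsilon> t x) z10 - (\<lambda>(t, x). E \<epsilon> t x) z01 + (\<lambda>(t, x). E \<epsilon> t x) z00)
      \<le> \<bar>M\<bar> * (DIM(real \<times> (real^2)))\<^sup>2 * (norm (z11 - z10 - z01 + z00) + norm (z10 - z00) * norm (z01 - z00))"
      by (rule Ck_on_four_points[OF bspec[OF E_C3 \<epsilon>] _ D_sub[unfolded D_def] M'[OF \<epsilon>, unfolded D_def]])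
         (use t p near1 n in \<open>auto simp: D_def[symmetric] D z algebra_simps\<close>)
    also have "\<dots> \<le> 9 * \<bar>M\<bar> * (norm (p11 - p10 - p01 + p00) + (h + norm (p10 - p00)) * (d + norm (p01 - p00)))"
    proof -
      have "z11 - z10 - z01 + z00 = (0, p11 - p10 - p01 + p00)" by (simp add: z)
      then have "norm (z11 - z10 - z01 + z00) = norm (p11 - p10 - p01 + p00)" by (simp only: norm_Pair) simp
      moreover have "norm (z10 - z00) \<le> h + norm (p10 - p00)" "norm (z01 - z00) \<le> d + norm (p01 - p00)"
        using pair[of h "p10 - p00"] pair[of d "p01 - p00"] t by (simp_all add: z)
      ultimately show ?thesis
        using t by (simp add: power2_eq_square) (intro mult_left_mono add_mono mult_mono; simp)
    qed
    finally show "norm (E \<epsilon> (t + h + d) (x0 + p11) - E \<epsilon> (t + h) (x0 + p10) - E \<epsilon> (t + d) (x0 + p01) + E \<epsilon> t (x0 + p00))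
      \<le> 9 * \<bar>M\<bar> * (norm (p11 - p10 - p01 + p00) + (h + norm (p10 - p00)) * (d + norm (p01 - p00)))"
      by (simp add: z)
  qed simp
  then show thesis by (rule that)
qed

text \<open>
  For \<open>p = (Z, Y)\<close> the vector \<open>disp \<tau> p\<close> is \<open>(X - x\<^sub>0) / \<epsilon>\<close>.
\<close>

definition disp :: "real \<Rightarrow> (real^2) \<times> (real^2) \<Rightarrow> real^2" where
  "disp \<tau> p = fst p - (1 / b0) *\<^sub>R rot \<tau> (J *v snd p)"

definition rel_b :: "real \<Rightarrow> real^2 \<Rightarrow> real" where
  "rel_b \<epsilon> q = (1 / \<epsilon>) * (b (x0 + \<epsilon> *\<^sub>R q) / b0 - 1)"

definition rhs_Y :: "real \<Rightarrow> real \<Rightarrow> real \<Rightarrow> (real^2) \<times> (real^2) \<Rightarrow> real^2" where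
  "rhs_Y \<epsilon> s \<tau> p = rel_b \<epsilon> (disp \<tau> p) *\<^sub>R (J *v snd p)
     + rot (- \<tau>) ((1 / b0) *\<^sub>R E \<epsilon> (s / b0) (x0 + \<epsilon> *\<^sub>R disp \<tau> p))"

text \<open>The first component contains no source e^{\<tau>J} Y / (\<epsilon> b0): it cancels
  against the \<tau>-derivative of J e^{\<tau>J} Y / b0 because J^2 = -I. What remains is the image
  of the forcing of Y under the same map J e^{\<tau>J} / b0.\<close>

definition rhs :: "real \<Rightarrow> real \<Rightarrow> real \<Rightarrow> (real^2) \<times> (real^2) \<Rightarrow> (real^2) \<times> (real^2)" where
  "rhs \<epsilon> s \<tau> p = ((1 / b0) *\<^sub>R rot \<tau> (J *v rhs_Y \<epsilon> s \<tau> p), rhs_Y \<epsilon> s \<tau> p)"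

text \<open>A common operator bound for \<open>disp\<close> and for the map sending y to (J
  e^{\<tau>J} y / b0, y).\<close>

definition "cq = 1 + 1 / b0"

lemma cq_ge_1: "1 \<le> cq"
  using b0_pos by (simp add: cq_def)

lemma disp_diff: "disp \<tau> (p - p') = disp \<tau> p - disp \<tau> p'"
  by (simp add: disp_def matrix_vector_mult_diff_distrib rot_diff scaleR_diff_right)

lemma norm_disp_le: "norm (disp \<tau> p) \<le> cq * norm p"
proof -
  have "norm (disp \<tau> p) \<le> norm (fst p) + (1 / b0) * norm (snd p)"
    unfolding disp_def using b0_pos by (intro order_trans[OF norm_triangle_ineq4] add_mono) auto
  also have "\<dots> \<le> norm p + (1 / b0) * norm p"
    using b0_pos by (intro add_mono mult_left_mono) (cases p; auto simp: norm_fst_le norm_snd_le)+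
  finally show ?thesis by (simp add: cq_def algebra_simps)
qed

lemma norm_pair_le: "norm ((1 / b0) *\<^sub>R rot \<tau> (J *v y), y) \<le> cq * norm y"
  using norm_Pair_le[of "(1 / b0) *\<^sub>R rot \<tau> (J *v y)" y] b0_pos
  by (simp add: cq_def algebra_simps)

lemma rel_b_diff: "0 < \<epsilon> \<Longrightarrow> rel_b \<epsilon> q - rel_b \<epsilon> q' = (b (x0 + \<epsilon> *\<^sub>R q) - b (x0 + \<epsilon> *\<^sub>R q')) / (\<epsilon> * b0)"
  using b0_pos by (simp add: rel_b_def field_simps)

lemma rel_b_lipschitz:
  assumes "0 < \<epsilon>"
  shows "\<bar>rel_b \<epsilon> q - rel_b \<epsilon> q'\<bar> \<le> C_b / b0 * norm (q - q')"
proof -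
  have "\<bar>b (x0 + \<epsilon> *\<^sub>R q) - b (x0 + \<epsilon> *\<^sub>R q')\<bar> \<le> C_b * norm ((x0 + \<epsilon> *\<^sub>R q) - (x0 + \<epsilon> *\<^sub>R q'))"
    using b_lipschitz by blast
  also have "(x0 + \<epsilon> *\<^sub>R q) - (x0 + \<epsilon> *\<^sub>R q') = \<epsilon> *\<^sub>R (q - q')" by (simp add: algebra_simps)
  finally have "\<bar>b (x0 + \<epsilon> *\<^sub>R q) - b (x0 + \<epsilon> *\<^sub>R q')\<bar> \<le> C_b * (\<epsilon> * norm (q - q'))"
    using assms by simp
  then show ?thesis
    using assms b0_pos by (simp add: rel_b_diff[OF assms] abs_mult divide_le_eq mult_ac)
qed

lemma rel_b_0: "rel_b \<epsilon> 0 = 0"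
  using b0_pos by (simp add: rel_b_def)

lemma rel_b_bound: "0 < \<epsilon> \<Longrightarrow> \<bar>rel_b \<epsilon> q\<bar> \<le> C_b / b0 * norm q"
  using rel_b_lipschitz[of \<epsilon> q 0] by (simp add: rel_b_0)

text \<open>Evaluating b at x0 + \<epsilon> q puts a factor \<epsilon> on the mixed difference of q
  and \<epsilon>^2 on the product of first differences; division by \<epsilon> leaves coefficients
  bounded for \<epsilon> \<le> 1.\<close>

lemma rel_b_c11:
  obtains M where "\<And>\<epsilon>. \<epsilon> \<in> {0<..1} \<Longrightarrow> c11 M S r (\<lambda>s \<tau>. rel_b \<epsilon>)"
proof -
  obtain M where M: "0 \<le> M" and bM: "\<And>p00 p10 p01 p11. \<lbrakk>norm (p00 - x0) \<le> r; norm (p10 - x0) \<le> r; norm (p01 - x0) \<le> r; norm (p11 - x0) \<le> r\<rbrakk>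
    \<Longrightarrow> \<bar>b p11 - b p10 - b p01 + b p00\<bar> \<le> M * (norm (p11 - p10 - p01 + p00) + norm (p10 - p00) * norm (p01 - p00))"
    using b_four_points[of r] by blast
  define L where "L = (C_b + M) / b0"
  have L: "0 \<le> L" "C_b / b0 \<le> L" "M / b0 \<le> L" using C_b_pos M b0_pos by (simp_all add: L_def divide_right_mono)
  have "c11 L S r (\<lambda>s \<tau>. rel_b \<epsilon>)" if \<epsilon>: "\<epsilon> \<in> {0<..1}" for \<epsilon>
  proof (rule c11I[OF L(1)])
    fix s s' :: real and q q' :: "real^2"
    have "\<bar>rel_b \<epsilon> q - rel_b \<epsilon> q'\<bar> \<le> C_b / b0 * norm (q - q')" using \<epsilon> by (intro rel_b_lipschitz) auto
    also have "\<dots> \<le> L * (\<bar>s - s'\<bar> + norm (q - q'))" using L by (intro mult_mono) auto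
    finally show "norm (rel_b \<epsilon> q - rel_b \<epsilon> q') \<le> L * (\<bar>s - s'\<bar> + norm (q - q'))" by simp
  next
    fix h d :: real and q00 q10 q01 q11 :: "real^2"
    assume hd: "0 \<le> h" "0 \<le> d" and q: "norm q00 \<le> r" "norm q10 \<le> r" "norm q01 \<le> r" "norm q11 \<le> r"
    define x where "x q = x0 + \<epsilon> *\<^sub>R q" for q
    have near: "norm (x q - x0) \<le> r" if "norm q \<le> r" for q
      using \<epsilon> that mult_mono[of \<epsilon> 1 "norm q" r] by (auto simp: x_def)
    have x_diff: "x q - x q' = \<epsilon> *\<^sub>R (q - q')" for q q' by (simp add: x_def algebra_simps)
    have x_diff2: "x q11 - x q10 - x q01 + x q00 = \<epsilon> *\<^sub>R (q11 - q10 - q01 + q00)" by (simp add: x_def algebra_simps)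
    have "\<bar>b (x q11) - b (x q10) - b (x q01) + b (x q00)\<bar>
        \<le> M * (norm (\<epsilon> *\<^sub>R (q11 - q10 - q01 + q00)) + norm (\<epsilon> *\<^sub>R (q10 - q00)) * norm (\<epsilon> *\<^sub>R (q01 - q00)))"
      unfolding x_diff2[symmetric] x_diff[symmetric] by (intro bM near q)
    also have "\<dots> = \<epsilon> * (M * (norm (q11 - q10 - q01 + q00) + \<epsilon> * (norm (q10 - q00) * norm (q01 - q00))))"
      using \<epsilon> by (simp add: distrib_left mult_ac)
    also have "\<dots> \<le> \<epsilon> * (M * (norm (q11 - q10 - q01 + q00) + 1 * (norm (q10 - q00) * norm (q01 - q00))))"
      using \<epsilon> M by (intro mult_left_mono add_left_mono mult_right_mono) auto
    also have "\<dots> \<le> \<epsilon> * (M * (norm (q11 - q10 - q01 + q00) + (h + norm (q10 - q00)) * (d + norm (q01 - q00))))"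
      using \<epsilon> M hd unfolding mult_1 by (intro mult_left_mono add_left_mono mult_mono) auto
    finally have "\<bar>b (x q11) - b (x q10) - b (x q01) + b (x q00)\<bar> / (\<epsilon> * b0)
        \<le> M / b0 * (norm (q11 - q10 - q01 + q00) + (h + norm (q10 - q00)) * (d + norm (q01 - q00)))" (is "_ \<le> _ * ?w")
      using \<epsilon> b0_pos by (simp add: divide_le_eq mult_ac)
    also have "\<dots> \<le> L * ?w" using L(3) hd by (intro mult_right_mono) auto
    finally have le: "\<bar>b (x q11) - b (x q10) - b (x q01) + b (x q00)\<bar> / (\<epsilon> * b0) \<le> L * ?w" .
    have "rel_b \<epsilon> q11 - rel_b \<epsilon> q10 - rel_b \<epsilon> q01 + rel_b \<epsilon> q00
        = (b (x q11) - b (x q10) - b (x q01) + b (x q00)) / (\<epsilon> * b0)"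
      using \<epsilon> b0_pos by (simp add: rel_b_def x_def field_simps)
    then show "norm (rel_b \<epsilon> q11 - rel_b \<epsilon> q10 - rel_b \<epsilon> q01 + rel_b \<epsilon> q00) \<le> L * ?w"
      using le \<epsilon> b0_pos by (simp only: real_norm_def abs_divide) simp
  qed
  then show thesis by (rule that)
qed

lemma linear_disp: "linear (disp \<tau>)"
  by (rule linearI) (simp_all add: disp_def matrix_vector_right_distrib matrix_vector_mult_scaleR rot_add rot_scaleR algebra_simps)

lemma rhs_c11:
  assumes r: "0 \<le> r"
  obtains L where "\<And>\<epsilon>. \<epsilon> \<in> {0<..1} \<Longrightarrow> c11 L (T * b0) r (rhs \<epsilon>)"
proof -
  obtain ME where ME: "\<And>\<epsilon>. \<epsilon> \<in> {0<..1} \<Longrightarrow> c11 ME T (cq * r) (\<lambda>t \<tau> x. E \<epsilon> t (x0 + x))"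
    using E_c11[of "cq * r"] by blast
  obtain Mb where Mb: "\<And>\<epsilon>. \<epsilon> \<in> {0<..1} \<Longrightarrow> c11 Mb T (cq * r) (\<lambda>s \<tau>. rel_b \<epsilon>)"
    using rel_b_c11[of T "cq * r"] by blast
  \<comment> \<open>Bound of the coefficient \<open>rel_b\<close> on the image under
    \<open>disp\<close> of the ball of radius \<open>r\<close>, as the product rule demands.\<close>
  define A where "A = C_b / b0 * (cq * r)"
  have A: "0 \<le> A" using C_b_pos b0_pos cq_ge_1 r by (simp add: A_def)
  have time: "0 \<le> 1 / b0" "1 / b0 \<le> cq" "1 / b0 * (T * b0) \<le> T" using b0_pos by (auto simp: cq_def)
  have "c11 (cq * (A * 1 + 5 * r * (cq * cq * Mb) + 2 * (cq * cq * Mb) * 1 + cq * (cq * cq * ME))) (T * b0) r (rhs \<epsilon>)"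
    if \<epsilon>: "\<epsilon> \<in> {0<..1}" for \<epsilon>
  proof -
    have b_part: "c11 (cq * cq * Mb) (T * b0) r (\<lambda>s \<tau> p. rel_b \<epsilon> (disp \<tau> p))"
      by (rule c11_compose_linear[OF Mb[OF \<epsilon>] r linear_disp cq_ge_1 norm_disp_le time])
    have J_part: "c11 1 (T * b0) r (\<lambda>s \<tau> p. J *v snd p)"
      by (rule c11_linear) (auto intro!: linearI norm_snd_le[of "snd p" "fst p" for p, simplified]
          simp: matrix_vector_right_distrib matrix_vector_mult_scaleR)
    have "\<bar>rel_b \<epsilon> (disp \<tau> p)\<bar> \<le> A" if "norm p \<le> r" for \<tau> p
    proof -
      have "norm (disp \<tau> p) \<le> cq * r"
        using cq_ge_1 that by (intro order_trans[OF norm_disp_le] mult_left_mono) auto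
      then show ?thesis
        unfolding A_def using \<epsilon> C_b_pos b0_pos by (intro order_trans[OF rel_b_bound] mult_left_mono) auto
    qed
    then have 1: "c11 (A * 1 + 5 * r * (cq * cq * Mb) + 2 * (cq * cq * Mb) * 1) (T * b0) r (\<lambda>s \<tau> p. rel_b \<epsilon> (disp \<tau> p) *\<^sub>R (J *v snd p))"
      by (intro c11_scaleR[OF b_part J_part])
         (auto simp: A r intro: order_trans[OF norm_snd_le[of "snd p" "fst p" for p, simplified]])
    have disp: "linear (\<lambda>p. \<epsilon> *\<^sub>R disp \<tau> p)" "norm (\<epsilon> *\<^sub>R disp \<tau> p) \<le> cq * norm p" for \<tau> p
    proof -
      show "linear (\<lambda>p. \<epsilon> *\<^sub>R disp \<tau> p)" by (intro linear_compose_scale_right linear_disp)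
      have "norm (\<epsilon> *\<^sub>R disp \<tau> p) \<le> 1 * norm (disp \<tau> p)" unfolding norm_scaleR using \<epsilon> by (intro mult_right_mono) auto
      then show "norm (\<epsilon> *\<^sub>R disp \<tau> p) \<le> cq * norm p" using norm_disp_le[of \<tau> p] by simp
    qed
    have rot: "linear (\<lambda>y. rot (- \<tau>) ((1 / b0) *\<^sub>R y))" "norm (rot (- \<tau>) ((1 / b0) *\<^sub>R y)) \<le> cq * norm y" for \<tau> y
    proof -
      show "linear (\<lambda>y. rot (- \<tau>) ((1 / b0) *\<^sub>R y))"
        by (rule linearI) (simp_all add: rot_add rot_scaleR scaleR_add_right)
      show "norm (rot (- \<tau>) ((1 / b0) *\<^sub>R y)) \<le> cq * norm y"
        using mult_right_mono[OF time(2), of "norm y"] b0_pos by simp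
    qed
    have 2: "c11 (cq * (cq * cq * ME)) (T * b0) r (\<lambda>s \<tau> p. rot (- \<tau>) ((1 / b0) *\<^sub>R E \<epsilon> (1 / b0 * s) (x0 + \<epsilon> *\<^sub>R disp \<tau> p)))"
      using cq_ge_1
      by (intro c11_linear_image[where A = "\<lambda>\<tau> y. rot (- \<tau>) ((1 / b0) *\<^sub>R y)"] rot
          c11_compose_linear[OF ME[OF \<epsilon>] r disp(1) cq_ge_1 disp(2) time]) auto
    have "c11 (cq * (A * 1 + 5 * r * (cq * cq * Mb) + 2 * (cq * cq * Mb) * 1 + cq * (cq * cq * ME))) (T * b0) r
        (\<lambda>s \<tau> p. ((1 / b0) *\<^sub>R rot \<tau> (J *v rhs_Y \<epsilon> s \<tau> p), rhs_Y \<epsilon> s \<tau> p))"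
    proof (rule c11_linear_image[where A = "\<lambda>\<tau> y. ((1 / b0) *\<^sub>R rot \<tau> (J *v y), y)"])
      show "c11 (A * 1 + 5 * r * (cq * cq * Mb) + 2 * (cq * cq * Mb) * 1 + cq * (cq * cq * ME)) (T * b0) r (rhs_Y \<epsilon>)"
        using c11_add[OF 1 2] unfolding rhs_Y_def[abs_def] by simp
      show "linear (\<lambda>y. ((1 / b0) *\<^sub>R rot \<tau> (J *v y), y))" for \<tau>
        by (rule linearI) (simp_all add: matrix_vector_right_distrib matrix_vector_mult_scaleR rot_add rot_scaleR scaleR_add_right)
    qed (use cq_ge_1 norm_pair_le in auto)
    then show ?thesis unfolding rhs_def[abs_def] .
  qed
  then show thesis by (rule that)
qed

subsection \<open>Prepared initial data\<close>

definition lift :: "real \<Rightarrow> real \<Rightarrow> real^2 \<Rightarrow> real^2 \<Rightarrow> (real^2) \<times> (real^2)" where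
  "lift \<epsilon> \<tau> x y = ((1 / \<epsilon>) *\<^sub>R (x - x0) + (1 / b0) *\<^sub>R rot \<tau> (J *v y), y)"

lemma snd_lift [simp]: "snd (lift \<epsilon> \<tau> x y) = y"
  by (simp add: lift_def)

lemma disp_lift [simp]: "disp \<tau> (lift \<epsilon> \<tau> x y) = (1 / \<epsilon>) *\<^sub>R (x - x0)"
  by (simp add: disp_def lift_def)

lemma norm_lift_le: "norm (lift \<epsilon> \<tau> x y) \<le> norm ((1 / \<epsilon>) *\<^sub>R (x - x0)) + cq * norm y"
proof -
  have "lift \<epsilon> \<tau> x y = ((1 / \<epsilon>) *\<^sub>R (x - x0), 0) + ((1 / b0) *\<^sub>R rot \<tau> (J *v y), y)"
    by (simp add: lift_def)
  then show ?thesis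
    using norm_triangle_ineq[of "((1 / \<epsilon>) *\<^sub>R (x - x0), 0)" "((1 / b0) *\<^sub>R rot \<tau> (J *v y), y)"] norm_pair_le[of \<tau> y]
    by (simp add: norm_Pair)
qed

lemma lift_has_derivative_along:
  assumes "(g has_real_derivative g') (at t within A)"
    "(x has_vector_derivative x') (at t within A)" "(y has_vector_derivative y') (at t within A)"
  shows "((\<lambda>s. lift \<epsilon> (g s) (x s) (y s)) has_vector_derivative
    ((1 / \<epsilon>) *\<^sub>R x' - (g' / b0) *\<^sub>R rot (g t) (y t) + (1 / b0) *\<^sub>R rot (g t) (J *v y'), y')) (at t within A)"
proof -
  have Jy: "((\<lambda>s. J *v y s) has_vector_derivative J *v y') (at t within A)"
    by (rule bounded_linear.has_vector_derivative[OF bounded_linear_J assms(3)])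
  have "((\<lambda>s. rot (g s) (J *v y s)) has_vector_derivative g' *\<^sub>R rot (g t) (J *v (J *v y t)) + rot (g t) (J *v y')) (at t within A)"
    by (rule has_vector_derivative_rot[OF assms(1) Jy])
  then have r: "((\<lambda>s. (1 / b0) *\<^sub>R rot (g s) (J *v y s)) has_vector_derivative
      (1 / b0) *\<^sub>R (g' *\<^sub>R rot (g t) (J *v (J *v y t)) + rot (g t) (J *v y'))) (at t within A)"
    by (rule scaleR_has_vd)
  have "((\<lambda>s. x s - x0) has_vector_derivative x' - 0) (at t within A)"
    by (rule has_vector_derivative_diff[OF assms(2) has_vector_derivative_const])
  then have "((\<lambda>s. (1 / \<epsilon>) *\<^sub>R (x s - x0)) has_vector_derivative (1 / \<epsilon>) *\<^sub>R (x' - 0)) (at t within A)"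
    by (rule scaleR_has_vd)
  note has_vector_derivative_add[OF this r]
  from has_vector_derivative_Pair[OF this assms(3)] show ?thesis
    unfolding lift_def by (simp add: rot_minus algebra_simps)
qed

lemma lift_has_derivative:
  assumes "(x has_vector_derivative x') (at t)" "(y has_vector_derivative y') (at t)"
  shows "((\<lambda>\<tau>. lift \<epsilon> \<tau> (x \<tau>) (y \<tau>)) has_vector_derivative
    ((1 / \<epsilon>) *\<^sub>R x' - (1 / b0) *\<^sub>R rot t (y t) + (1 / b0) *\<^sub>R rot t (J *v y'), y')) (at t)"
  by (rule lift_has_derivative_along[OF DERIV_ident assms])

lemma X_1st_eq: "X_1st b x0 v0 \<epsilon> \<tau> = x0 - (\<epsilon> / b0) *\<^sub>R (rot \<tau> (J *v v0) - J *v v0)"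
  by (simp add: X_1st_def matrix_vector_mult_diff_rdistrib mexp_mult_vec J_rot matrix_vector_mult_diff_distrib
      flip: matrix_vector_mul_assoc)

lemma X_1st_has_derivative:
  "(X_1st b x0 v0 \<epsilon> has_vector_derivative (\<epsilon> / b0) *\<^sub>R rot \<tau> v0) (at \<tau>)"
proof -
  have "((\<lambda>\<tau>. rot \<tau> (J *v v0)) has_vector_derivative 1 *\<^sub>R rot \<tau> (J *v (J *v v0)) + rot \<tau> 0) (at \<tau>)"
    by (rule has_vector_derivative_rot) (auto intro!: derivative_eq_intros)
  then show ?thesis
    unfolding X_1st_eq[abs_def]
    by (auto intro!: derivative_eq_intros simp: rot_minus) (simp add: rot_def algebra_simps)
qed

lemma continuous_b: "continuous_on A b"
proof -
  have "continuous_on UNIV (iter_partial UNIV [] b)"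
    using b_C3 unfolding Ck_on_def by (metis empty_subsetI le0 list.set(1) list.size(3))
  then show ?thesis using continuous_on_subset by simp blast
qed

text \<open>The displacement (X - x0) / \<epsilon> of the first-order datum \<open>X_1st\<close>,
  which is independent of \<epsilon>.\<close>

definition q1 :: "real \<Rightarrow> real^2" where
  "q1 \<tau> = (1 / b0) *\<^sub>R (J *v v0 - rot \<tau> (J *v v0))"

lemma X_1st_q1: "X_1st b x0 v0 \<epsilon> \<tau> = x0 + \<epsilon> *\<^sub>R q1 \<tau>"
  by (simp add: X_1st_eq q1_def algebra_simps)

lemma norm_q1_le: "norm (q1 \<tau>) \<le> 2 * norm v0 / b0"
  using norm_triangle_ineq4[of "J *v v0" "rot \<tau> (J *v v0)"] b0_pos
  by (simp add: q1_def divide_right_mono)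

definition \<phi>1 :: "real \<Rightarrow> real \<Rightarrow> real" where
  "\<phi>1 \<epsilon> \<tau> = rel_b \<epsilon> (q1 \<tau>)"

lemma continuous_\<phi>1: "continuous_on UNIV (\<phi>1 \<epsilon>)"
  unfolding \<phi>1_def rel_b_def q1_def
  using less_imp_neq[OF b0_pos, symmetric] by (intro continuous_intros continuous_on_compose2[OF continuous_b]) auto

lemma b_X_1st:
  assumes "0 < \<epsilon>"
  shows "b (X_1st b x0 v0 \<epsilon> \<tau>) / b0 - 1 = \<epsilon> * \<phi>1 \<epsilon> \<tau>"
  unfolding \<phi>1_def rel_b_def X_1st_q1 using assms by simp

text \<open>The derivative is \<epsilon> times the leading forcing of Y with the mean of
  \<open>\<phi>1\<close> removed. The field term needs no subtraction since e^{-\<tau>J} already has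
  mean zero.\<close>

lemma Y_1st_has_derivative:
  assumes \<epsilon>: "0 < \<epsilon>"
  shows "(Y_1st b E x0 v0 \<epsilon> has_vector_derivative
    \<epsilon> *\<^sub>R ((\<phi>1 \<epsilon> \<tau> - avg (\<phi>1 \<epsilon>)) *\<^sub>R (J *v v0) + rot (- \<tau>) ((1 / b0) *\<^sub>R E \<epsilon> 0 x0))) (at \<tau>)"
proof -
  define e0 where "e0 = (1 / b0) *\<^sub>R E \<epsilon> 0 x0"
  have osc: "osc (\<lambda>\<sigma>. b (X_1st b x0 v0 \<epsilon> \<sigma>) / b0 - 1) = (\<lambda>\<sigma>. \<epsilon> * (\<phi>1 \<epsilon> \<sigma> - avg (\<phi>1 \<epsilon>)))"
    using avg_scaleR[OF continuous_\<phi>1, of \<epsilon> \<epsilon>] by (auto simp: osc_def b_X_1st[OF \<epsilon>] algebra_simps)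
  have "((\<lambda>t. rot (- t) (J *v e0)) has_vector_derivative (-1) *\<^sub>R rot (- \<tau>) (J *v (J *v e0)) + rot (- \<tau>) 0) (at \<tau>)"
    by (rule has_vector_derivative_rot) (auto intro!: derivative_eq_intros)
  then have r: "((\<lambda>t. rot (- t) (J *v e0)) has_vector_derivative rot (- \<tau>) e0) (at \<tau>)"
    by (simp add: rot_minus) (simp add: rot_def)
  have i: "((\<lambda>t. LBINT \<sigma>=0..ereal t. \<epsilon> * (\<phi>1 \<epsilon> \<sigma> - avg (\<phi>1 \<epsilon>))) has_vector_derivative \<epsilon> * (\<phi>1 \<epsilon> \<tau> - avg (\<phi>1 \<epsilon>))) (at \<tau>)"
    by (rule interval_integral_has_derivative) (intro continuous_intros continuous_\<phi>1)
  have Y: "Y_1st b E x0 v0 \<epsilon> = (\<lambda>t. v0 + (LBINT \<sigma>=0..ereal t. \<epsilon> * (\<phi>1 \<epsilon> \<sigma> - avg (\<phi>1 \<epsilon>))) *\<^sub>R (J *v v0)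
      + \<epsilon> *\<^sub>R (rot (- t) (J *v e0) - J *v e0))"
    unfolding Y_1st_def osc
    by (simp add: e0_def[symmetric] matrix_vector_mult_diff_rdistrib mexp_mult_vec J_rot matrix_vector_mult_diff_distrib
      flip: matrix_vector_mul_assoc scaleR_minus_left)
  show ?thesis unfolding Y e0_def[symmetric]
  proof -
    have "((\<lambda>t. v0 + (LBINT \<sigma>=0..ereal t. \<epsilon> * (\<phi>1 \<epsilon> \<sigma> - avg (\<phi>1 \<epsilon>))) *\<^sub>R (J *v v0)
        + \<epsilon> *\<^sub>R (rot (- t) (J *v e0) - J *v e0)) has_vector_derivative
        (0 + (\<epsilon> * (\<phi>1 \<epsilon> \<tau> - avg (\<phi>1 \<epsilon>))) *\<^sub>R (J *v v0)) + \<epsilon> *\<^sub>R (rot (- \<tau>) e0 - 0)) (at \<tau>)"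
      by (intro has_vector_derivative_add scaleR_has_vd has_vector_derivative_diff r has_vector_derivative_const
          bounded_linear.has_vector_derivative[OF bounded_linear_scaleR_left i])
    then show "((\<lambda>t. v0 + (LBINT \<sigma>=0..ereal t. \<epsilon> * (\<phi>1 \<epsilon> \<sigma> - avg (\<phi>1 \<epsilon>))) *\<^sub>R (J *v v0)
        + \<epsilon> *\<^sub>R (rot (- t) (J *v e0) - J *v e0)) has_vector_derivative
        \<epsilon> *\<^sub>R ((\<phi>1 \<epsilon> \<tau> - avg (\<phi>1 \<epsilon>)) *\<^sub>R (J *v v0) + rot (- \<tau>) e0)) (at \<tau>)"
      by (simp add: scaleR_add_right)
  qed
qed

text \<open>\<open>A_op\<close> differentiates back to its argument without the mean; the second
  term arises because L_inv A e^{\<tau>J} has derivative -J e^{\<tau>J}.\<close>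

lemma X_2nd_has_derivative:
  assumes \<epsilon>: "0 < \<epsilon>"
  shows "(X_2nd b E x0 v0 \<epsilon> has_vector_derivative
    (\<epsilon> / b0) *\<^sub>R (rot \<tau> (Y_1st b E x0 v0 \<epsilon> \<tau>) - avg (\<lambda>\<sigma>. rot \<sigma> (Y_1st b E x0 v0 \<epsilon> \<sigma>)))
      + (\<epsilon>\<^sup>2 / b0) *\<^sub>R rot \<tau> (J *v (avg (\<phi>1 \<epsilon>) *\<^sub>R (J *v v0)))) (at \<tau>)"
proof -
  define w where "w = avg (\<phi>1 \<epsilon>) *\<^sub>R (J *v v0)"
  have "continuous_on UNIV (Y_1st b E x0 v0 \<epsilon>)"
    by (rule continuous_on_vector_derivative) (rule has_vector_derivative_at_within[OF Y_1st_has_derivative[OF \<epsilon>]])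
  then have A: "(A_op (\<lambda>\<sigma>. rot \<sigma> (Y_1st b E x0 v0 \<epsilon> \<sigma>)) has_vector_derivative
      rot \<tau> (Y_1st b E x0 v0 \<epsilon> \<tau>) - avg (\<lambda>\<sigma>. rot \<sigma> (Y_1st b E x0 v0 \<epsilon> \<sigma>))) (at \<tau>)"
    using A_op_has_derivative[of "\<lambda>\<sigma>. rot \<sigma> (Y_1st b E x0 v0 \<epsilon> \<sigma>)" \<tau>] by (simp add: osc_def continuous_intros)
  have w: "avg (\<lambda>\<sigma>. (1 / \<epsilon>) * (b (X_1st b x0 v0 \<epsilon> \<sigma>) / b x0 - 1)) *\<^sub>R (J *v v0) = w"
    unfolding b_X_1st[OF \<epsilon>] using \<epsilon> by (simp add: w_def)
  have "(h_2nd b E x0 v0 \<epsilon> has_vector_derivative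
      (\<epsilon> / b0) *\<^sub>R (rot \<tau> (Y_1st b E x0 v0 \<epsilon> \<tau>) - avg (\<lambda>\<sigma>. rot \<sigma> (Y_1st b E x0 v0 \<epsilon> \<sigma>)))
      - (\<epsilon>\<^sup>2 / b0) *\<^sub>R (- rot \<tau> (J *v w))) (at \<tau>)"
    unfolding h_2nd_def[abs_def] w mexp_mult_vec
    by (rule has_vector_derivative_diff[OF scaleR_has_vd[OF A] scaleR_has_vd[OF L_inv_A_op_mexp_has_derivative]])
  then have "((\<lambda>\<tau>. x0 + h_2nd b E x0 v0 \<epsilon> \<tau> - h_2nd b E x0 v0 \<epsilon> 0) has_vector_derivative
      (0 + ((\<epsilon> / b0) *\<^sub>R (rot \<tau> (Y_1st b E x0 v0 \<epsilon> \<tau>) - avg (\<lambda>\<sigma>. rot \<sigma> (Y_1st b E x0 v0 \<epsilon> \<sigma>)))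
      - (\<epsilon>\<^sup>2 / b0) *\<^sub>R (- rot \<tau> (J *v w)))) - 0) (at \<tau>)"
    by (intro has_vector_derivative_diff has_vector_derivative_add has_vector_derivative_const)
  then show ?thesis unfolding X_2nd_def[abs_def] w_def by simp
qed

lemma Y_1st_0: "Y_1st b E x0 v0 \<epsilon> 0 = v0"
  using mexp_J[of 0] by (simp add: Y_1st_def zero_ereal_def[symmetric])

text \<open>
  With \<open>\<Pi>\<phi>\<close> the mean of \<open>(b(X\<^sup>1\<^sup>s\<^sup>t) / b\<^sub>0 - 1) / \<epsilon>\<close> and \<open>a\<close> the mean of \<open>e\<^bsup>\<tau>J\<^esup> Y\<^sup>1\<^sup>s\<^sup>t\<close>, the initial
  slow derivative is the constant \<open>(a / (\<epsilon> b\<^sub>0), \<Pi>\<phi> J v\<^sub>0)\<close> plus \<open>(J e\<^bsup>\<tau>J\<^esup> G / b\<^sub>0, G)\<close>, where \<open>G\<close> is \<open>O(\<epsilon>)\<close>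
  together with its Lipschitz constant.
\<close>

lemma initial_slow_derivative:
  assumes \<epsilon>: "0 < \<epsilon>"
  defines "X0 \<equiv> X_2nd b E x0 v0 \<epsilon>" and "Y1 \<equiv> Y_1st b E x0 v0 \<epsilon>"
  defines "P0 \<equiv> \<lambda>\<tau>. lift \<epsilon> \<tau> (X0 \<tau>) (Y1 \<tau>)"
  defines "q0 \<equiv> \<lambda>\<tau>. (1 / \<epsilon>) *\<^sub>R (X0 \<tau> - x0)"
  defines "G \<equiv> \<lambda>\<tau>. (rel_b \<epsilon> (q0 \<tau>) - \<phi>1 \<epsilon> \<tau>) *\<^sub>R (J *v v0) + rel_b \<epsilon> (q0 \<tau>) *\<^sub>R (J *v (Y1 \<tau> - v0))
      + rot (- \<tau>) ((1 / b0) *\<^sub>R (E \<epsilon> 0 (X0 \<tau>) - E \<epsilon> 0 x0))"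
  defines "a \<equiv> avg (\<lambda>\<sigma>. rot \<sigma> (Y1 \<sigma>))"
  obtains Q where "\<And>\<tau>. (P0 has_vector_derivative Q \<tau>) (at \<tau>)"
    "\<And>\<tau>. rhs \<epsilon> 0 \<tau> (P0 \<tau>) - (1 / \<epsilon>) *\<^sub>R Q \<tau>
      = ((1 / (\<epsilon> * b0)) *\<^sub>R a, avg (\<phi>1 \<epsilon>) *\<^sub>R (J *v v0)) + ((1 / b0) *\<^sub>R rot \<tau> (J *v G \<tau>), G \<tau>)"
proof -
  define w where "w = avg (\<phi>1 \<epsilon>) *\<^sub>R (J *v v0)"
  define Y' where "Y' \<tau> = (\<phi>1 \<epsilon> \<tau> - avg (\<phi>1 \<epsilon>)) *\<^sub>R (J *v v0) + rot (- \<tau>) ((1 / b0) *\<^sub>R E \<epsilon> 0 x0)" for \<tau>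
  define X' where "X' \<tau> = (\<epsilon> / b0) *\<^sub>R (rot \<tau> (Y1 \<tau>) - a) + (\<epsilon>\<^sup>2 / b0) *\<^sub>R rot \<tau> (J *v w)" for \<tau>
  define Q where "Q \<tau> = ((1 / \<epsilon>) *\<^sub>R X' \<tau> - (1 / b0) *\<^sub>R rot \<tau> (Y1 \<tau>) + (1 / b0) *\<^sub>R rot \<tau> (J *v (\<epsilon> *\<^sub>R Y' \<tau>)), \<epsilon> *\<^sub>R Y' \<tau>)" for \<tau>
  show thesis
  proof (rule that[of Q])
    fix \<tau>
    show "(P0 has_vector_derivative Q \<tau>) (at \<tau>)"
      unfolding P0_def Q_def
    proof (rule lift_has_derivative)
      show "(X0 has_vector_derivative X' \<tau>) (at \<tau>)"
        unfolding X0_def X'_def a_def w_def Y1_def by (rule X_2nd_has_derivative[OF \<epsilon>])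
      show "(Y1 has_vector_derivative \<epsilon> *\<^sub>R Y' \<tau>) (at \<tau>)"
        unfolding Y1_def Y'_def by (rule Y_1st_has_derivative[OF \<epsilon>])
    qed
    have X0: "x0 + \<epsilon> *\<^sub>R q0 \<tau> = X0 \<tau>" using \<epsilon> by (simp add: q0_def)
    \<comment> \<open>\<open>Y'\<close> is the leading forcing minus its mean \<open>w\<close>;
      \<open>G\<close> collects the errors of replacing q0 by q1, Y1 by v0 and X0 by x0.\<close>
    have rY: "rhs_Y \<epsilon> 0 \<tau> (P0 \<tau>) = w + G \<tau> + Y' \<tau>"
    proof -
      have "disp \<tau> (P0 \<tau>) = q0 \<tau>" "snd (P0 \<tau>) = Y1 \<tau>" by (simp_all add: P0_def q0_def)
      then show ?thesis
        by (simp only: rhs_Y_def X0 G_def Y'_def w_def rot_diff rot_scaleR div_0)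
           (simp add: matrix_vector_mult_diff_distrib algebra_simps)
    qed
    \<comment> \<open>The rotated Y1 of order 1/\<epsilon> in \<open>X'\<close> cancels against the
      derivative of the rotation inside \<open>lift\<close>. The \<epsilon>^2 correction in
      \<open>X_2nd\<close> is there to cancel J e^{\<tau>J} w / b0, which would otherwise oscillate
      at order one.\<close>
    have fst_eq: "(1 / b0) *\<^sub>R rot \<tau> (J *v (w + G \<tau> + Y' \<tau>)) - (1 / \<epsilon>) *\<^sub>R ((1 / \<epsilon>) *\<^sub>R X' \<tau> - (1 / b0) *\<^sub>R rot \<tau> (Y1 \<tau>) + (1 / b0) *\<^sub>R rot \<tau> (J *v (\<epsilon> *\<^sub>R Y' \<tau>)))
      = (1 / (\<epsilon> * b0)) *\<^sub>R a + (1 / b0) *\<^sub>R rot \<tau> (J *v G \<tau>)"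
    proof -
      have "(1 / \<epsilon>) *\<^sub>R ((1 / \<epsilon>) *\<^sub>R X' \<tau>) = (1 / (\<epsilon> * b0)) *\<^sub>R (rot \<tau> (Y1 \<tau>) - a) + (1 / b0) *\<^sub>R rot \<tau> (J *v w)"
        using \<epsilon> by (simp add: X'_def scaleR_add_right power2_eq_square)
      moreover have "(1 / \<epsilon>) *\<^sub>R ((1 / b0) *\<^sub>R rot \<tau> (J *v (\<epsilon> *\<^sub>R Y' \<tau>))) = (1 / b0) *\<^sub>R rot \<tau> (J *v Y' \<tau>)"
        using \<epsilon> by (simp add: matrix_vector_mult_scaleR rot_scaleR)
      ultimately show ?thesis
        by (simp add: scaleR_add_right scaleR_diff_right matrix_vector_right_distrib rot_add)
    qed
    show "rhs \<epsilon> 0 \<tau> (P0 \<tau>) - (1 / \<epsilon>) *\<^sub>R Q \<tau>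
      = ((1 / (\<epsilon> * b0)) *\<^sub>R a, avg (\<phi>1 \<epsilon>) *\<^sub>R (J *v v0)) + ((1 / b0) *\<^sub>R rot \<tau> (J *v G \<tau>), G \<tau>)"
      unfolding rhs_def rY Q_def w_def[symmetric] using fst_eq \<epsilon> by (simp add: algebra_simps)
  qed
qed

abbreviation initial_P :: "real \<Rightarrow> real \<Rightarrow> (real^2) \<times> (real^2)" where
  "initial_P \<epsilon> \<tau> \<equiv> lift \<epsilon> \<tau> (X_2nd b E x0 v0 \<epsilon> \<tau>) (Y_1st b E x0 v0 \<epsilon> \<tau>)"

text \<open>Quantifying over every derivative \<open>Q\<close> allows the bounds to be applied to
  the one supplied by the solution; uniqueness of derivatives makes this equivalent to fixing
  one.\<close>

definition prepared :: "real \<Rightarrow> real \<Rightarrow> bool" where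
  "prepared \<kappa> \<epsilon> \<longleftrightarrow> (\<forall>\<tau>. norm (initial_P \<epsilon> \<tau>) \<le> \<kappa>) \<and>
    (\<forall>Q. (\<forall>\<tau>. (initial_P \<epsilon> has_vector_derivative Q \<tau>) (at \<tau>)) \<longrightarrow>
      (let V0 = \<lambda>\<tau>. rhs \<epsilon> 0 \<tau> (initial_P \<epsilon> \<tau>) - (1 / \<epsilon>) *\<^sub>R Q \<tau> in
        (\<forall>\<tau>. norm (V0 \<tau>) \<le> \<kappa>) \<and> (\<forall>\<tau> \<tau>'. norm (V0 \<tau> - V0 \<tau>') \<le> \<kappa> * \<epsilon> * \<bar>\<tau> - \<tau>'\<bar>)))"

text \<open>Everything is measured through slopes in \<tau>, and periodicity converts slopes into
  sizes. Periodicity of the data is a hypothesis here; in the application it is inherited from the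
  solution at s = 0.\<close>

lemma initial_data_prepared:
  obtains \<kappa> where "0 \<le> \<kappa>"
    "\<And>\<epsilon>. \<lbrakk>\<epsilon> \<in> {0<..1}; torus_fun (X_2nd b E x0 v0 \<epsilon>); torus_fun (Y_1st b E x0 v0 \<epsilon>)\<rbrakk> \<Longrightarrow> prepared \<kappa> \<epsilon>"
proof -
  obtain m where m: "0 \<le> m" "\<And>\<epsilon> t. \<lbrakk>\<epsilon> \<in> {0<..1}; t \<in> {0..T}\<rbrakk> \<Longrightarrow> norm (E \<epsilon> t x0) \<le> m"
    using E_x0_bounded by blast
  \<comment> \<open>\<open>B1\<close> bounds \<open>\<phi>1\<close>. \<open>BY\<close> is the slope
    of Y1 and \<open>BA\<close> the size of Y1 - v0 and of the mean a, all divided by \<epsilon>;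
    \<open>BD\<close> is the slope of X0 - X1 over \<epsilon>^2 and \<open>BX\<close> that of X0
    over \<epsilon>. The radius \<open>rq\<close> contains q0 and q1, and \<open>G1\<close>,
    \<open>G2\<close> are size and slope of G over \<epsilon>. Each factor \<open>2 * pi\<close>
    turns a slope into a size.\<close>
  define Lb where "Lb = C_b / b0"
  define V where "V = norm v0"
  define B1 where "B1 = Lb * (2 * V / b0)"
  define BY where "BY = 2 * B1 * V + m / b0"
  define BA where "BA = BY * (2 * pi)"
  define BD where "BD = (2 * BA + B1 * V) / b0"
  define BX where "BX = V / b0 + BD"
  define rq where "rq = 2 * V / b0 + BX * (2 * pi)"
  obtain Mb where b_c11: "\<And>\<epsilon>. \<epsilon> \<in> {0<..1} \<Longrightarrow> c11 Mb 0 rq (\<lambda>s \<tau>. rel_b \<epsilon>)"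
    using rel_b_c11[of 0 rq] by blast
  have Mb: "0 \<le> Mb" using c11_nonneg[OF b_c11[of 1]] by simp
  define BE where "BE = C_E / b0 * BX"
  define G1 where "G1 = (Lb * (BD * (2 * pi))) * V + (Lb * (BX * (2 * pi))) * BA + BE * (2 * pi)"
  define G2 where "G2 = (Mb * (BD + V / b0 * (BD * (2 * pi)))) * V + ((Lb * BX) * BA + (Lb * (BX * (2 * pi))) * BY) + (BE * (2 * pi) + BE)"
  have nn: "0 \<le> Lb" "0 \<le> V" "0 \<le> B1" "0 \<le> BY" "0 \<le> BA" "0 \<le> BD" "0 \<le> BX" "0 \<le> rq" "0 \<le> BE" "0 \<le> G1" "0 \<le> G2" "0 < b0" "0 \<le> 2 * pi"
    using b0_pos C_b_pos C_E_pos m(1) Mb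
    by (simp_all add: Lb_def V_def B1_def BY_def BA_def BD_def BX_def rq_def BE_def G1_def G2_def)
  define \<kappa> where "\<kappa> = (BX * (2 * pi) + cq * (V + BA)) + (BA / b0 + B1 * V + cq * G1) + ((1 / b0) * (G1 + G2) + G2)"
  have parts: "0 \<le> BX * (2 * pi) + cq * (V + BA)" "0 \<le> BA / b0 + B1 * V + cq * G1" "0 \<le> (1 / b0) * (G1 + G2) + G2"
    using nn cq_ge_1 by simp_all
  have main: "prepared \<kappa> \<epsilon>"
    if \<epsilon>: "\<epsilon> \<in> {0<..1}" and per: "torus_fun (X_2nd b E x0 v0 \<epsilon>)" "torus_fun (Y_1st b E x0 v0 \<epsilon>)" for \<epsilon>
  proof -
    have \<epsilon>0: "0 < \<epsilon>" "\<epsilon> \<le> 1" using \<epsilon> by auto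
    define X0 Y1 X1 where "X0 = X_2nd b E x0 v0 \<epsilon>" and "Y1 = Y_1st b E x0 v0 \<epsilon>" and "X1 = X_1st b x0 v0 \<epsilon>"
    define q0 where "q0 \<tau> = (1 / \<epsilon>) *\<^sub>R (X0 \<tau> - x0)" for \<tau>
    define a where "a = avg (\<lambda>\<sigma>. rot \<sigma> (Y1 \<sigma>))"
    define w where "w = avg (\<phi>1 \<epsilon>) *\<^sub>R (J *v v0)"
    have \<phi>1: "\<bar>\<phi>1 \<epsilon> \<tau>\<bar> \<le> B1" for \<tau>
    proof -
      have "\<bar>\<phi>1 \<epsilon> \<tau>\<bar> \<le> Lb * norm (q1 \<tau>)" unfolding \<phi>1_def Lb_def by (rule rel_b_bound[OF \<epsilon>0(1)])
      also have "\<dots> \<le> B1" unfolding B1_def V_def using nn norm_q1_le by (intro mult_left_mono) auto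
      finally show ?thesis .
    qed
    have avg\<phi>: "\<bar>avg (\<phi>1 \<epsilon>)\<bar> \<le> B1"
      using norm_avg_le[OF continuous_\<phi>1, of \<epsilon> B1] \<phi>1 by simp
    have w: "norm w \<le> B1 * V" unfolding w_def V_def using avg\<phi> by (simp add: mult_right_mono)
    have Y_lip: "norm (Y1 t - Y1 t') \<le> (\<epsilon> * BY) * \<bar>t - t'\<bar>" for t t'
    proof (rule lipschitz_of_vector_derivative[OF Y_1st_has_derivative[OF \<epsilon>0(1), folded Y1_def]])
      fix \<tau>
      have "norm ((\<phi>1 \<epsilon> \<tau> - avg (\<phi>1 \<epsilon>)) *\<^sub>R (J *v v0)) \<le> (2 * B1) * V"
        unfolding norm_scaleR norm_J V_def using \<phi>1[of \<tau>] avg\<phi> by (intro mult_right_mono) auto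
      moreover have "norm (rot (- \<tau>) ((1 / b0) *\<^sub>R E \<epsilon> 0 x0)) \<le> m / b0"
        using m(2)[OF \<epsilon>, of 0] T_pos b0_pos by (simp add: divide_right_mono)
      ultimately show "norm (\<epsilon> *\<^sub>R ((\<phi>1 \<epsilon> \<tau> - avg (\<phi>1 \<epsilon>)) *\<^sub>R (J *v v0) + rot (- \<tau>) ((1 / b0) *\<^sub>R E \<epsilon> 0 x0))) \<le> \<epsilon> * BY"
        unfolding BY_def norm_scaleR using \<epsilon>0 by (simp add: norm_triangle_mono)
    qed
    have Y_near: "norm (Y1 \<tau> - v0) \<le> \<epsilon> * BA" for \<tau>
      using periodic_lipschitz_bound[OF per(2)[folded Y1_def] _ Y_lip] by (simp add: Y1_def Y_1st_0 BA_def mult_ac)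
    have Y_cont: "continuous_on UNIV Y1"
      by (rule continuous_on_vector_derivative)
         (rule has_vector_derivative_at_within[OF Y_1st_has_derivative[OF \<epsilon>0(1), folded Y1_def]])
    \<comment> \<open>The mean of e^{\<sigma>J} v0 vanishes, so only Y1 - v0 contributes.\<close>
    have a: "norm a \<le> \<epsilon> * BA"
    proof -
      have "a = avg (\<lambda>\<sigma>. rot \<sigma> (Y1 \<sigma> - v0)) + avg (\<lambda>\<sigma>. rot \<sigma> v0)"
        unfolding a_def by (subst avg_add[symmetric]) (auto intro!: continuous_intros Y_cont simp: rot_diff)
      also have "avg (\<lambda>\<sigma>. rot \<sigma> v0) = 0"
        unfolding rot_def by (rule avg_trig)
      finally show ?thesis
        using Y_near by (simp add: norm_avg_le continuous_intros Y_cont)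
    qed
    have X_der: "(X0 has_vector_derivative (\<epsilon> / b0) *\<^sub>R (rot \<tau> (Y1 \<tau>) - a) + (\<epsilon>\<^sup>2 / b0) *\<^sub>R rot \<tau> (J *v w)) (at \<tau>)" for \<tau>
      unfolding X0_def Y1_def a_def w_def by (rule X_2nd_has_derivative[OF \<epsilon>0(1)])
    \<comment> \<open>Both derivatives have the leading part (\<epsilon> / b0) e^{\<tau>J} v0; the
      remainder is of order \<epsilon>^2 since Y1 - v0 and a are of order \<epsilon>.\<close>
    have D_lip: "norm ((X0 t - X1 t) - (X0 t' - X1 t')) \<le> (\<epsilon>\<^sup>2 * BD) * \<bar>t - t'\<bar>" for t t'
    proof (rule lipschitz_of_vector_derivative[where u = "\<lambda>t. X0 t - X1 t"])
      show "((\<lambda>t. X0 t - X1 t) has_vector_derivative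
          ((\<epsilon> / b0) *\<^sub>R (rot t (Y1 t) - a) + (\<epsilon>\<^sup>2 / b0) *\<^sub>R rot t (J *v w)) - (\<epsilon> / b0) *\<^sub>R rot t v0) (at t)" for t
        unfolding X1_def by (rule has_vector_derivative_diff[OF X_der X_1st_has_derivative])
      fix t
      have eq: "((\<epsilon> / b0) *\<^sub>R (rot t (Y1 t) - a) + (\<epsilon>\<^sup>2 / b0) *\<^sub>R rot t (J *v w)) - (\<epsilon> / b0) *\<^sub>R rot t v0
          = (\<epsilon> / b0) *\<^sub>R (rot t (Y1 t - v0) - a) + (\<epsilon>\<^sup>2 / b0) *\<^sub>R rot t (J *v w)"
        by (simp add: rot_diff algebra_simps)
      have "norm (rot t (Y1 t - v0) - a) \<le> \<epsilon> * (2 * BA)"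
        using norm_triangle_ineq4[of "rot t (Y1 t - v0)" a] Y_near[of t] a by simp
      then have 1: "norm ((\<epsilon> / b0) *\<^sub>R (rot t (Y1 t - v0) - a)) \<le> (\<epsilon> / b0) * (\<epsilon> * (2 * BA))"
        using \<epsilon>0 b0_pos unfolding norm_scaleR by (intro mult_mono) auto
      have 2: "norm ((\<epsilon>\<^sup>2 / b0) *\<^sub>R rot t (J *v w)) \<le> (\<epsilon>\<^sup>2 / b0) * (B1 * V)"
        using w b0_pos unfolding norm_scaleR by (intro mult_mono) auto
      have "(\<epsilon> / b0) * (\<epsilon> * (2 * BA)) + (\<epsilon>\<^sup>2 / b0) * (B1 * V) = \<epsilon>\<^sup>2 * BD"
        by (simp add: BD_def power2_eq_square add_divide_distrib distrib_left mult_ac)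
      with norm_triangle_mono[OF 1 2]
      show "norm (((\<epsilon> / b0) *\<^sub>R (rot t (Y1 t) - a) + (\<epsilon>\<^sup>2 / b0) *\<^sub>R rot t (J *v w)) - (\<epsilon> / b0) *\<^sub>R rot t v0) \<le> \<epsilon>\<^sup>2 * BD"
        unfolding eq by simp
    qed
    have X00: "X0 0 = x0" "X1 0 = x0" by (simp_all add: X0_def X1_def X_2nd_def X_1st_eq)
    have D_per: "torus_fun (\<lambda>t. X0 t - X1 t)"
      using per(1) unfolding X0_def X1_def periodic_fun_simple_def by (simp add: X_1st_eq)
    have D: "norm (X0 \<tau> - X1 \<tau>) \<le> \<epsilon>\<^sup>2 * (BD * (2 * pi))" for \<tau>
      using periodic_lipschitz_bound[OF D_per _ D_lip] by (simp add: X00 mult_ac)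
    have X1_lip: "norm (X1 t - X1 t') \<le> (\<epsilon> * (V / b0)) * \<bar>t - t'\<bar>" for t t'
      by (rule lipschitz_of_vector_derivative[OF X_1st_has_derivative[of \<epsilon>, folded X1_def]])
         (use \<epsilon>0 b0_pos in \<open>simp add: V_def\<close>)
    have X0_lip: "norm (X0 t - X0 t') \<le> (\<epsilon> * BX) * \<bar>t - t'\<bar>" for t t'
    proof -
      have "norm (X0 t - X0 t') \<le> (\<epsilon>\<^sup>2 * BD) * \<bar>t - t'\<bar> + (\<epsilon> * (V / b0)) * \<bar>t - t'\<bar>"
        using norm_triangle_mono[OF D_lip[of t t'] X1_lip[of t t']] by simp
      also have "\<dots> \<le> (\<epsilon> * BD) * \<bar>t - t'\<bar> + (\<epsilon> * (V / b0)) * \<bar>t - t'\<bar>"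
        using \<epsilon>0 nn by (intro add_right_mono mult_right_mono) (auto simp: power2_eq_square mult_left_le)
      finally show ?thesis by (simp add: BX_def algebra_simps)
    qed
    have X0_near: "norm (X0 \<tau> - x0) \<le> \<epsilon> * (BX * (2 * pi))" for \<tau>
      using periodic_lipschitz_bound[OF per(1)[folded X0_def] _ X0_lip] by (simp add: X00 mult_ac)
    have scale: "norm ((1 / \<epsilon>) *\<^sub>R x) \<le> c" if "norm x \<le> \<epsilon> * c" for x :: "real^2" and c
      using that \<epsilon>0 by (simp add: divide_le_eq mult.commute)
    have q0: "norm (q0 \<tau>) \<le> BX * (2 * pi)" for \<tau>
      unfolding q0_def by (rule scale[OF X0_near])
    have q0_lip: "norm (q0 t - q0 t') \<le> BX * \<bar>t - t'\<bar>" for t t'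
      using scale[of "X0 t - X0 t'" "BX * \<bar>t - t'\<bar>"] X0_lip[of t t']
      by (simp add: q0_def mult_ac flip: scaleR_diff_right)
    have q1_eq: "q1 \<tau> = (1 / \<epsilon>) *\<^sub>R (X1 \<tau> - x0)" for \<tau>
      using \<epsilon>0 by (simp add: X1_def X_1st_q1)
    have q01: "norm (q0 \<tau> - q1 \<tau>) \<le> \<epsilon> * (BD * (2 * pi))" for \<tau>
      using scale[of "X0 \<tau> - X1 \<tau>" "\<epsilon> * (BD * (2 * pi))"] D[of \<tau>]
      by (simp add: q0_def q1_eq power2_eq_square mult_ac flip: scaleR_diff_right)
    have q01_lip: "norm ((q0 t - q1 t) - (q0 t' - q1 t')) \<le> (\<epsilon> * BD) * \<bar>t - t'\<bar>" for t t'
      using scale[of "(X0 t - X1 t) - (X0 t' - X1 t')" "(\<epsilon> * BD) * \<bar>t - t'\<bar>"] D_lip[of t t']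
      by (simp add: q0_def q1_eq power2_eq_square mult_ac flip: scaleR_diff_right)
    have q1_lip: "norm (q1 t - q1 t') \<le> (V / b0) * \<bar>t - t'\<bar>" for t t'
      using scale[of "X1 t - X1 t'" "(V / b0) * \<bar>t - t'\<bar>"] X1_lip[of t t']
      by (simp add: q1_eq mult_ac flip: scaleR_diff_right)

    define f where "f \<tau> = rel_b \<epsilon> (q0 \<tau>)" for \<tau>
    define e where "e \<tau> = (1 / b0) *\<^sub>R (E \<epsilon> 0 (X0 \<tau>) - E \<epsilon> 0 x0)" for \<tau>
    define G where "G \<tau> = (f \<tau> - \<phi>1 \<epsilon> \<tau>) *\<^sub>R (J *v v0) + f \<tau> *\<^sub>R (J *v (Y1 \<tau> - v0)) + rot (- \<tau>) (e \<tau>)" for \<tau>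
    have f: "\<bar>f \<tau>\<bar> \<le> Lb * (BX * (2 * pi))" for \<tau>
      unfolding f_def using rel_b_bound[OF \<epsilon>0(1), of "q0 \<tau>"] mult_left_mono[OF q0[of \<tau>] nn(1)] by (simp add: Lb_def)
    have f_lip: "\<bar>f t - f t'\<bar> \<le> (Lb * BX) * \<bar>t - t'\<bar>" for t t'
      unfolding f_def using rel_b_lipschitz[OF \<epsilon>0(1), of "q0 t" "q0 t'"] mult_left_mono[OF q0_lip[of t t'] nn(1)]
      by (simp add: Lb_def mult_ac)
    have f\<phi>: "\<bar>f \<tau> - \<phi>1 \<epsilon> \<tau>\<bar> \<le> \<epsilon> * (Lb * (BD * (2 * pi)))" for \<tau>
      unfolding f_def \<phi>1_def using rel_b_lipschitz[OF \<epsilon>0(1), of "q0 \<tau>" "q1 \<tau>"] mult_left_mono[OF q01[of \<tau>] nn(1)]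
      by (simp add: Lb_def mult_ac)
    have f\<phi>_lip: "\<bar>(f t - \<phi>1 \<epsilon> t) - (f t' - \<phi>1 \<epsilon> t')\<bar> \<le> \<epsilon> * ((Mb * (BD + V / b0 * (BD * (2 * pi)))) * \<bar>t - t'\<bar>)" for t t'
    proof -
      have "0 \<le> 2 * V / b0" "0 \<le> BX * (2 * pi)" using nn by simp_all
      then have "norm (q0 \<tau>) \<le> rq" "norm (q1 \<tau>) \<le> rq" for \<tau>
        using q0[of \<tau>] norm_q1_le[of \<tau>] unfolding rq_def V_def by linarith+
      then have "\<bar>rel_b \<epsilon> (q0 t) - rel_b \<epsilon> (q1 t) - rel_b \<epsilon> (q0 t') + rel_b \<epsilon> (q1 t')\<bar>
          \<le> Mb * (norm (q0 t - q1 t - q0 t' + q1 t') + norm (q1 t - q1 t') * norm (q0 t' - q1 t'))"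
        using c11_second[OF b_c11[OF \<epsilon>], where s = 0 and h = 0 and d = 0] by simp
      also have "\<dots> \<le> Mb * ((\<epsilon> * BD) * \<bar>t - t'\<bar> + ((V / b0) * \<bar>t - t'\<bar>) * (\<epsilon> * (BD * (2 * pi))))"
        using q01_lip[of t t'] q1_lip[of t t'] q01[of t'] Mb nn
        by (intro mult_left_mono add_mono mult_mono) (auto simp: algebra_simps)
      finally show ?thesis by (simp add: f_def \<phi>1_def algebra_simps)
    qed
    have e: "norm (e \<tau>) \<le> \<epsilon> * (BE * (2 * pi))" for \<tau>
    proof -
      have "norm (E \<epsilon> 0 (X0 \<tau>) - E \<epsilon> 0 x0) \<le> C_E * norm (X0 \<tau> - x0)" using E_lipschitz \<epsilon> T_pos by auto
      also have "\<dots> \<le> C_E * (\<epsilon> * (BX * (2 * pi)))" using X0_near C_E_pos by (intro mult_left_mono) auto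
      finally have "(1 / b0) * norm (E \<epsilon> 0 (X0 \<tau>) - E \<epsilon> 0 x0) \<le> (1 / b0) * (C_E * (\<epsilon> * (BX * (2 * pi))))"
        using b0_pos by (intro mult_left_mono) auto
      then show ?thesis unfolding e_def norm_scaleR using b0_pos by (simp add: BE_def mult_ac)
    qed
    have e_lip: "norm (e t - e t') \<le> \<epsilon> * (BE * \<bar>t - t'\<bar>)" for t t'
    proof -
      have "norm (E \<epsilon> 0 (X0 t) - E \<epsilon> 0 (X0 t')) \<le> C_E * norm (X0 t - X0 t')" using E_lipschitz \<epsilon> T_pos by auto
      also have "\<dots> \<le> C_E * ((\<epsilon> * BX) * \<bar>t - t'\<bar>)" using X0_lip C_E_pos by (intro mult_left_mono) auto
      finally have "(1 / b0) * norm (E \<epsilon> 0 (X0 t) - E \<epsilon> 0 (X0 t')) \<le> (1 / b0) * (C_E * ((\<epsilon> * BX) * \<bar>t - t'\<bar>))"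
        using b0_pos by (intro mult_left_mono) auto
      moreover have "e t - e t' = (1 / b0) *\<^sub>R (E \<epsilon> 0 (X0 t) - E \<epsilon> 0 (X0 t'))" by (simp add: e_def algebra_simps)
      ultimately show ?thesis using b0_pos by (simp add: BE_def mult_ac)
    qed
    have G: "norm (G \<tau>) \<le> \<epsilon> * G1" for \<tau>
    proof -
      have 1: "norm ((f \<tau> - \<phi>1 \<epsilon> \<tau>) *\<^sub>R (J *v v0)) \<le> (\<epsilon> * (Lb * (BD * (2 * pi)))) * V"
        unfolding norm_scaleR norm_J V_def by (rule mult_right_mono[OF f\<phi>]) simp
      have 2: "norm (f \<tau> *\<^sub>R (J *v (Y1 \<tau> - v0))) \<le> (Lb * (BX * (2 * pi))) * (\<epsilon> * BA)"
        unfolding norm_scaleR norm_J using f Y_near nn by (intro mult_mono) auto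
      have 3: "norm (rot (- \<tau>) (e \<tau>)) \<le> \<epsilon> * (BE * (2 * pi))" using e by simp
      show ?thesis
        using norm_triangle_mono[OF norm_triangle_mono[OF 1 2] 3] by (simp add: G_def G1_def algebra_simps)
    qed
    have G_lip: "norm (G t - G t') \<le> (\<epsilon> * G2) * \<bar>t - t'\<bar>" for t t'
    proof -
      define d where "d = \<bar>t - t'\<bar>"
      have d: "0 \<le> d" by (simp add: d_def)
      have eq: "G t - G t' = ((f t - \<phi>1 \<epsilon> t) - (f t' - \<phi>1 \<epsilon> t')) *\<^sub>R (J *v v0)
          + ((f t - f t') *\<^sub>R (J *v (Y1 t - v0)) + f t' *\<^sub>R (J *v (Y1 t - Y1 t')))
          + ((rot (- t) (e t) - rot (- t') (e t)) + rot (- t') (e t - e t'))"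
        by (simp add: G_def rot_diff matrix_vector_mult_diff_distrib algebra_simps)
      have 1: "norm (((f t - \<phi>1 \<epsilon> t) - (f t' - \<phi>1 \<epsilon> t')) *\<^sub>R (J *v v0)) \<le> (\<epsilon> * ((Mb * (BD + V / b0 * (BD * (2 * pi)))) * d)) * V"
        unfolding norm_scaleR norm_J V_def d_def by (rule mult_right_mono[OF f\<phi>_lip[unfolded V_def]]) simp
      have 2: "norm ((f t - f t') *\<^sub>R (J *v (Y1 t - v0))) \<le> ((Lb * BX) * d) * (\<epsilon> * BA)"
        unfolding norm_scaleR norm_J using f_lip Y_near nn d by (intro mult_mono) (auto simp: d_def)
      have 3: "norm (f t' *\<^sub>R (J *v (Y1 t - Y1 t'))) \<le> (Lb * (BX * (2 * pi))) * ((\<epsilon> * BY) * d)"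
        unfolding norm_scaleR norm_J using f Y_lip nn d by (intro mult_mono) (auto simp: d_def)
      have 4: "norm (rot (- t) (e t) - rot (- t') (e t)) \<le> d * (\<epsilon> * (BE * (2 * pi)))"
        using rot_lipschitz[of "- t" "e t" "- t'"] mult_left_mono[OF e[of t] d] by (simp add: d_def abs_minus_commute)
      have 5: "norm (rot (- t') (e t - e t')) \<le> \<epsilon> * (BE * d)" using e_lip[of t t'] by (simp add: d_def)
      show ?thesis
        unfolding eq d_def[symmetric]
        using norm_triangle_mono[OF norm_triangle_mono[OF 1 norm_triangle_mono[OF 2 3]] norm_triangle_mono[OF 4 5]]
        by (simp add: G2_def algebra_simps)
    qed

    define W where "W \<tau> = ((1 / (\<epsilon> * b0)) *\<^sub>R a, w) + ((1 / b0) *\<^sub>R rot \<tau> (J *v G \<tau>), G \<tau>)" for \<tau>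
    obtain Q0 where Q0: "\<And>\<tau>. ((\<lambda>\<tau>. lift \<epsilon> \<tau> (X0 \<tau>) (Y1 \<tau>)) has_vector_derivative Q0 \<tau>) (at \<tau>)"
      "\<And>\<tau>. rhs \<epsilon> 0 \<tau> (lift \<epsilon> \<tau> (X0 \<tau>) (Y1 \<tau>)) - (1 / \<epsilon>) *\<^sub>R Q0 \<tau> = W \<tau>"
      using initial_slow_derivative[OF \<epsilon>0(1)]
      unfolding W_def G_def e_def f_def a_def w_def q0_def X0_def Y1_def by blast
    have W_le: "norm (W \<tau>) \<le> \<kappa>" for \<tau>
    proof -
      have 1: "norm ((1 / (\<epsilon> * b0)) *\<^sub>R a, w) \<le> BA / b0 + B1 * V"
      proof (rule order_trans[OF norm_Pair_le add_mono[OF _ w]])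
        have "norm ((1 / b0) *\<^sub>R ((1 / \<epsilon>) *\<^sub>R a)) \<le> (1 / b0) * BA"
          unfolding norm_scaleR[of "1 / b0"] using scale[OF a] b0_pos by (intro mult_mono) auto
        then show "norm ((1 / (\<epsilon> * b0)) *\<^sub>R a) \<le> BA / b0" by (simp add: mult.commute)
      qed
      have 2: "norm ((1 / b0) *\<^sub>R rot \<tau> (J *v G \<tau>), G \<tau>) \<le> cq * G1"
      proof (rule order_trans[OF norm_pair_le mult_left_mono])
        have "\<epsilon> * G1 \<le> G1" using \<epsilon>0 nn by (simp add: mult_left_le_one_le)
        then show "norm (G \<tau>) \<le> G1" using G[of \<tau>] by linarith
      qed (use cq_ge_1 in simp)
      have "norm (W \<tau>) \<le> BA / b0 + B1 * V + cq * G1"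
        unfolding W_def by (rule norm_triangle_mono[OF 1 2])
      then show ?thesis using parts unfolding \<kappa>_def by linarith
    qed
    have W_lip: "norm (W \<tau> - W \<tau>') \<le> \<kappa> * \<epsilon> * \<bar>\<tau> - \<tau>'\<bar>" for \<tau> \<tau>'
    proof -
      define d where "d = \<bar>\<tau> - \<tau>'\<bar>"
      \<comment> \<open>The constant part drops out, so the factor 1/\<epsilon> in front of a is
        harmless for the Lipschitz bound.\<close>
      have "W \<tau> - W \<tau>' = ((1 / b0) *\<^sub>R (rot \<tau> (J *v G \<tau>) - rot \<tau>' (J *v G \<tau>')), G \<tau> - G \<tau>')"
        by (simp add: W_def scaleR_diff_right)
      moreover have "norm (rot \<tau> (J *v G \<tau>) - rot \<tau>' (J *v G \<tau>')) \<le> d * (\<epsilon> * G1) + (\<epsilon> * G2) * d"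
      proof -
        have eq: "rot \<tau> (J *v G \<tau>) - rot \<tau>' (J *v G \<tau>') = (rot \<tau> (J *v G \<tau>) - rot \<tau>' (J *v G \<tau>)) + rot \<tau>' (J *v (G \<tau> - G \<tau>'))"
          by (simp add: matrix_vector_mult_diff_distrib rot_diff)
        show ?thesis
          unfolding eq
        proof (rule norm_triangle_mono)
          have "norm (rot \<tau> (J *v G \<tau>) - rot \<tau>' (J *v G \<tau>)) \<le> d * norm (G \<tau>)"
            using rot_lipschitz[of \<tau> "J *v G \<tau>" \<tau>'] by (simp add: d_def)
          also have "\<dots> \<le> d * (\<epsilon> * G1)" using G by (intro mult_left_mono) (auto simp: d_def)
          finally show "norm (rot \<tau> (J *v G \<tau>) - rot \<tau>' (J *v G \<tau>)) \<le> d * (\<epsilon> * G1)" .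
          show "norm (rot \<tau>' (J *v (G \<tau> - G \<tau>'))) \<le> (\<epsilon> * G2) * d"
            using G_lip[of \<tau> \<tau>'] by (simp add: d_def)
        qed
      qed
      then have "norm ((1 / b0) *\<^sub>R (rot \<tau> (J *v G \<tau>) - rot \<tau>' (J *v G \<tau>'))) \<le> (1 / b0) * (d * (\<epsilon> * G1) + (\<epsilon> * G2) * d)"
        unfolding norm_scaleR using b0_pos by (intro mult_mono) auto
      ultimately have "norm (W \<tau> - W \<tau>') \<le> (1 / b0) * (d * (\<epsilon> * G1) + (\<epsilon> * G2) * d) + (\<epsilon> * G2) * d"
        using G_lip[of \<tau> \<tau>', folded d_def] by (auto intro: order_trans[OF norm_Pair_le add_mono])
      then have "norm (W \<tau> - W \<tau>') \<le> ((1 / b0) * (G1 + G2) + G2) * \<epsilon> * d"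
        by (simp add: algebra_simps add_divide_distrib)
      also have "\<dots> \<le> \<kappa> * \<epsilon> * d"
        using parts \<epsilon>0 unfolding \<kappa>_def d_def by (intro mult_right_mono) auto
      finally show ?thesis by (simp add: d_def)
    qed
    have P_le: "norm (lift \<epsilon> \<tau> (X0 \<tau>) (Y1 \<tau>)) \<le> \<kappa>" for \<tau>
    proof -
      have "norm (lift \<epsilon> \<tau> (X0 \<tau>) (Y1 \<tau>)) \<le> BX * (2 * pi) + cq * (V + BA)"
      proof (rule order_trans[OF norm_lift_le add_mono])
        show "norm ((1 / \<epsilon>) *\<^sub>R (X0 \<tau> - x0)) \<le> BX * (2 * pi)" using q0 by (simp add: q0_def)
        have "norm (Y1 \<tau>) \<le> V + \<epsilon> * BA"
          using norm_triangle_sub[of "Y1 \<tau>" v0] Y_near[of \<tau>] by (simp add: V_def)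
        also have "\<dots> \<le> V + BA" using \<epsilon>0 nn by (simp add: mult_left_le_one_le)
        finally show "cq * norm (Y1 \<tau>) \<le> cq * (V + BA)" using cq_ge_1 by (intro mult_left_mono) auto
      qed
      then show ?thesis using parts unfolding \<kappa>_def by linarith
    qed
    have Q_unique: "Q \<tau> = Q0 \<tau>" if "\<forall>\<tau>. (initial_P \<epsilon> has_vector_derivative Q \<tau>) (at \<tau>)" for Q \<tau>
      using that Q0(1)[of \<tau>] unfolding X0_def Y1_def by (blast intro: vector_derivative_unique_at)
    show ?thesis
      unfolding prepared_def Let_def
    proof (intro conjI allI impI)
      show "norm (initial_P \<epsilon> \<tau>) \<le> \<kappa>" for \<tau> using P_le by (simp add: X0_def Y1_def)
      fix Q assume "\<forall>\<tau>. (initial_P \<epsilon> has_vector_derivative Q \<tau>) (at \<tau>)"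
      then have W: "rhs \<epsilon> 0 \<tau> (initial_P \<epsilon> \<tau>) - (1 / \<epsilon>) *\<^sub>R Q \<tau> = W \<tau>" for \<tau>
        using Q0(2)[of \<tau>] Q_unique by (simp add: X0_def Y1_def)
      fix \<tau> \<tau>'
      show "norm (rhs \<epsilon> 0 \<tau> (initial_P \<epsilon> \<tau>) - (1 / \<epsilon>) *\<^sub>R Q \<tau>) \<le> \<kappa>"
        unfolding W by (rule W_le)
      show "norm ((rhs \<epsilon> 0 \<tau> (initial_P \<epsilon> \<tau>) - (1 / \<epsilon>) *\<^sub>R Q \<tau>)
          - (rhs \<epsilon> 0 \<tau>' (initial_P \<epsilon> \<tau>') - (1 / \<epsilon>) *\<^sub>R Q \<tau>')) \<le> \<kappa> * \<epsilon> * \<bar>\<tau> - \<tau>'\<bar>"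
        unfolding W by (rule W_lip)
    qed
  qed
  have "0 \<le> \<kappa>" using parts by (simp add: \<kappa>_def)
  then show thesis using main by (rule that)
qed

subsection \<open>A priori bound and convergence\<close>

text \<open>Pure algebra: \<open>dx\<close> and \<open>dy\<close> are arbitrary vectors, so the same
  identity transforms both the slow derivative of the exact system and the backward difference of
  the scheme.\<close>

lemma lift_equation:
  assumes "dx + (1 / \<epsilon>) *\<^sub>R xt = (1 / b0) *\<^sub>R rot \<tau> y" "dy + (1 / \<epsilon>) *\<^sub>R yt = g"
  shows "((1 / \<epsilon>) *\<^sub>R dx + (1 / b0) *\<^sub>R rot \<tau> (J *v dy), dy)
      + (1 / \<epsilon>) *\<^sub>R ((1 / \<epsilon>) *\<^sub>R xt - (1 / b0) *\<^sub>R rot \<tau> y + (1 / b0) *\<^sub>R rot \<tau> (J *v yt), yt)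
    = ((1 / b0) *\<^sub>R rot \<tau> (J *v g), g)"
proof -
  have "(1 / \<epsilon>) *\<^sub>R dx = (1 / \<epsilon>) *\<^sub>R ((1 / b0) *\<^sub>R rot \<tau> y) - (1 / \<epsilon>) *\<^sub>R ((1 / \<epsilon>) *\<^sub>R xt)"
    unfolding assms(1)[symmetric] by (simp add: scaleR_add_right)
  moreover have "(1 / b0) *\<^sub>R rot \<tau> (J *v g) = (1 / b0) *\<^sub>R rot \<tau> (J *v dy) + (1 / \<epsilon>) *\<^sub>R ((1 / b0) *\<^sub>R rot \<tau> (J *v yt))"
    unfolding assms(2)[symmetric]
    by (simp add: matrix_vector_right_distrib matrix_vector_mult_scaleR rot_add rot_scaleR scaleR_add_right)
  ultimately show ?thesis
    using assms(2) by (simp add: scaleR_add_right scaleR_diff_right del: scaleR_scaleR)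
qed

lemma rhs_Y_lift:
  assumes "\<epsilon> \<noteq> 0"
  shows "rhs_Y \<epsilon> s \<tau> (lift \<epsilon> \<tau> x y)
    = ((1 / \<epsilon>) * (b x / b0 - 1)) *\<^sub>R (J *v y) + rot (- \<tau>) ((1 / b0) *\<^sub>R E \<epsilon> (s / b0) x)"
  using assms by (simp add: rhs_Y_def rel_b_def)

lemma torus_fun_lift:
  assumes "torus_fun x" "torus_fun y"
  shows "torus_fun (\<lambda>\<tau>. lift \<epsilon> \<tau> (x \<tau>) (y \<tau>))"
  using assms by (simp add: periodic_fun_simple_def lift_def)

lemma solution_characteristics:
  fixes \<tau> :: real
  assumes \<epsilon>: "\<epsilon> \<in> {0<..1}" and sol: "two_scale_solution b E T x0 v0 \<epsilon> X Y" and s: "s \<in> {0..T * b0}"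
  defines "\<xi> \<equiv> \<lambda>s. \<tau> + s / \<epsilon>" and "P \<equiv> \<lambda>s \<tau>. lift \<epsilon> \<tau> (X s \<tau>) (Y s \<tau>)"
  shows "((\<lambda>s. X s (\<xi> s)) has_vector_derivative (1 / b0) *\<^sub>R rot (\<xi> s) (Y s (\<xi> s))) (at s within {0..T * b0})"
    and "((\<lambda>s. Y s (\<xi> s)) has_vector_derivative rhs_Y \<epsilon> s (\<xi> s) (P s (\<xi> s))) (at s within {0..T * b0})"
    and "((\<lambda>s. P s (\<xi> s)) has_vector_derivative rhs \<epsilon> s (\<xi> s) (P s (\<xi> s))) (at s within {0..T * b0})"
proof -
  have \<epsilon>0: "\<epsilon> \<noteq> 0" using \<epsilon> by auto
  have S: "0 < T * b0" using T_pos b0_pos by simp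
  have CX: "Ck_on 1 (\<lambda>(s, \<tau>). X s \<tau>) ({0..T * b0} \<times> UNIV)" and CY: "Ck_on 1 (\<lambda>(s, \<tau>). Y s \<tau>) ({0..T * b0} \<times> UNIV)"
    using sol unfolding two_scale_solution_def by simp_all
  show X: "((\<lambda>s. X s (\<xi> s)) has_vector_derivative (1 / b0) *\<^sub>R rot (\<xi> s) (Y s (\<xi> s))) (at s within {0..T * b0})"
    using strip_characteristic[OF CX S s \<epsilon>0, of \<tau>] sol s
    unfolding two_scale_solution_def \<xi>_def by (simp add: mexp_mult_vec)
  show Y: "((\<lambda>s. Y s (\<xi> s)) has_vector_derivative rhs_Y \<epsilon> s (\<xi> s) (P s (\<xi> s))) (at s within {0..T * b0})"
    using strip_characteristic[OF CY S s \<epsilon>0, of \<tau>] sol s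
    unfolding two_scale_solution_def \<xi>_def P_def by (simp add: mexp_mult_vec rhs_Y_lift[OF \<epsilon>0] flip: scaleR_minus_left)
  have "(\<xi> has_real_derivative 1 / \<epsilon>) (at s within {0..T * b0})"
    unfolding \<xi>_def using \<epsilon>0 by (auto intro!: derivative_eq_intros)
  from lift_has_derivative_along[OF this X Y, of \<epsilon>]
  show "((\<lambda>s. P s (\<xi> s)) has_vector_derivative rhs \<epsilon> s (\<xi> s) (P s (\<xi> s))) (at s within {0..T * b0})"
    unfolding P_def rhs_def by (simp add: mult.commute)
qed

text \<open>The first stage is an energy estimate for the original unknowns along a characteristic:
  it bounds Y and X - x0 but gives no factor \<epsilon> for X - x0. With Y bounded, the forcing of
  the lifted unknown has linear growth, and Gronwall then yields X - x0 = O(\<epsilon>) as part of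
  the bound of \<open>lift\<close>. The absolute values in \<open>R\<close> allow any real
  \<kappa>.\<close>

lemma solution_bound:
  obtains R where "0 \<le> R"
    "\<And>\<epsilon> X Y s \<tau>. \<lbrakk>\<epsilon> \<in> {0<..1}; two_scale_solution b E T x0 v0 \<epsilon> X Y; \<And>\<tau>. norm (lift \<epsilon> \<tau> (X 0 \<tau>) (Y 0 \<tau>)) \<le> \<kappa>;
      s \<in> {0..T * b0}\<rbrakk> \<Longrightarrow> norm (lift \<epsilon> \<tau> (X s \<tau>) (Y s \<tau>)) \<le> R"
proof -
  define S where "S = T * b0"
  have S: "0 < S" using T_pos b0_pos by (simp add: S_def)
  obtain m where m: "0 \<le> m" "\<And>\<epsilon> t. \<lbrakk>\<epsilon> \<in> {0<..1}; t \<in> {0..T}\<rbrakk> \<Longrightarrow> norm (E \<epsilon> t x0) \<le> m"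
    using E_x0_bounded by blast
  define k where "k = (m + C_E + 1) / b0"
  have k: "0 \<le> k" using m(1) C_E_pos b0_pos by (simp add: k_def)
  define N0 where "N0 = \<kappa>\<^sup>2 + (cq * \<kappa>)\<^sup>2 + 1"
  define B where "B = sqrt (exp (k * S) * N0)"
  define L' where "L' = cq * (C_b / b0 * cq * B)"
  define C' where "C' = cq * ((m + C_E * B) / b0)"
  have B: "0 \<le> B" by (simp add: B_def N0_def)
  have L': "0 \<le> L'" using cq_ge_1 C_b_pos b0_pos B by (simp add: L'_def)
  have C': "0 \<le> C'" using cq_ge_1 C_E_pos b0_pos B m(1) by (simp add: C'_def)
  define R where "R = \<bar>exp ((L' + 1) * S) * (\<bar>\<kappa>\<bar> + C')\<bar>"
  show thesis
  proof (rule that[of R])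
    show "0 \<le> R" by (simp add: R_def)
    fix \<epsilon> X Y s \<tau>
    assume \<epsilon>: "\<epsilon> \<in> {0<..(1::real)}"
      and sol: "two_scale_solution b E T x0 v0 \<epsilon> X Y"
      and init: "\<And>\<tau>. norm (lift \<epsilon> \<tau> (X 0 \<tau>) (Y 0 \<tau>)) \<le> \<kappa>" and s: "s \<in> {0..T * b0}"
    have \<epsilon>0: "0 < \<epsilon>" "\<epsilon> \<le> 1" using \<epsilon> by auto
    note char = solution_characteristics[OF \<epsilon> sol]
    define \<tau>0 where "\<tau>0 = \<tau> - s / \<epsilon>"
    define \<xi> where "\<xi> r = \<tau>0 + r / \<epsilon>" for r
    define x y p where "x r = X r (\<xi> r)" and "y r = Y r (\<xi> r)" and "p r = lift \<epsilon> (\<xi> r) (x r) (y r)" for r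
    define F where "F r = (1 / b0) *\<^sub>R E \<epsilon> (r / b0) (x r)" for r
    define y' where "y' r = ((1 / \<epsilon>) * (b (x r) / b0 - 1)) *\<^sub>R (J *v y r) + rot (- \<xi> r) (F r)" for r
    have yd: "(y has_vector_derivative y' r) (at r within {0..S})" if "r \<in> {0..S}" for r
      using char(2)[of r \<tau>0] that \<epsilon>0 unfolding y_def x_def \<xi>_def S_def y'_def F_def by (simp add: rhs_Y_lift)
    have xd: "(x has_vector_derivative (1 / b0) *\<^sub>R rot (\<xi> r) (y r)) (at r within {0..S})" if "r \<in> {0..S}" for r
      using char(1)[of r \<tau>0] that unfolding y_def x_def \<xi>_def S_def by simp
    have F_le: "norm (F r) \<le> (m + C_E * norm (x r - x0)) / b0" if "r \<in> {0..S}" for r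
    proof -
      have t: "r / b0 \<in> {0..T}" using that b0_pos by (simp add: S_def pos_divide_le_eq)
      have "norm (E \<epsilon> (r / b0) (x r)) \<le> norm (E \<epsilon> (r / b0) x0) + norm (E \<epsilon> (r / b0) (x r) - E \<epsilon> (r / b0) x0)"
        by (rule norm_triangle_sub)
      also have "\<dots> \<le> m + C_E * norm (x r - x0)"
        using m(2)[OF \<epsilon> t] E_lipschitz \<epsilon> t by (intro add_mono) auto
      finally show ?thesis using b0_pos by (simp add: F_def divide_right_mono)
    qed
    \<comment> \<open>The summand 1 absorbs the force at x0, through 2 |y| \<le> |y|^2 + 1.\<close>
    define n where "n r = y r \<bullet> y r + (x r - x0) \<bullet> (x r - x0) + 1" for r
    have nd: "(n has_real_derivative 2 * (y r \<bullet> y' r) + 2 * ((x r - x0) \<bullet> ((1 / b0) *\<^sub>R rot (\<xi> r) (y r)))) (at r within {0..S})"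
      if r: "r \<in> {0..S}" for r
    proof -
      have "((\<lambda>r. x r - x0) has_vector_derivative (1 / b0) *\<^sub>R rot (\<xi> r) (y r) - 0) (at r within {0..S})"
        by (intro has_vector_derivative_diff xd r has_vector_derivative_const)
      from has_real_derivative_inner_self[OF this]
      have "((\<lambda>r. (x r - x0) \<bullet> (x r - x0)) has_real_derivative 2 * ((x r - x0) \<bullet> ((1 / b0) *\<^sub>R rot (\<xi> r) (y r)))) (at r within {0..S})"
        by simp
      from DERIV_add[OF DERIV_add[OF has_real_derivative_inner_self[OF yd[OF r]] this] DERIV_const[of 1]]
      show ?thesis unfolding n_def by (simp only: add_0_right)
    qed
    have n_bound: "n r \<le> exp (k * S) * N0" if r: "r \<in> {0..S}" for r
    proof -
      have "n r \<le> exp (k * r) * n 0"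
      proof (rule gronwall_scalar[OF nd _ r])
        fix t assume t: "t \<in> {0..S}"
        define Y X where "Y = norm (y t)" and "X = norm (x t - x0)"
        have YX: "0 \<le> Y" "0 \<le> X" by (auto simp: Y_def X_def)
        have nt: "n t = Y\<^sup>2 + X\<^sup>2 + 1" by (simp add: n_def Y_def X_def power2_norm_eq_inner)
        \<comment> \<open>The magnetic term does no work, so its coefficient of order 1/\<epsilon>
          disappears.\<close>
        have "y t \<bullet> y' t = y t \<bullet> rot (- \<xi> t) (F t)" by (simp add: y'_def inner_add_right)
        also have "\<dots> \<le> Y * norm (F t)" using norm_cauchy_schwarz[of "y t" "rot (- \<xi> t) (F t)"] by (simp add: Y_def)
        also have "\<dots> \<le> Y * ((m + C_E * X) / b0)"
          unfolding X_def by (rule mult_left_mono[OF F_le[OF t] YX(1)])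
        finally have 1: "y t \<bullet> y' t \<le> Y * ((m + C_E * X) / b0)" .
        have "(x t - x0) \<bullet> ((1 / b0) *\<^sub>R rot (\<xi> t) (y t)) \<le> X * ((1 / b0) * Y)"
          using norm_cauchy_schwarz[of "x t - x0" "(1 / b0) *\<^sub>R rot (\<xi> t) (y t)"] b0_pos by (simp add: X_def Y_def)
        with 1 have "2 * (y t \<bullet> y' t) + 2 * ((x t - x0) \<bullet> ((1 / b0) *\<^sub>R rot (\<xi> t) (y t)))
            \<le> 2 * (Y * ((m + C_E * X) / b0)) + 2 * (X * ((1 / b0) * Y))" by linarith
        also have "\<dots> = (m * (2 * Y) + C_E * (2 * Y * X) + 2 * Y * X) / b0"
          by (simp add: add_divide_distrib algebra_simps)
        also have "\<dots> \<le> (m * n t + C_E * n t + n t) / b0"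
        proof (intro divide_right_mono add_mono mult_left_mono)
          have "2 * Y \<le> Y\<^sup>2 + 1" "2 * Y * X \<le> Y\<^sup>2 + X\<^sup>2"
            using sum_squares_bound[of Y 1] sum_squares_bound[of Y X] by simp_all
          then show "2 * Y \<le> n t" "2 * Y * X \<le> n t" "2 * Y * X \<le> n t"
            unfolding nt using zero_le_power2[of X] by linarith+
        qed (use m(1) C_E_pos b0_pos in auto)
        also have "\<dots> = k * n t" by (simp add: k_def distrib_right add_divide_distrib)
        finally show "2 * (y t \<bullet> y' t) + 2 * ((x t - x0) \<bullet> ((1 / b0) *\<^sub>R rot (\<xi> t) (y t))) \<le> k * n t" .
      qed
      also have "\<dots> \<le> exp (k * S) * N0"
      proof (intro mult_mono)
        show "exp (k * r) \<le> exp (k * S)" using r k by (simp add: mult_left_mono)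
        have p0: "norm (p 0) \<le> \<kappa>" using init[of \<tau>0] by (simp add: p_def x_def y_def \<xi>_def)
        have "norm (y 0) \<le> norm (p 0)" unfolding p_def by (metis norm_snd_le prod.collapse snd_lift)
        then have 1: "norm (y 0) \<le> \<kappa>" using p0 by linarith
        have "x 0 - x0 = \<epsilon> *\<^sub>R disp (\<xi> 0) (p 0)" using \<epsilon>0 by (simp add: p_def)
        then have "norm (x 0 - x0) \<le> 1 * (cq * norm (p 0))"
          using \<epsilon>0 norm_disp_le[of "\<xi> 0" "p 0"] by (simp only: norm_scaleR) (intro mult_mono; simp)
        also have "\<dots> \<le> cq * \<kappa>" using p0 cq_ge_1 by (simp add: mult_left_mono)
        finally have 2: "norm (x 0 - x0) \<le> cq * \<kappa>" .
        show "n 0 \<le> N0"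
          unfolding n_def N0_def power2_norm_eq_inner[symmetric]
          by (intro add_mono power_mono 1 2) auto
        show "0 \<le> n 0" by (simp add: n_def)
      qed simp
      finally show ?thesis .
    qed
    have yB: "norm (y r) \<le> B" and xB: "norm (x r - x0) \<le> B" if "r \<in> {0..S}" for r
    proof -
      have "(norm (y r))\<^sup>2 + (norm (x r - x0))\<^sup>2 + 1 \<le> exp (k * S) * N0"
        using n_bound[OF that] by (simp only: n_def power2_norm_eq_inner)
      then have "(norm (y r))\<^sup>2 \<le> exp (k * S) * N0" "(norm (x r - x0))\<^sup>2 \<le> exp (k * S) * N0"
        using zero_le_power2[of "norm (y r)"] zero_le_power2[of "norm (x r - x0)"] by linarith+
      then show "norm (y r) \<le> B" "norm (x r - x0) \<le> B"
        unfolding B_def by (auto intro: real_le_rsqrt)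
    qed
    have "norm (p s) \<le> exp ((L' + 1) * s) * (norm (p 0) + C')"
    proof (rule gronwall_norm)
      show "s \<in> {0..S}" using s by (simp add: S_def)
      fix t assume t: "t \<in> {0..S}"
      show "(p has_vector_derivative rhs \<epsilon> t (\<xi> t) (p t)) (at t within {0..S})"
        using char(3)[of t \<tau>0] t unfolding p_def x_def y_def \<xi>_def S_def by simp
      have "norm (rhs \<epsilon> t (\<xi> t) (p t)) \<le> cq * norm (rhs_Y \<epsilon> t (\<xi> t) (p t))"
        unfolding rhs_def by (rule norm_pair_le)
      \<comment> \<open>Of the two factors of the magnetic term, the velocity is bounded by the
        energy estimate and the coefficient by |p|; their product is linear in |p|.\<close>
      also have "norm (rhs_Y \<epsilon> t (\<xi> t) (p t)) \<le> (C_b / b0 * (cq * norm (p t))) * B + (m + C_E * B) / b0"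
      proof -
        have "\<bar>rel_b \<epsilon> (disp (\<xi> t) (p t))\<bar> \<le> C_b / b0 * (cq * norm (p t))"
          using C_b_pos b0_pos by (intro order_trans[OF rel_b_bound[OF \<epsilon>0(1)]] mult_left_mono norm_disp_le) auto
        then have 1: "norm (rel_b \<epsilon> (disp (\<xi> t) (p t)) *\<^sub>R (J *v y t)) \<le> (C_b / b0 * (cq * norm (p t))) * B"
          unfolding norm_scaleR norm_J using yB[OF t] C_b_pos b0_pos cq_ge_1 by (intro mult_mono) auto
        have "(m + C_E * norm (x t - x0)) / b0 \<le> (m + C_E * B) / b0"
          using xB[OF t] C_E_pos b0_pos by (intro divide_right_mono add_left_mono mult_left_mono) auto
        then have 2: "norm (rot (- \<xi> t) (F t)) \<le> (m + C_E * B) / b0"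
          using F_le[OF t] by simp
        have "rhs_Y \<epsilon> t (\<xi> t) (p t) = rel_b \<epsilon> (disp (\<xi> t) (p t)) *\<^sub>R (J *v y t) + rot (- \<xi> t) (F t)"
          using \<epsilon>0 by (simp add: rhs_Y_def p_def F_def)
        then show ?thesis using norm_triangle_mono[OF 1 2] by simp
      qed
      finally show "norm (rhs \<epsilon> t (\<xi> t) (p t)) \<le> L' * norm (p t) + C'"
        using cq_ge_1 by (simp add: L'_def C'_def distrib_left mult_ac)
    qed (use L' C' in auto)
    also have "\<dots> \<le> exp ((L' + 1) * S) * (\<bar>\<kappa>\<bar> + C')"
      using init[of \<tau>0] s L' C' by (intro mult_mono add_mono) (auto simp: p_def x_def y_def \<xi>_def S_def mult_left_mono)
    also have "\<dots> \<le> R" by (simp add: R_def)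
    finally show "norm (lift \<epsilon> \<tau> (X s \<tau>) (Y s \<tau>)) \<le> R"
      by (simp add: p_def x_def y_def \<xi>_def \<tau>0_def)
  qed
qed

lemma solution_lift:
  assumes \<epsilon>: "\<epsilon> \<in> {0<..1}" and sol: "two_scale_solution b E T x0 v0 \<epsilon> X Y"
  defines "S \<equiv> T * b0" and "P \<equiv> \<lambda>s \<tau>. lift \<epsilon> \<tau> (X s \<tau>) (Y s \<tau>)"
  obtains V Q where
    "\<And>s \<tau>. s \<in> {0..S} \<Longrightarrow> ((\<lambda>s. P s \<tau>) has_vector_derivative V s \<tau>) (at s within {0..S})"
    "\<And>s \<tau>. s \<in> {0..S} \<Longrightarrow> (P s has_vector_derivative Q s \<tau>) (at \<tau>)"
    "\<And>s \<tau>. s \<in> {0..S} \<Longrightarrow> V s \<tau> + (1 / \<epsilon>) *\<^sub>R Q s \<tau> = rhs \<epsilon> s \<tau> (P s \<tau>)"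
    "\<And>\<tau>. continuous_on {0..S} (\<lambda>s. V s \<tau>)"
    "\<And>s. s \<in> {0..S} \<Longrightarrow> torus_fun (P s)"
proof -
  have \<epsilon>0: "0 < \<epsilon>" "\<epsilon> \<noteq> 0" using \<epsilon> by auto
  have S: "0 < S" using T_pos b0_pos by (simp add: S_def)
  define Xs Ys where "Xs s \<tau> = vector_derivative (\<lambda>s'. X s' \<tau>) (at s within {0..S})"
    and "Ys s \<tau> = vector_derivative (\<lambda>s'. Y s' \<tau>) (at s within {0..S})" for s \<tau>
  define Xt Yt where "Xt s \<tau> = vector_derivative (X s) (at \<tau>)" and "Yt s \<tau> = vector_derivative (Y s) (at \<tau>)" for s \<tau>
  have CX: "Ck_on 1 (\<lambda>(s, \<tau>). X s \<tau>) ({0..S} \<times> UNIV)" and CY: "Ck_on 1 (\<lambda>(s, \<tau>). Y s \<tau>) ({0..S} \<times> UNIV)"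
    and tor: "\<And>s. s \<in> {0..S} \<Longrightarrow> torus_fun (X s)" "\<And>s. s \<in> {0..S} \<Longrightarrow> torus_fun (Y s)"
    and eqX: "\<And>s \<tau>. s \<in> {0..S} \<Longrightarrow> Xs s \<tau> + (1 / \<epsilon>) *\<^sub>R Xt s \<tau> = (1 / b0) *\<^sub>R rot \<tau> (Y s \<tau>)"
    and eqY: "\<And>s \<tau>. s \<in> {0..S} \<Longrightarrow> Ys s \<tau> + (1 / \<epsilon>) *\<^sub>R Yt s \<tau> = rhs_Y \<epsilon> s \<tau> (P s \<tau>)"
    using sol \<epsilon>0 unfolding two_scale_solution_def S_def Xs_def Ys_def Xt_def Yt_def P_def
    by (simp_all add: mexp_mult_vec rhs_Y_lift flip: scaleR_minus_left)
  note X = C1_on_strip[OF CX S, folded Xs_def Xt_def] and Y = C1_on_strip[OF CY S, folded Ys_def Yt_def]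
  define V where "V s \<tau> = ((1 / \<epsilon>) *\<^sub>R Xs s \<tau> + (1 / b0) *\<^sub>R rot \<tau> (J *v Ys s \<tau>), Ys s \<tau>)" for s \<tau>
  define Q where "Q s \<tau> = ((1 / \<epsilon>) *\<^sub>R Xt s \<tau> - (1 / b0) *\<^sub>R rot \<tau> (Y s \<tau>) + (1 / b0) *\<^sub>R rot \<tau> (J *v Yt s \<tau>), Yt s \<tau>)" for s \<tau>
  show thesis
  proof (rule that[of V Q])
    fix s \<tau> assume s: "s \<in> {0..S}"
    have "((\<lambda>s. \<tau>) has_real_derivative 0) (at s within {0..S})" by simp
    from lift_has_derivative_along[OF this X(1)[OF s] Y(1)[OF s], of \<epsilon>]
    show "((\<lambda>s. P s \<tau>) has_vector_derivative V s \<tau>) (at s within {0..S})"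
      unfolding P_def V_def by simp
    show "(P s has_vector_derivative Q s \<tau>) (at \<tau>)"
      unfolding P_def Q_def by (rule lift_has_derivative[OF X(2)[OF s] Y(2)[OF s]])
    show "V s \<tau> + (1 / \<epsilon>) *\<^sub>R Q s \<tau> = rhs \<epsilon> s \<tau> (P s \<tau>)"
      unfolding V_def Q_def rhs_def by (rule lift_equation[OF eqX[OF s] eqY[OF s]])
  next
    fix \<tau>
    show "continuous_on {0..S} (\<lambda>s. V s \<tau>)"
      unfolding V_def
      by (intro continuous_on_Pair continuous_on_add continuous_on_scaleR continuous_on_const continuous_on_rot
          bounded_linear.continuous_on[OF bounded_linear_J] X(3) Y(3))
  next
    fix s assume "s \<in> {0..S}"
    then show "torus_fun (P s)" unfolding P_def by (intro torus_fun_lift tor)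
  qed
qed

text \<open>The velocity rotated in \<open>lift\<close> is taken at the same step as the position,
  so the source at the new step cancels against the implicit \<tau>-derivative while F stays at the
  old step.\<close>

lemma scheme_lift:
  fixes Xn Yn :: "nat \<Rightarrow> real \<Rightarrow> real^2"
  assumes \<epsilon>: "\<epsilon> \<in> {0<..1}" and scheme: "two_scale_scheme b E T x0 v0 \<epsilon> \<Delta>t Xn Yn"
  defines "S \<equiv> T * b0" and "D \<equiv> b0 * \<Delta>t" and "Pn \<equiv> \<lambda>n \<tau>. lift \<epsilon> \<tau> (Xn n \<tau>) (Yn n \<tau>)"
  obtains Qn where
    "\<And>n \<tau>. real (Suc n) * D \<le> S \<Longrightarrow> (Pn (Suc n) has_vector_derivative Qn (Suc n) \<tau>) (at \<tau>)"
    "\<And>n. real (Suc n) * D \<le> S \<Longrightarrow> torus_fun (Pn (Suc n))"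
    "\<And>n \<tau>. real (Suc n) * D \<le> S \<Longrightarrow>
      (1 / D) *\<^sub>R (Pn (Suc n) \<tau> - Pn n \<tau>) + (1 / \<epsilon>) *\<^sub>R Qn (Suc n) \<tau> = rhs \<epsilon> (real n * D) \<tau> (Pn n \<tau>)"
proof -
  have \<epsilon>0: "0 < \<epsilon>" "\<epsilon> \<noteq> 0" using \<epsilon> by auto
  define Xt Yt where "Xt n \<tau> = vector_derivative (Xn n) (at \<tau>)" and "Yt n \<tau> = vector_derivative (Yn n) (at \<tau>)" for n \<tau>
  have time: "real n * D / b0 = real n * \<Delta>t" for n using b0_pos by (simp add: D_def)
  have step: "torus_fun (Xn (Suc n)) \<and> torus_fun (Yn (Suc n)) \<and>
      (\<forall>\<tau>. Xn (Suc n) differentiable at \<tau> \<and> Yn (Suc n) differentiable at \<tau> \<and>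
        (1 / D) *\<^sub>R (Xn (Suc n) \<tau> - Xn n \<tau>) + (1 / \<epsilon>) *\<^sub>R Xt (Suc n) \<tau> = (1 / b0) *\<^sub>R rot \<tau> (Yn (Suc n) \<tau>) \<and>
        (1 / D) *\<^sub>R (Yn (Suc n) \<tau> - Yn n \<tau>) + (1 / \<epsilon>) *\<^sub>R Yt (Suc n) \<tau> = rhs_Y \<epsilon> (real n * D) \<tau> (Pn n \<tau>))"
    if "real (Suc n) * D \<le> S" for n
    using scheme that unfolding two_scale_scheme_def Let_def D_def[symmetric] S_def[symmetric] Pn_def Xt_def Yt_def
      rhs_Y_lift[OF \<epsilon>0(2)] time mexp_mult_vec
    by blast
  define Qn where "Qn n \<tau> = ((1 / \<epsilon>) *\<^sub>R Xt n \<tau> - (1 / b0) *\<^sub>R rot \<tau> (Yn n \<tau>) + (1 / b0) *\<^sub>R rot \<tau> (J *v Yt n \<tau>), Yt n \<tau>)" for n \<tau>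
  show thesis
  proof (rule that[of Qn])
    fix n assume n: "real (Suc n) * D \<le> S"
    note st = step[OF n]
    show "torus_fun (Pn (Suc n))" unfolding Pn_def by (intro torus_fun_lift) (use st in auto)
    fix \<tau>
    show "(Pn (Suc n) has_vector_derivative Qn (Suc n) \<tau>) (at \<tau>)"
      unfolding Pn_def Qn_def Xt_def Yt_def
      by (intro lift_has_derivative vector_derivative_works[THEN iffD1]) (use st in auto)
    have "(1 / D) *\<^sub>R (Pn (Suc n) \<tau> - Pn n \<tau>)
        = ((1 / \<epsilon>) *\<^sub>R ((1 / D) *\<^sub>R (Xn (Suc n) \<tau> - Xn n \<tau>)) + (1 / b0) *\<^sub>R rot \<tau> (J *v ((1 / D) *\<^sub>R (Yn (Suc n) \<tau> - Yn n \<tau>))),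
           (1 / D) *\<^sub>R (Yn (Suc n) \<tau> - Yn n \<tau>))"
      unfolding Pn_def lift_def
      by (simp add: matrix_vector_mult_diff_distrib matrix_vector_mult_scaleR rot_diff rot_scaleR algebra_simps)
    then show "(1 / D) *\<^sub>R (Pn (Suc n) \<tau> - Pn n \<tau>) + (1 / \<epsilon>) *\<^sub>R Qn (Suc n) \<tau> = rhs \<epsilon> (real n * D) \<tau> (Pn n \<tau>)"
      unfolding Qn_def rhs_def using st by (simp only:) (intro lift_equation; blast)
  qed
qed

theorem uniform_convergence:
  obtains C R where "0 \<le> C" "0 \<le> R"
    "\<And>\<epsilon> X Y s \<tau>. \<lbrakk>\<epsilon> \<in> {0<..1}; two_scale_solution b E T x0 v0 \<epsilon> X Y; s \<in> {0..T * b0}\<rbrakk>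
      \<Longrightarrow> norm (lift \<epsilon> \<tau> (X s \<tau>) (Y s \<tau>)) \<le> R"
    "\<And>\<epsilon> X Y \<Delta>t Xn Yn n \<tau>. \<lbrakk>\<epsilon> \<in> {0<..1}; two_scale_solution b E T x0 v0 \<epsilon> X Y; 0 < \<Delta>t; C * (b0 * \<Delta>t) \<le> 1;
        two_scale_scheme b E T x0 v0 \<epsilon> \<Delta>t Xn Yn; real n * (b0 * \<Delta>t) \<le> T * b0\<rbrakk>
      \<Longrightarrow> norm (lift \<epsilon> \<tau> (Xn n \<tau>) (Yn n \<tau>) - lift \<epsilon> \<tau> (X (real n * (b0 * \<Delta>t)) \<tau>) (Y (real n * (b0 * \<Delta>t)) \<tau>)) \<le> C * (b0 * \<Delta>t)"
proof -
  define S where "S = T * b0"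
  have S: "0 < S" using T_pos b0_pos by (simp add: S_def)
  obtain \<kappa> where \<kappa>: "0 \<le> \<kappa>"
    and prep: "\<And>\<epsilon>. \<lbrakk>\<epsilon> \<in> {0<..1}; torus_fun (X_2nd b E x0 v0 \<epsilon>); torus_fun (Y_1st b E x0 v0 \<epsilon>)\<rbrakk> \<Longrightarrow> prepared \<kappa> \<epsilon>"
    using initial_data_prepared by blast
  obtain R where R: "0 \<le> R"
    and P_le: "\<And>\<epsilon> X Y s \<tau>. \<lbrakk>\<epsilon> \<in> {0<..1}; two_scale_solution b E T x0 v0 \<epsilon> X Y; \<And>\<tau>. norm (lift \<epsilon> \<tau> (X 0 \<tau>) (Y 0 \<tau>)) \<le> \<kappa>;
      s \<in> {0..T * b0}\<rbrakk> \<Longrightarrow> norm (lift \<epsilon> \<tau> (X s \<tau>) (Y s \<tau>)) \<le> R"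
    using solution_bound[where \<kappa> = \<kappa>] by blast
  have "0 \<le> R + 1" using R by simp
  then obtain L where L: "\<And>\<epsilon>. \<epsilon> \<in> {0<..1} \<Longrightarrow> c11 L (T * b0) (R + 1) (rhs \<epsilon>)"
    using rhs_c11 by blast
  have problem: "\<exists>V Q. transport_problem \<epsilon> S R L \<kappa> (rhs \<epsilon>) (\<lambda>s \<tau>. lift \<epsilon> \<tau> (X s \<tau>) (Y s \<tau>)) V Q"
    if \<epsilon>: "\<epsilon> \<in> {0<..1}" and sol: "two_scale_solution b E T x0 v0 \<epsilon> X Y" for \<epsilon> X Y
  proof -
    define P where "P = (\<lambda>s \<tau>. lift \<epsilon> \<tau> (X s \<tau>) (Y s \<tau>))"
    obtain V Q where
      V: "\<And>s \<tau>. s \<in> {0..S} \<Longrightarrow> ((\<lambda>s. P s \<tau>) has_vector_derivative V s \<tau>) (at s within {0..S})"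
      and Q: "\<And>s \<tau>. s \<in> {0..S} \<Longrightarrow> (P s has_vector_derivative Q s \<tau>) (at \<tau>)"
      and eq: "\<And>s \<tau>. s \<in> {0..S} \<Longrightarrow> V s \<tau> + (1 / \<epsilon>) *\<^sub>R Q s \<tau> = rhs \<epsilon> s \<tau> (P s \<tau>)"
      and cont: "\<And>\<tau>. continuous_on {0..S} (\<lambda>s. V s \<tau>)"
      and per: "\<And>s. s \<in> {0..S} \<Longrightarrow> torus_fun (P s)"
      unfolding P_def S_def
    proof (rule solution_lift[OF \<epsilon> sol], goal_cases)
      case (1 V Q)
      show ?case by (rule that[of V Q, unfolded P_def S_def]) (fact 1)+
    qed
    have S0: "0 \<in> {0..S}" using S by simp
    have X0: "X 0 = X_2nd b E x0 v0 \<epsilon>" and Y0: "Y 0 = Y_1st b E x0 v0 \<epsilon>"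
      and tor: "torus_fun (X 0)" "torus_fun (Y 0)"
      using sol S0 unfolding two_scale_solution_def S_def by auto
    have P0: "P 0 = initial_P \<epsilon>"
      by (simp add: P_def X0 Y0)
    have V0: "V 0 \<tau> = rhs \<epsilon> 0 \<tau> (initial_P \<epsilon> \<tau>) - (1 / \<epsilon>) *\<^sub>R Q 0 \<tau>" for \<tau>
      using eq[OF S0, of \<tau>] by (simp add: P0 eq_diff_eq)
    note init = prep[OF \<epsilon> tor[unfolded X0 Y0], unfolded prepared_def Let_def]
    have V0_bounds: "(\<forall>\<tau>. norm (V 0 \<tau>) \<le> \<kappa>) \<and> (\<forall>\<tau> \<tau>'. norm (V 0 \<tau> - V 0 \<tau>') \<le> \<kappa> * \<epsilon> * \<bar>\<tau> - \<tau>'\<bar>)"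
      unfolding V0 by (rule mp[OF spec[OF conjunct2[OF init]]]) (use Q[OF S0, unfolded P0] in blast)
    have bound: "norm (P s \<tau>) \<le> R" if "s \<in> {0..S}" for s \<tau>
      unfolding P_def
    proof (rule P_le[OF \<epsilon> sol])
      show "norm (lift \<epsilon> \<tau> (X 0 \<tau>) (Y 0 \<tau>)) \<le> \<kappa>" for \<tau> unfolding X0 Y0 using init by blast
    qed (use that in \<open>simp add: S_def\<close>)
    have P: "((\<lambda>s. P s (\<tau> + s / \<epsilon>)) has_vector_derivative rhs \<epsilon> s (\<tau> + s / \<epsilon>) (P s (\<tau> + s / \<epsilon>))) (at s within {0..S})"
      if "s \<in> {0..S}" for s \<tau>
      using solution_characteristics(3)[OF \<epsilon> sol, of s \<tau>] that by (simp add: P_def S_def)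
    have \<epsilon>0: "0 < \<epsilon>" using \<epsilon> by simp
    have "transport_problem \<epsilon> S R L \<kappa> (rhs \<epsilon>) P V Q"
    proof
      show "norm (V 0 \<tau>) \<le> \<kappa>" "norm (V 0 \<tau> - V 0 \<tau>') \<le> \<kappa> * \<epsilon> * \<bar>\<tau> - \<tau>'\<bar>" for \<tau> \<tau>'
        using V0_bounds by blast+
    qed (fact \<epsilon>0 S \<kappa> P V Q eq cont periodic_fun_simple.plus_period[OF per] bound L[OF \<epsilon>, folded S_def])+
    then show ?thesis unfolding P_def by blast
  qed
  \<comment> \<open>The exported constant of the locale depends on \<open>S\<close>,
    \<open>L\<close> and \<open>\<kappa>\<close> only: this is the uniformity in \<epsilon>.\<close>
  define C where "C = transport_problem.M S L \<kappa> * S * exp (L * S)"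
  show thesis
  \<comment> \<open>The absolute value supplies a nonnegative constant without requiring that a
    solution exist for some \<epsilon>.\<close>
  proof (rule that[of "\<bar>C\<bar>" R])
    show "0 \<le> \<bar>C\<bar>" "0 \<le> R" using R by auto
  next
    fix \<epsilon> X Y s \<tau> assume "\<epsilon> \<in> {0<..(1::real)}" "two_scale_solution b E T x0 v0 \<epsilon> X Y" "s \<in> {0..T * b0}"
    with problem obtain V Q where "transport_problem \<epsilon> S R L \<kappa> (rhs \<epsilon>) (\<lambda>s \<tau>. lift \<epsilon> \<tau> (X s \<tau>) (Y s \<tau>)) V Q" by blast
    then show "norm (lift \<epsilon> \<tau> (X s \<tau>) (Y s \<tau>)) \<le> R"
      by (rule transport_problem.P_bound) (use \<open>s \<in> {0..T * b0}\<close> in \<open>simp add: S_def\<close>)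
  next
    fix \<epsilon> X Y \<Delta>t Xn Yn n \<tau>
    assume \<epsilon>: "\<epsilon> \<in> {0<..(1::real)}" and sol: "two_scale_solution b E T x0 v0 \<epsilon> X Y" and \<Delta>t: "0 < \<Delta>t" "\<bar>C\<bar> * (b0 * \<Delta>t) \<le> 1"
      and scheme: "two_scale_scheme b E T x0 v0 \<epsilon> \<Delta>t Xn Yn" and n: "real n * (b0 * \<Delta>t) \<le> T * b0"
    define D where "D = b0 * \<Delta>t"
    have D: "0 < D" using \<Delta>t b0_pos by (simp add: D_def)
    have CD: "C * D \<le> \<bar>C\<bar> * D" using D by (intro mult_right_mono) auto
    obtain V Q where tp: "transport_problem \<epsilon> S R L \<kappa> (rhs \<epsilon>) (\<lambda>s \<tau>. lift \<epsilon> \<tau> (X s \<tau>) (Y s \<tau>)) V Q"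
      using problem[OF \<epsilon> sol] by blast
    define Pn where "Pn = (\<lambda>n \<tau>. lift \<epsilon> \<tau> (Xn n \<tau>) (Yn n \<tau>))"
    obtain Qn where
      Qn: "\<And>n \<tau>. real (Suc n) * D \<le> S \<Longrightarrow> (Pn (Suc n) has_vector_derivative Qn (Suc n) \<tau>) (at \<tau>)"
      and per: "\<And>n. real (Suc n) * D \<le> S \<Longrightarrow> torus_fun (Pn (Suc n))"
      and step: "\<And>n \<tau>. real (Suc n) * D \<le> S \<Longrightarrow>
        (1 / D) *\<^sub>R (Pn (Suc n) \<tau> - Pn n \<tau>) + (1 / \<epsilon>) *\<^sub>R Qn (Suc n) \<tau> = rhs \<epsilon> (real n * D) \<tau> (Pn n \<tau>)"
      unfolding D_def S_def Pn_def
    proof (rule scheme_lift[OF \<epsilon> scheme], goal_cases)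
      case (1 Qn)
      show ?case by (rule that[of Qn, unfolded D_def S_def Pn_def]) (fact 1)+
    qed
    have "norm (Pn n \<tau> - lift \<epsilon> \<tau> (X (real n * D) \<tau>) (Y (real n * D) \<tau>)) \<le> C * D"
      unfolding C_def
    proof (rule transport_problem.scheme_error[OF tp, where Pn = Pn and Qn = Qn])
      show "transport_problem.M S L \<kappa> * S * exp (L * S) * D \<le> 1"
        using CD \<Delta>t(2) unfolding C_def[symmetric] D_def by linarith
      show "Pn 0 \<tau> = lift \<epsilon> \<tau> (X 0 \<tau>) (Y 0 \<tau>)" for \<tau>
        using sol scheme unfolding Pn_def two_scale_solution_def two_scale_scheme_def Let_def by auto
    qed (use D Qn per step n in \<open>auto simp: D_def S_def\<close>)
    then show "norm (lift \<epsilon> \<tau> (Xn n \<tau>) (Yn n \<tau>) - lift \<epsilon> \<tau> (X (real n * (b0 * \<Delta>t)) \<tau>) (Y (real n * (b0 * \<Delta>t)) \<tau>)) \<le> \<bar>C\<bar> * (b0 * \<Delta>t)"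
      using CD unfolding Pn_def D_def by linarith
  qed
qed

end

section \<open>Return to the original unknowns\<close>

theorem theorem3p1:
  fixes T c0 C_E C_b :: real
    and x0 v0 :: "real^2"
    and b :: "real^2 \<Rightarrow> real"
    and E :: "real \<Rightarrow> real \<Rightarrow> real^2 \<Rightarrow> real^2"
  assumes "T > 0"
    and "c0 > 0" and "\<forall>x. b x \<ge> c0"
    and "C_E > 0" and "C_b > 0"
    and E_lipschitz: "\<forall>\<epsilon>\<in>{0<..1}. \<forall>t\<in>{0..T}. \<forall>x1 x2. norm (E \<epsilon> t x1 - E \<epsilon> t x2) \<le> C_E * norm (x1 - x2)"
    and b_lipschitz: "\<forall>x1 x2. \<bar>b x1 - b x2\<bar> \<le> C_b * norm (x1 - x2)"
    and E_C3: "\<forall>\<epsilon>\<in>{0<..1}. Ck_on 3 (\<lambda>(t, x). E \<epsilon> t x) ({0..T} \<times> UNIV)"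
    and E_bounded: "\<forall>K. compact K \<and> K \<subseteq> {0..T} \<times> UNIV \<longrightarrow>
          (\<exists>M. \<forall>\<epsilon>\<in>{0<..1}. \<forall>es. set es \<subseteq> Basis \<and> length es \<le> 3 \<longrightarrow>
             (\<forall>z\<in>K. norm (iter_partial ({0..T} \<times> UNIV) es (\<lambda>(t, x). E \<epsilon> t x) z) \<le> M))"
    and b_C3: "Ck_on 3 b UNIV"
  shows "\<exists>C0>0. \<exists>C1>0. \<exists>C2>0. \<forall>\<epsilon>\<in>{0<..1}. \<forall>X Y. two_scale_solution b E T x0 v0 \<epsilon> X Y \<longrightarrow>
          (\<forall>\<Delta>t>0. b x0 * \<Delta>t \<le> C0 \<longrightarrow> (\<forall>Xn Yn. two_scale_scheme b E T x0 v0 \<epsilon> \<Delta>t Xn Yn \<longrightarrow>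
            (\<forall>n::nat. real n \<le> T * b x0 / (b x0 * \<Delta>t) \<longrightarrow>
               (1 / \<epsilon>) * Linf_norm (\<lambda>\<tau>. Xn n \<tau> - X (real n * (b x0 * \<Delta>t)) \<tau>)
                 + Linf_norm (\<lambda>\<tau>. Yn n \<tau> - Y (real n * (b x0 * \<Delta>t)) \<tau>) \<le> C1 * (b x0 * \<Delta>t) \<and>
               Linf_norm (\<lambda>\<tau>. Xn n \<tau> - x0) \<le> C2 * \<epsilon> \<and>
               Linf_norm (Yn n) \<le> Linf_Linf_norm (T * b x0) Y + 1)))"
proof -
  interpret gyrating_particle T c0 C_E C_b x0 v0 b E
    by unfold_locales (fact assms)+
  obtain C R where C: "0 \<le> C" and R: "0 \<le> R"
    and P_le: "\<And>\<epsilon> X Y s \<tau>. \<lbrakk>\<epsilon> \<in> {0<..1}; two_scale_solution b E T x0 v0 \<epsilon> X Y; s \<in> {0..T * b0}\<rbrakk>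
      \<Longrightarrow> norm (lift \<epsilon> \<tau> (X s \<tau>) (Y s \<tau>)) \<le> R"
    and err: "\<And>\<epsilon> X Y \<Delta>t Xn Yn n \<tau>. \<lbrakk>\<epsilon> \<in> {0<..1}; two_scale_solution b E T x0 v0 \<epsilon> X Y; 0 < \<Delta>t; C * (b0 * \<Delta>t) \<le> 1;
        two_scale_scheme b E T x0 v0 \<epsilon> \<Delta>t Xn Yn; real n * (b0 * \<Delta>t) \<le> T * b0\<rbrakk>
      \<Longrightarrow> norm (lift \<epsilon> \<tau> (Xn n \<tau>) (Yn n \<tau>) - lift \<epsilon> \<tau> (X (real n * (b0 * \<Delta>t)) \<tau>) (Y (real n * (b0 * \<Delta>t)) \<tau>)) \<le> C * (b0 * \<Delta>t)"
  proof (rule uniform_convergence, goal_cases)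
    case 1
    show ?case by (rule that) (fact 1)+
  qed
  have main: "(1 / \<epsilon>) * Linf_norm (\<lambda>\<tau>. Xn n \<tau> - X (real n * (b x0 * \<Delta>t)) \<tau>)
        + Linf_norm (\<lambda>\<tau>. Yn n \<tau> - Y (real n * (b x0 * \<Delta>t)) \<tau>) \<le> ((cq + 1) * C + 1) * (b x0 * \<Delta>t)
      \<and> Linf_norm (\<lambda>\<tau>. Xn n \<tau> - x0) \<le> (cq * (R + 1)) * \<epsilon>
      \<and> Linf_norm (Yn n) \<le> Linf_Linf_norm (T * b x0) Y + 1"
    if \<epsilon>: "\<epsilon> \<in> {0<..1}" and sol: "two_scale_solution b E T x0 v0 \<epsilon> X Y" and \<Delta>t: "0 < \<Delta>t" "b x0 * \<Delta>t \<le> 1 / (C + 1)"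
      and scheme: "two_scale_scheme b E T x0 v0 \<epsilon> \<Delta>t Xn Yn" and n: "real n \<le> T * b x0 / (b x0 * \<Delta>t)"
    for \<epsilon> X Y \<Delta>t Xn Yn n
  proof -
    define D where "D = b0 * \<Delta>t"
    define s where "s = real n * D"
    have \<epsilon>0: "0 < \<epsilon>" using \<epsilon> by simp
    have D: "0 < D" using \<Delta>t b0_pos by (simp add: D_def)
    have nD: "s \<le> T * b0" using n D unfolding s_def D_def[symmetric] by (simp add: pos_le_divide_eq)
    have s: "s \<in> {0..T * b0}" using nD D by (simp add: s_def)
    have "(C + 1) * D \<le> 1" using \<Delta>t(2) C D unfolding D_def[symmetric] by (simp add: pos_le_divide_eq mult.commute)
    then have CD: "C * D \<le> 1" using D by (simp add: distrib_right)
    define p q where "p \<tau> = lift \<epsilon> \<tau> (Xn n \<tau>) (Yn n \<tau>)" and "q \<tau> = lift \<epsilon> \<tau> (X s \<tau>) (Y s \<tau>)" for \<tau>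
    have pq: "norm (p \<tau> - q \<tau>) \<le> C * D" for \<tau>
      using err[OF \<epsilon> sol \<Delta>t(1) CD[unfolded D_def] scheme nD[unfolded s_def D_def], of \<tau>]
      by (simp add: p_def q_def s_def D_def)
    have q: "norm (q \<tau>) \<le> R" for \<tau> unfolding q_def by (rule P_le[OF \<epsilon> sol s])
    have Y_err: "norm (Yn n \<tau> - Y s \<tau>) \<le> C * D" for \<tau>
    proof -
      have "Yn n \<tau> - Y s \<tau> = snd (p \<tau> - q \<tau>)" by (simp add: p_def q_def)
      also have "norm \<dots> \<le> norm (p \<tau> - q \<tau>)" by (metis norm_snd_le prod.collapse)
      finally show ?thesis using pq[of \<tau>] by linarith
    qed
    \<comment> \<open>\<open>disp\<close> inverts the change of unknown up to the factor \<epsilon>,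
      which provides the weight 1/\<epsilon> on the position error.\<close>
    have X_err: "norm (Xn n \<tau> - X s \<tau>) \<le> \<epsilon> * (cq * (C * D))" for \<tau>
    proof -
      have "Xn n \<tau> - X s \<tau> = \<epsilon> *\<^sub>R disp \<tau> (p \<tau> - q \<tau>)"
        using \<epsilon>0 by (simp add: disp_diff p_def q_def scaleR_diff_right)
      then have "norm (Xn n \<tau> - X s \<tau>) = \<epsilon> * norm (disp \<tau> (p \<tau> - q \<tau>))" using \<epsilon>0 by simp
      also have "\<dots> \<le> \<epsilon> * (cq * (C * D))"
        using \<epsilon>0 cq_ge_1 by (intro mult_left_mono order_trans[OF norm_disp_le] pq) auto
      finally show ?thesis .
    qed
    have X_near: "norm (Xn n \<tau> - x0) \<le> (cq * (R + 1)) * \<epsilon>" for \<tau>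
    proof -
      have "norm (p \<tau>) \<le> R + 1"
        using norm_triangle_sub[of "p \<tau>" "q \<tau>"] pq[of \<tau>] q[of \<tau>] CD by linarith
      then have "norm (disp \<tau> (p \<tau>)) \<le> cq * (R + 1)"
        using cq_ge_1 by (intro order_trans[OF norm_disp_le] mult_left_mono) auto
      moreover have "Xn n \<tau> - x0 = \<epsilon> *\<^sub>R disp \<tau> (p \<tau>)" using \<epsilon>0 by (simp add: p_def)
      ultimately show ?thesis using \<epsilon>0 by (simp add: mult.commute mult_left_mono)
    qed
    have Y_le: "norm (Y s \<tau>) \<le> R" if "s \<in> {0..T * b0}" for s \<tau>
      using P_le[OF \<epsilon> sol that, of \<tau>] by (metis norm_snd_le order_trans prod.collapse snd_lift)
    have "(1 / \<epsilon>) * Linf_norm (\<lambda>\<tau>. Xn n \<tau> - X s \<tau>) \<le> (1 / \<epsilon>) * (\<epsilon> * (cq * (C * D)))"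
      using \<epsilon>0 by (intro mult_left_mono Linf_norm_le X_err) auto
    moreover have "Linf_norm (\<lambda>\<tau>. Yn n \<tau> - Y s \<tau>) \<le> C * D" by (rule Linf_norm_le[OF Y_err])
    ultimately have 1: "(1 / \<epsilon>) * Linf_norm (\<lambda>\<tau>. Xn n \<tau> - X s \<tau>) + Linf_norm (\<lambda>\<tau>. Yn n \<tau> - Y s \<tau>) \<le> ((cq + 1) * C + 1) * D"
      using \<epsilon>0 D by (simp add: algebra_simps)
    have 2: "Linf_norm (\<lambda>\<tau>. Xn n \<tau> - x0) \<le> (cq * (R + 1)) * \<epsilon>" by (rule Linf_norm_le[OF X_near])
    have 3: "Linf_norm (Yn n) \<le> Linf_Linf_norm (T * b x0) Y + 1"
      by (rule Linf_norm_le_Linf_Linf[OF s Y_le]) (use Y_err CD order_trans in blast)+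
    from 1 2 3 show ?thesis unfolding s_def D_def by blast
  qed
  \<comment> \<open>The step bound 1 / (C + 1) gives C D \<le> 1 and is positive even if C = 0; the
    added 1 in (cq + 1) C + 1 serves the same purpose.\<close>
  have "0 < 1 / (C + 1)" "0 < (cq + 1) * C + 1" "0 < cq * (R + 1)"
    using C R cq_ge_1 by (auto intro!: mult_pos_pos add_nonneg_pos)
  with main show ?thesis by blast
qed

end
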